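(* Let $G$ be a compact connected Lie group that is locally isomorphic to a product of copies of $\mathrm{SU}(2)$ and $\mathrm{U}(1)$, and let $n>2$. Consider the unitary representation of $\mathrm{Out}(F_n)$ on $L^2(\mathrm{Hom}(F_n,G)/G)$ induced by the measure-preserving action of $\mathrm{Out}(F_n)$ on $\mathrm{Hom}(F_n,G)/G$. Then the only invariant finite-dimensional subrepresentation consists of constants; that is, every finite-dimensional $\mathrm{Out}(F_n)$-invariant linear subspace of $L^2(\mathrm{Hom}(F_n,G)/G)$ consists of (almost everywhere) constant functions.
   Context: $F_n$ is the free group of rank $n$ and $\mathrm{Out}(F_n)=\mathrm{Aut}(F_n)/\mathrm{Inn}(F_n)$. Choosing free generators $X_1,\dots,X_n$ of $F_n$ identifies $\mathrm{Hom}(F_n,G)$ with $G^n$ via $\rho\mapsto(\rho(X_1),\dots,\rho(X_n))$; the product Haar measure on $G^n$ is invariant under $\mathrm{Aut}(F_n)$, which acts by $\phi\cdot\rho=\rho\circ\phi^{-1}$. $\mathrm{Hom}(F_n,G)/G$ denotes the quotient by the action of $G$ by conjugation, equipped with the pushforward of this finite measure; $\mathrm{Out}(F_n)$ acts on it preserving the measure. The induced unitary representation is by composition: $(\phi\cdot h)(x)=h(\phi^{-1}\cdot x)$. *)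

theory Defs
  imports "HOL-Analysis.Analysis" "HOL-Algebra.Algebra"
begin

section \<open>Topological groups and Lie groups\<close>

locale topological_group = group G for G :: "('a, 'b) monoid_scheme" (structure) and T :: "'a topology" +
  assumes topspace_eq: "topspace T = carrier G"
    and continuous_mult: "continuous_map (prod_topology T T) T (\<lambda>(x, y). x \<otimes> y)"
    and continuous_inv: "continuous_map T T (\<lambda>x. inv x)"

text \<open>
  Following \<^const>\<open>Euclidean_space\<close>, points of \<open>\<real>\<^sup>d\<close> are functions \<open>nat \<Rightarrow> real\<close> that vanish from
  index \<open>d\<close> on, so that the dimension may be any natural number, including \<open>0\<close>.
  A function is \<open>C\<^sup>k\<close> on an open set \<open>U\<close> of \<open>\<real>\<^sup>d\<close> if its partial derivatives of order at most \<open>k\<close>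
  exist and are continuous on \<open>U\<close>.
\<close>

primrec C_k :: "nat \<Rightarrow> nat \<Rightarrow> (nat \<Rightarrow> real) set \<Rightarrow> ((nat \<Rightarrow> real) \<Rightarrow> real) \<Rightarrow> bool" where
  "C_k 0 d U f \<longleftrightarrow> continuous_map (subtopology (Euclidean_space d) U) euclideanreal f"
| "C_k (Suc k) d U f \<longleftrightarrow>
     continuous_map (subtopology (Euclidean_space d) U) euclideanreal f \<and>
     (\<forall>i<d. \<exists>g. (\<forall>x\<in>U. ((\<lambda>t. f (x(i := t))) has_real_derivative g x) (at (x i))) \<and> C_k k d U g)"

definition smooth_map :: "nat \<Rightarrow> (nat \<Rightarrow> real) set \<Rightarrow> ((nat \<Rightarrow> real) \<Rightarrow> (nat \<Rightarrow> real)) \<Rightarrow> bool" where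
  "smooth_map d U f \<longleftrightarrow> (\<forall>j k. C_k k d U (\<lambda>x. f x j))"

text \<open>The two components under the identification of \<open>\<real>\<^sup>2\<^sup>d\<close> with \<open>\<real>\<^sup>d \<times> \<real>\<^sup>d\<close>.\<close>

definition fst_half :: "nat \<Rightarrow> (nat \<Rightarrow> real) \<Rightarrow> (nat \<Rightarrow> real)" where
  "fst_half d z = (\<lambda>i. if i < d then z i else 0)"

definition snd_half :: "nat \<Rightarrow> (nat \<Rightarrow> real) \<Rightarrow> (nat \<Rightarrow> real)" where
  "snd_half d z = (\<lambda>i. if i < d then z (d + i) else 0)"

definition is_chart :: "'a topology \<Rightarrow> nat \<Rightarrow> 'a set \<times> ('a \<Rightarrow> nat \<Rightarrow> real) \<Rightarrow> bool" where
  "is_chart T d = (\<lambda>(U, \<phi>). openin T U \<and> openin (Euclidean_space d) (\<phi> ` U) \<and>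
     homeomorphic_map (subtopology T U) (subtopology (Euclidean_space d) (\<phi> ` U)) \<phi>)"

locale smooth_manifold =
  fixes T :: "'a topology" and d :: nat and \<A> :: "('a set \<times> ('a \<Rightarrow> nat \<Rightarrow> real)) set"
  assumes Hausdorff: "Hausdorff_space T"
    and second_countable:
      "\<exists>\<B>. countable \<B> \<and> (\<forall>V\<in>\<B>. openin T V) \<and>
           (\<forall>U x. openin T U \<and> x \<in> U \<longrightarrow> (\<exists>V\<in>\<B>. x \<in> V \<and> V \<subseteq> U))"
    and charts: "c \<in> \<A> \<Longrightarrow> is_chart T d c"
    and charts_cover: "(\<Union>(U, \<phi>)\<in>\<A>. U) = topspace T"
    and smooth_transition:
      "(U, \<phi>) \<in> \<A> \<Longrightarrow> (V, \<psi>) \<in> \<A> \<Longrightarrow> smooth_map d (\<phi> ` (U \<inter> V)) (\<lambda>x. \<psi> (inv_into U \<phi> x))"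

locale lie_group =
  topological_group G T + smooth_manifold T d \<A>
  for G :: "('a, 'b) monoid_scheme" (structure) and T :: "'a topology" and d :: nat
    and \<A> :: "('a set \<times> ('a \<Rightarrow> nat \<Rightarrow> real)) set" +
  assumes smooth_mult:
      "(U, \<phi>) \<in> \<A> \<Longrightarrow> (V, \<psi>) \<in> \<A> \<Longrightarrow> (W, \<theta>) \<in> \<A> \<Longrightarrow>
       smooth_map (2 * d)
         {z \<in> topspace (Euclidean_space (2 * d)). fst_half d z \<in> \<phi> ` U \<and> snd_half d z \<in> \<psi> ` V \<and>
            inv_into U \<phi> (fst_half d z) \<otimes> inv_into V \<psi> (snd_half d z) \<in> W}
         (\<lambda>z. \<theta> (inv_into U \<phi> (fst_half d z) \<otimes> inv_into V \<psi> (snd_half d z)))"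
    and smooth_inv:
      "(U, \<phi>) \<in> \<A> \<Longrightarrow> (V, \<psi>) \<in> \<A> \<Longrightarrow>
       smooth_map d (\<phi> ` {x \<in> U. inv x \<in> V}) (\<lambda>u. \<psi> (inv (inv_into U \<phi> u)))"

definition locally_isomorphic ::
  "('a, 'c) monoid_scheme \<Rightarrow> 'a topology \<Rightarrow> ('b, 'd) monoid_scheme \<Rightarrow> 'b topology \<Rightarrow> bool" where
  "locally_isomorphic G T H S \<longleftrightarrow>
     (\<exists>U V f. openin T U \<and> \<one>\<^bsub>G\<^esub> \<in> U \<and> openin S V \<and> \<one>\<^bsub>H\<^esub> \<in> V \<and>
        homeomorphic_map (subtopology T U) (subtopology S V) f \<and>
        (\<forall>x\<in>U. \<forall>y\<in>U. (x \<otimes>\<^bsub>G\<^esub> y \<in> U \<longleftrightarrow> f x \<otimes>\<^bsub>H\<^esub> f y \<in> V) \<and>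
           (x \<otimes>\<^bsub>G\<^esub> y \<in> U \<longrightarrow> f (x \<otimes>\<^bsub>G\<^esub> y) = f x \<otimes>\<^bsub>H\<^esub> f y)))"

definition conj_transpose :: "complex^'n^'m \<Rightarrow> complex^'m^'n" where
  "conj_transpose A = (\<chi> i j. cnj (A $ j $ i))"

definition SU2 :: "(complex^2^2) monoid" where
  "SU2 = \<lparr>carrier = {A. A ** conj_transpose A = mat 1 \<and> det A = 1}, mult = (**), one = mat 1\<rparr>"

definition U1 :: "complex monoid" where
  "U1 = \<lparr>carrier = {z. cmod z = 1}, mult = (*), one = 1\<rparr>"

text \<open>The product of \<open>k\<close> copies of \<open>SU(2)\<close> and \<open>l\<close> copies of \<open>U(1)\<close>, with its topology.\<close>

definition SU2_U1_product :: "nat \<Rightarrow> nat \<Rightarrow> ((nat \<Rightarrow> complex^2^2) \<times> (nat \<Rightarrow> complex)) monoid" where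
  "SU2_U1_product k l = product_group {..<k} (\<lambda>_. SU2) \<times>\<times> product_group {..<l} (\<lambda>_. U1)"

definition SU2_U1_topology :: "nat \<Rightarrow> nat \<Rightarrow> ((nat \<Rightarrow> complex^2^2) \<times> (nat \<Rightarrow> complex)) topology" where
  "SU2_U1_topology k l =
     prod_topology (product_topology (\<lambda>_. top_of_set (carrier SU2)) {..<k})
                   (product_topology (\<lambda>_. top_of_set (carrier U1)) {..<l})"

section \<open>Haar measure\<close>

definition borel_of :: "'a topology \<Rightarrow> 'a measure" where
  "borel_of T = sigma (topspace T) {U. openin T U}"

text \<open>
  Left-invariant nonzero Radon measures. The measure is not normalised; it is unique up to a
  positive factor, and on a compact group it is finite and bi-invariant.
\<close>

definition haar_measure :: "('a, 'b) monoid_scheme \<Rightarrow> 'a topology \<Rightarrow> 'a measure \<Rightarrow> bool" where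
  "haar_measure G T \<mu> \<longleftrightarrow>
     sets \<mu> = sets (borel_of T) \<and>
     emeasure \<mu> (space \<mu>) \<noteq> 0 \<and>
     (\<forall>K. compactin T K \<longrightarrow> emeasure \<mu> K < \<infinity>) \<and>
     (\<forall>A\<in>sets \<mu>. emeasure \<mu> A = (INF U\<in>{U. openin T U \<and> A \<subseteq> U}. emeasure \<mu> U)) \<and>
     (\<forall>U. openin T U \<longrightarrow> emeasure \<mu> U = (SUP K\<in>{K. compactin T K \<and> K \<subseteq> U}. emeasure \<mu> K)) \<and>
     (\<forall>g\<in>carrier G. \<forall>A\<in>sets \<mu>. emeasure \<mu> (g <#\<^bsub>G\<^esub> A) = emeasure \<mu> A)"

section \<open>The free group and its outer automorphism group\<close>

text \<open>
  A letter \<open>(i, True)\<close> stands for the generator with index \<open>i\<close> and \<open>(i, False)\<close> for its inverse;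
  group elements are the reduced words in the letters with \<open>i < n\<close>.
\<close>

definition inv_letter :: "nat \<times> bool \<Rightarrow> nat \<times> bool" where
  "inv_letter x = (fst x, \<not> snd x)"

definition reduced_word :: "(nat \<times> bool) list \<Rightarrow> bool" where
  "reduced_word w \<longleftrightarrow> successively (\<lambda>x y. y \<noteq> inv_letter x) w"

fun push_letter :: "nat \<times> bool \<Rightarrow> (nat \<times> bool) list \<Rightarrow> (nat \<times> bool) list" where
  "push_letter x [] = [x]"
| "push_letter x (y # w) = (if y = inv_letter x then w else x # y # w)"

definition free_group :: "nat \<Rightarrow> (nat \<times> bool) list monoid" where
  "free_group n =
     \<lparr>carrier = {w. reduced_word w \<and> fst ` set w \<subseteq> {..<n}}, mult = foldr push_letter, one = []\<rparr>"

definition free_gen :: "nat \<Rightarrow> (nat \<times> bool) list" where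
  "free_gen i = [(i, True)]"

definition Inn :: "('a, 'b) monoid_scheme \<Rightarrow> ('a \<Rightarrow> 'a) set" where
  "Inn G = (\<lambda>g. \<lambda>x\<in>carrier G. g \<otimes>\<^bsub>G\<^esub> x \<otimes>\<^bsub>G\<^esub> inv\<^bsub>G\<^esub> g) ` carrier G"

definition Out :: "('a, 'b) monoid_scheme \<Rightarrow> ('a \<Rightarrow> 'a) set monoid" where
  "Out G = AutoGroup G Mod Inn G"

section \<open>The space of representations modulo conjugation\<close>

type_synonym 'a rep = "(nat \<times> bool) list \<Rightarrow> 'a"

definition Hom_space :: "nat \<Rightarrow> ('a, 'b) monoid_scheme \<Rightarrow> 'a rep set" where
  "Hom_space n G = hom (free_group n) G \<inter> extensional (carrier (free_group n))"

definition eval_gens :: "nat \<Rightarrow> 'a rep \<Rightarrow> nat \<Rightarrow> 'a" where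
  "eval_gens n \<rho> = (\<lambda>i\<in>{..<n}. \<rho> (free_gen i))"

text \<open>
  \<open>eval_gens n\<close> is a bijection from \<open>Hom(F\<^sub>n, G)\<close> to \<open>G\<^sup>n\<close>; the product measure is transported
  along its inverse.
\<close>

definition Hom_measure :: "nat \<Rightarrow> ('a, 'b) monoid_scheme \<Rightarrow> 'a measure \<Rightarrow> 'a rep measure" where
  "Hom_measure n G \<mu> =
     embed_measure (Pi\<^sub>M {..<n} (\<lambda>_. \<mu>)) (the_inv_into (Hom_space n G) (eval_gens n))"

definition conj_rep :: "nat \<Rightarrow> ('a, 'b) monoid_scheme \<Rightarrow> 'a \<Rightarrow> 'a rep \<Rightarrow> 'a rep" where
  "conj_rep n G g =
     (\<lambda>\<rho>\<in>Hom_space n G. \<lambda>w\<in>carrier (free_group n). g \<otimes>\<^bsub>G\<^esub> \<rho> w \<otimes>\<^bsub>G\<^esub> inv\<^bsub>G\<^esub> g)"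

text \<open>\<open>Hom(F\<^sub>n, G)/G\<close>, whose points are conjugation orbits, with the pushforward measure.\<close>

definition char_space :: "nat \<Rightarrow> ('a, 'b) monoid_scheme \<Rightarrow> 'a rep set set" where
  "char_space n G = orbits G (Hom_space n G) (conj_rep n G)"

definition quotient_measure :: "'x measure \<Rightarrow> ('x \<Rightarrow> 'y) \<Rightarrow> 'y set \<Rightarrow> 'y measure" where
  "quotient_measure M q Y =
     measure_of Y {A. A \<subseteq> Y \<and> q -` A \<inter> space M \<in> sets M} (\<lambda>A. emeasure M (q -` A \<inter> space M))"

definition char_measure :: "nat \<Rightarrow> ('a, 'b) monoid_scheme \<Rightarrow> 'a measure \<Rightarrow> 'a rep set measure" where
  "char_measure n G \<mu> =
     quotient_measure (Hom_measure n G \<mu>) (orbit G (conj_rep n G)) (char_space n G)"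

text \<open>
  The action \<open>[\<phi>] \<cdot> [\<rho>] = [\<rho> \<circ> \<phi>\<^sup>-\<^sup>1]\<close>: as \<open>\<phi>\<close> ranges over a coset of the inner automorphisms and
  \<open>\<rho>\<close> over an orbit, the homomorphisms \<open>\<rho> \<circ> \<phi>\<^sup>-\<^sup>1\<close> make up exactly one orbit.
\<close>

definition out_act :: "nat \<Rightarrow> ((nat \<times> bool) list \<Rightarrow> (nat \<times> bool) list) set \<Rightarrow> 'a rep set \<Rightarrow> 'a rep set" where
  "out_act n c x =
     {compose (carrier (free_group n)) \<rho> (inv\<^bsub>AutoGroup (free_group n)\<^esub> \<phi>) | \<rho> \<phi>. \<rho> \<in> x \<and> \<phi> \<in> c}"

section \<open>The space \<open>L\<^sup>2\<close>\<close>

definition sq_integrable :: "'x measure \<Rightarrow> ('x \<Rightarrow> complex) set" where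
  "sq_integrable M = {f \<in> borel_measurable M. integrable M (\<lambda>x. (cmod (f x))\<^sup>2)}"

definition ae_rel :: "'x measure \<Rightarrow> (('x \<Rightarrow> complex) \<times> ('x \<Rightarrow> complex)) set" where
  "ae_rel M = {(f, g). f \<in> sq_integrable M \<and> g \<in> sq_integrable M \<and> (AE x in M. f x = g x)}"

definition L2 :: "'x measure \<Rightarrow> ('x \<Rightarrow> complex) set set" where
  "L2 M = sq_integrable M // ae_rel M"

definition L2_class :: "'x measure \<Rightarrow> ('x \<Rightarrow> complex) \<Rightarrow> ('x \<Rightarrow> complex) set" where
  "L2_class M f = ae_rel M `` {f}"

definition L2_add :: "'x measure \<Rightarrow> ('x \<Rightarrow> complex) set \<Rightarrow> ('x \<Rightarrow> complex) set \<Rightarrow> ('x \<Rightarrow> complex) set" where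
  "L2_add M v w = (\<Union>f\<in>v. \<Union>g\<in>w. L2_class M (\<lambda>x. f x + g x))"

definition L2_scale :: "'x measure \<Rightarrow> complex \<Rightarrow> ('x \<Rightarrow> complex) set \<Rightarrow> ('x \<Rightarrow> complex) set" where
  "L2_scale M a v = (\<Union>f\<in>v. L2_class M (\<lambda>x. a * f x))"

definition L2_subspace :: "'x measure \<Rightarrow> ('x \<Rightarrow> complex) set set \<Rightarrow> bool" where
  "L2_subspace M V \<longleftrightarrow>
     V \<subseteq> L2 M \<and> L2_class M (\<lambda>_. 0) \<in> V \<and>
     (\<forall>v\<in>V. \<forall>w\<in>V. L2_add M v w \<in> V) \<and> (\<forall>a. \<forall>v\<in>V. L2_scale M a v \<in> V)"

definition L2_finite_dim :: "'x measure \<Rightarrow> ('x \<Rightarrow> complex) set set \<Rightarrow> bool" where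
  "L2_finite_dim M V \<longleftrightarrow> (\<exists>B. finite B \<and> B \<subseteq> L2 M \<and> V = L2_subspace M hull B)"

text \<open>The representation \<open>(\<phi> \<cdot> h)(x) = h(\<phi>\<^sup>-\<^sup>1 \<cdot> x)\<close> on \<open>L\<^sup>2(Hom(F\<^sub>n, G)/G)\<close>.\<close>

definition out_rep ::
  "nat \<Rightarrow> ('a, 'b) monoid_scheme \<Rightarrow> 'a measure \<Rightarrow> ((nat \<times> bool) list \<Rightarrow> (nat \<times> bool) list) set \<Rightarrow>
   ('a rep set \<Rightarrow> complex) set \<Rightarrow> ('a rep set \<Rightarrow> complex) set" where
  "out_rep n G \<mu> c v =
     (\<Union>h\<in>v. L2_class (char_measure n G \<mu>) (\<lambda>x. h (out_act n (inv\<^bsub>Out (free_group n)\<^esub> c) x)))"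

end

theory Submission
  imports Defs
begin

text \<open>
  Lift a finite-dimensional invariant space to functions on \<open>G\<^sup>n\<close>. Transvections \<open>x\<^sub>i \<mapsto> x\<^sub>j x\<^sub>i\<close> keep the lift
  \<open>f\<close> in a finite-dimensional space \<open>F\<close>. If \<open>g\<^sub>p \<rightarrow> \<one>\<close>, then multiplying \<open>x\<^sub>i\<close> by \<open>\<omega>\<^sub>p = (g\<^sub>p x\<^sub>j)\<^sup>p x\<^sub>j\<^sup>-\<^sup>p\<close>
  changes \<open>f\<close> by an \<open>L\<^sup>1\<close>-small amount: the functions \<open>f (x\<^sub>j\<^sup>p x\<^sub>i)\<close> stay in a bounded, hence
  equicontinuous, subset of \<open>F\<close>, so replacing \<open>x\<^sub>j\<close> by \<open>g\<^sub>p x\<^sub>j\<close> in them changes little. Hence for almost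
  every point \<open>f\<close> is invariant in the coordinate \<open>i\<close> under every limit of \<open>\<omega>\<^sub>p\<close>, for \<open>x\<^sub>j\<close> as well as for a
  third coordinate \<open>x\<^sub>m\<close> (here \<open>n > 2\<close> enters). Taking for \<open>g\<^sub>p\<close> small elements \<open>exp (s Z / p)\<close> of the factors
  \<open>SU(2)\<close> and \<open>U(1)\<close>, the limits contain the whole local \<open>U(1)\<close> factors and, in each \<open>SU(2)\<close> factor, the maximal
  tori centralising \<open>x\<^sub>j\<close> and \<open>x\<^sub>m\<close>. For almost every pair these tori are different and generate the factor,
  so the limits generate the connected group \<open>G\<close>, and \<open>f\<close> does not depend on \<open>x\<^sub>i\<close>.
\<close>

section \<open>Continuity of composition in \<open>L\<^sup>1\<close>\<close>

text \<open>With \<open>a = x\<^sub>j\<close> and \<open>g = g\<^sub>p\<close>, the perturbation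
  expands to \<open>\<omega>\<^sub>p = g (a g a\<^sup>-\<^sup>1) (a\<^sup>2 g a\<^sup>-\<^sup>2)
  ...\<close> with \<open>p\<close> factors. For \<open>g = exp (s Z / p)\<close> it averages
  \<open>Z\<close> over the powers of conjugation by \<open>a\<close>, and only the component of
  \<open>Z\<close> fixed by \<open>a\<close> survives in the limit. That is why the torus
  centralising \<open>a\<close> appears. Two obstacles shape the proof. The group is a product only
  near the identity, so there are no global factors to argue with; connectedness is used to show
  that every group element still conjugates the local factors by unit quaternions. And everything
  about \<open>f\<close> holds only up to null sets: \<open>L\<^sup>1\<close> convergence on
  \<open>G\<^sup>n\<close> gives convergence on slices only along a subsequence, with an exceptional
  set depending on the sequence \<open>g\<close>. Hence only countably many sequences may be tested
  (rational \<open>s\<close>, three axes \<open>Z\<close>), and the remaining elements come from the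
  closedness of the almost-everywhere stabiliser of a slice.\<close>

text \<open>Dynkin induction from the generator, where pointwise convergence and dominated
  convergence suffice. The one-sided difference is enough because both maps preserve the
  measure.\<close>

lemma (in finite_measure) measure_vimage_diff_tendsto_0:
  assumes \<tau>p: "\<And>p. \<tau>p p \<in> measurable M M" and \<tau>: "\<tau> \<in> measurable M M"
    and dp: "\<And>p. distr M M (\<tau>p p) = M" and d: "distr M M \<tau> = M"
    and gen: "sets M = sigma_sets (space M) E" "Int_stable E" "E \<subseteq> Pow (space M)"
    and ev: "\<And>A t. A \<in> E \<Longrightarrow> t \<in> space M \<Longrightarrow> \<tau> t \<in> A \<Longrightarrow> eventually (\<lambda>p. \<tau>p p t \<in> A) sequentially"
    and A: "A \<in> sets M"
  shows "(\<lambda>p. measure M ({t\<in>space M. \<tau> t \<in> A} - {t\<in>space M. \<tau>p p t \<in> A})) \<longlonglongrightarrow> 0"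
proof -
  note [measurable] = \<tau>p \<tau>
  have mp: "measure M {t\<in>space M. \<tau>p p t \<in> A} = measure M A" if [measurable]: "A \<in> sets M" for A p
  proof -
    have "measure M A = measure (distr M M (\<tau>p p)) A" by (simp add: dp)
    also have "\<dots> = measure M {t\<in>space M. \<tau>p p t \<in> A}"
      by (subst measure_distr) (auto intro!: arg_cong[where f="measure M"])
    finally show ?thesis by simp
  qed
  have m: "measure M {t\<in>space M. \<tau> t \<in> A} = measure M A" if [measurable]: "A \<in> sets M" for A
  proof -
    have "measure M A = measure (distr M M \<tau>) A" by (simp add: d)
    also have "\<dots> = measure M {t\<in>space M. \<tau> t \<in> A}"
      by (subst measure_distr) (auto intro!: arg_cong[where f="measure M"])
    finally show ?thesis by simp
  qed
  \<comment> \<open>Two sets of equal finite measure have differences of equal measure; this handles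
    complements below, where the two differences change places.\<close>
  have sym: "measure M ({t\<in>space M. \<tau> t \<in> A} - {t\<in>space M. \<tau>p p t \<in> A}) =
      measure M ({t\<in>space M. \<tau>p p t \<in> A} - {t\<in>space M. \<tau> t \<in> A})" if [measurable]: "A \<in> sets M" for A p
  proof -
    have X: "{t\<in>space M. \<tau> t \<in> A} \<in> sets M" and Y: "{t\<in>space M. \<tau>p p t \<in> A} \<in> sets M" by auto
    show ?thesis using finite_measure_Diff'[OF X Y] finite_measure_Diff'[OF Y X]
      by (simp add: m mp that Int_commute)
  qed
  from A have "A \<in> sigma_sets (space M) E" using gen by simp
  with gen(2,3) show ?thesis
  proof (induction rule: sigma_sets_induct_disjoint)
    case (basic A)
    then have A[measurable]: "A \<in> sets M" using gen by auto
    let ?D = "\<lambda>p. {t\<in>space M. \<tau> t \<in> A} - {t\<in>space M. \<tau>p p t \<in> A}"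
    have "(\<lambda>p. \<integral>t. indicator (?D p) t \<partial>M) \<longlonglongrightarrow> (\<integral>t. (0::real) \<partial>M)"
    proof (rule integral_dominated_convergence[where w="\<lambda>_. 1"])
      show "AE t in M. (\<lambda>p. indicator (?D p) t) \<longlonglongrightarrow> (0::real)"
      proof (rule AE_I2)
        fix t assume t: "t \<in> space M"
        have "eventually (\<lambda>p. indicator (?D p) t = (0::real)) sequentially"
        proof (cases "\<tau> t \<in> A")
          case True
          from ev[OF basic t True] show ?thesis
            by eventually_elim (auto simp: indicator_def)
        qed (auto simp: indicator_def)
        then show "(\<lambda>p. indicator (?D p) t) \<longlonglongrightarrow> (0::real)" by (rule tendsto_eventually)
      qed
    qed (auto split: split_indicator)
    then show ?case by (simp add: Int_absorb2 subset_eq)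
  next
    case empty then show ?case by simp
  next
    case (compl A)
    then have [measurable]: "A \<in> sets M" using gen by auto
    have "{t\<in>space M. \<tau> t \<in> space M - A} - {t\<in>space M. \<tau>p p t \<in> space M - A} =
      {t\<in>space M. \<tau>p p t \<in> A} - {t\<in>space M. \<tau> t \<in> A}" for p
      using measurable_space[OF \<tau>] measurable_space[OF \<tau>p] by auto
    then show ?case using compl.IH by (simp add: sym)
  next
    case (union A)
    then have Am[measurable]: "\<And>k. A k \<in> sets M" using gen by auto
    let ?D = "\<lambda>A p. {t\<in>space M. \<tau> t \<in> A} - {t\<in>space M. \<tau>p p t \<in> A}"
    have summ: "summable (\<lambda>k. measure M (A k))"
      by (rule sums_summable[OF finite_measure_UNION]) (use union(1) Am in auto)
    have sumD: "summable (\<lambda>k. measure M (?D (A k) p))" for p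
    proof (rule summable_comparison_test'[OF summ])
      fix n show "norm (measure M (?D (A n) p)) \<le> measure M (A n)"
        unfolding m[OF Am, symmetric] by (auto intro!: finite_measure_mono)
    qed
    \<comment> \<open>The \<open>k\<close>-th term is at most \<open>measure M (A k)\<close>, which
      is summable by disjointness, so the limit passes through the sum.\<close>
    have "((\<lambda>p. suminf (\<lambda>k. measure M (?D (A k) p))) \<longlonglongrightarrow> suminf (\<lambda>k. 0::real))"
    proof (rule conjunct2[OF conjunct2[OF tannerys_theorem]])
      show "(\<lambda>p. measure M (?D (A k) p)) \<longlonglongrightarrow> 0" for k by (rule union)
      show "eventually (\<lambda>(k, p). norm (measure M (?D (A k) p)) \<le> measure M (A k)) (sequentially \<times>\<^sub>F sequentially)"
      proof (rule always_eventually, clarify)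
        fix k p show "norm (measure M (?D (A k) p)) \<le> measure M (A k)"
          unfolding m[OF Am, symmetric] by (auto intro!: finite_measure_mono)
      qed
    qed (auto simp: summ)
    then have lim: "(\<lambda>p. suminf (\<lambda>k. measure M (?D (A k) p))) \<longlonglongrightarrow> 0" by simp
    show ?case
    proof (rule tendsto_sandwich[OF _ _ tendsto_const lim])
      show "\<forall>\<^sub>F p in sequentially. measure M (?D (\<Union>k. A k) p) \<le> suminf (\<lambda>k. measure M (?D (A k) p))"
      proof (rule always_eventually, rule allI)
        fix p
        have "measure M (?D (\<Union>k. A k) p) \<le> measure M (\<Union>k. ?D (A k) p)"
          by (intro finite_measure_mono) auto
        also have "\<dots> \<le> suminf (\<lambda>k. measure M (?D (A k) p))"
          by (intro finite_measure_subadditive_countably sumD) auto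
        finally show "measure M (?D (\<Union>k. A k) p) \<le> suminf (\<lambda>k. measure M (?D (A k) p))" .
      qed
    qed auto
  qed
qed

text \<open>Indicators are covered by the preceding lemma; the general case follows by approximation
  in the mean, with an error that is uniform in \<open>p\<close> because all maps preserve the
  measure.\<close>

lemma (in finite_measure) integral_norm_comp_diff_tendsto_0:
  fixes f :: "'a \<Rightarrow> complex"
  assumes \<tau>p: "\<And>p. \<tau>p p \<in> measurable M M" and \<tau>: "\<tau> \<in> measurable M M"
    and dp: "\<And>p. distr M M (\<tau>p p) = M" and d: "distr M M \<tau> = M"
    and gen: "sets M = sigma_sets (space M) E" "Int_stable E" "E \<subseteq> Pow (space M)"
    and ev: "\<And>A t. A \<in> E \<Longrightarrow> t \<in> space M \<Longrightarrow> \<tau> t \<in> A \<Longrightarrow> eventually (\<lambda>p. \<tau>p p t \<in> A) sequentially"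
    and f: "integrable M f"
  shows "(\<lambda>p. \<integral>t. norm (f (\<tau>p p t) - f (\<tau> t)) \<partial>M) \<longlonglongrightarrow> 0"
proof -
  note [measurable] = \<tau>p \<tau>
  have ip: "integrable M (\<lambda>t. g (\<tau>p p t))" if "integrable M g" for g :: "'a \<Rightarrow> complex" and p
    by (rule integrable_distr[of _ M M]) (auto simp: dp that)
  have i: "integrable M (\<lambda>t. g (\<tau> t))" if "integrable M g" for g :: "'a \<Rightarrow> complex"
    by (rule integrable_distr[of _ M M]) (auto simp: d that)
  have ep: "(\<integral>t. g (\<tau>p p t) \<partial>M) = (\<integral>t. g t \<partial>M)" if "integrable M g" for g :: "'a \<Rightarrow> real" and p
    using integral_distr[of "\<tau>p p" M M g] that by (simp add: dp)
  have e: "(\<integral>t. g (\<tau> t) \<partial>M) = (\<integral>t. g t \<partial>M)" if "integrable M g" for g :: "'a \<Rightarrow> real"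
    using integral_distr[of \<tau> M M g] that by (simp add: d)
  from f show ?thesis
  proof (induction rule: integrable_induct)
    case (base A c)
    then have [measurable]: "A \<in> sets M" by simp
    let ?X = "{t\<in>space M. \<tau> t \<in> A}" and ?Y = "\<lambda>p. {t\<in>space M. \<tau>p p t \<in> A}"
    have mp: "measure M (?Y p) = measure M A" for p
    proof -
      have "measure M A = measure (distr M M (\<tau>p p)) A" by (simp add: dp)
      also have "\<dots> = measure M (?Y p)"
        by (subst measure_distr) (auto intro!: arg_cong[where f="measure M"])
      finally show ?thesis by simp
    qed
    have m: "measure M ?X = measure M A"
    proof -
      have "measure M A = measure (distr M M \<tau>) A" by (simp add: d)
      also have "\<dots> = measure M ?X"
        by (subst measure_distr) (auto intro!: arg_cong[where f="measure M"])
      finally show ?thesis by simp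
    qed
    have sym: "measure M (?X - ?Y p) = measure M (?Y p - ?X)" for p
    proof -
      have X: "?X \<in> sets M" and Y: "?Y p \<in> sets M" by auto
      show ?thesis using finite_measure_Diff'[OF X Y] finite_measure_Diff'[OF Y X]
        by (simp add: m mp Int_commute)
    qed
    have "(\<integral>t. norm (indicat_real A (\<tau>p p t) *\<^sub>R c - indicat_real A (\<tau> t) *\<^sub>R c) \<partial>M)
        = 2 * norm c * measure M (?X - ?Y p)" for p
    proof -
      have "(\<integral>t. norm (indicat_real A (\<tau>p p t) *\<^sub>R c - indicat_real A (\<tau> t) *\<^sub>R c) \<partial>M) =
        (\<integral>t. norm c * (indicat_real (?X - ?Y p) t + indicat_real (?Y p - ?X) t) \<partial>M)"
        by (rule Bochner_Integration.integral_cong) (auto split: split_indicator)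
      also have "\<dots> = norm c * (measure M (?X - ?Y p) + measure M (?Y p - ?X))"
        by (subst integral_mult_right_zero, subst Bochner_Integration.integral_add) (auto simp: Int_absorb2 subset_eq less_top[symmetric] intro!: integrable_real_indicator)
      finally show ?thesis by (simp add: sym)
    qed
    moreover have "(\<lambda>p. 2 * norm c * measure M (?X - ?Y p)) \<longlonglongrightarrow> 2 * norm c * 0"
      by (intro tendsto_intros measure_vimage_diff_tendsto_0[OF assms(1-8) \<open>A \<in> sets M\<close>])
    ultimately show ?case by simp
  next
    case (add f g)
    have "(\<lambda>p. (\<integral>t. norm (f (\<tau>p p t) - f (\<tau> t)) \<partial>M) + (\<integral>t. norm (g (\<tau>p p t) - g (\<tau> t)) \<partial>M)) \<longlonglongrightarrow> 0 + 0"
      using add by (intro tendsto_add)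
    then have lim: "(\<lambda>p. (\<integral>t. norm (f (\<tau>p p t) - f (\<tau> t)) \<partial>M) + (\<integral>t. norm (g (\<tau>p p t) - g (\<tau> t)) \<partial>M)) \<longlonglongrightarrow> 0"
      by simp
    show ?case
    proof (rule tendsto_sandwich[OF _ _ tendsto_const lim])
      show "\<forall>\<^sub>F p in sequentially. (\<integral>t. norm (f (\<tau>p p t) + g (\<tau>p p t) - (f (\<tau> t) + g (\<tau> t))) \<partial>M)
         \<le> (\<integral>t. norm (f (\<tau>p p t) - f (\<tau> t)) \<partial>M) + (\<integral>t. norm (g (\<tau>p p t) - g (\<tau> t)) \<partial>M)"
      proof (rule always_eventually, rule allI)
        fix p
        have 1: "integrable M (\<lambda>t. f (\<tau>p p t) - f (\<tau> t))"
          by (rule Bochner_Integration.integrable_diff[OF ip[OF add.hyps(1)] i[OF add.hyps(1)]])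
        have 2: "integrable M (\<lambda>t. g (\<tau>p p t) - g (\<tau> t))"
          by (rule Bochner_Integration.integrable_diff[OF ip[OF add.hyps(2)] i[OF add.hyps(2)]])
        have "(\<integral>t. norm (f (\<tau>p p t) + g (\<tau>p p t) - (f (\<tau> t) + g (\<tau> t))) \<partial>M) \<le>
           (\<integral>t. norm (f (\<tau>p p t) - f (\<tau> t)) + norm (g (\<tau>p p t) - g (\<tau> t)) \<partial>M)"
        proof (rule integral_mono)
          show "integrable M (\<lambda>t. norm (f (\<tau>p p t) + g (\<tau>p p t) - (f (\<tau> t) + g (\<tau> t))))"
            unfolding add_diff_add by (rule integrable_norm[OF Bochner_Integration.integrable_add[OF 1 2]])
          show "integrable M (\<lambda>t. norm (f (\<tau>p p t) - f (\<tau> t)) + norm (g (\<tau>p p t) - g (\<tau> t)))"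
            by (rule Bochner_Integration.integrable_add[OF integrable_norm[OF 1] integrable_norm[OF 2]])
          show "norm (f (\<tau>p p t) + g (\<tau>p p t) - (f (\<tau> t) + g (\<tau> t))) \<le> norm (f (\<tau>p p t) - f (\<tau> t)) + norm (g (\<tau>p p t) - g (\<tau> t))" for t
            unfolding add_diff_add by (rule norm_triangle_ineq)
        qed
        also have "\<dots> = (\<integral>t. norm (f (\<tau>p p t) - f (\<tau> t)) \<partial>M) + (\<integral>t. norm (g (\<tau>p p t) - g (\<tau> t)) \<partial>M)"
          by (rule Bochner_Integration.integral_add[OF integrable_norm[OF 1] integrable_norm[OF 2]])
        finally show "(\<integral>t. norm (f (\<tau>p p t) + g (\<tau>p p t) - (f (\<tau> t) + g (\<tau> t))) \<partial>M)
         \<le> (\<integral>t. norm (f (\<tau>p p t) - f (\<tau> t)) \<partial>M) + (\<integral>t. norm (g (\<tau>p p t) - g (\<tau> t)) \<partial>M)" .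
      qed
    qed auto
  next
    case (lim f s)
    have sf: "(\<lambda>k. \<integral>t. norm (s k t - f t) \<partial>M) \<longlonglongrightarrow> (\<integral>t. (0::real) \<partial>M)"
    proof (rule integral_dominated_convergence[where w="\<lambda>t. 3 * norm (f t)"])
      show "AE t in M. (\<lambda>k. norm (s k t - f t)) \<longlonglongrightarrow> 0"
        by (rule AE_I2) (auto intro!: tendsto_norm_zero Lim_null[THEN iffD1] lim.hyps(2))
      show "AE t in M. norm (norm (s k t - f t)) \<le> 3 * norm (f t)" for k
      proof (rule AE_I2)
        fix t assume "t \<in> space M"
        then show "norm (norm (s k t - f t)) \<le> 3 * norm (f t)"
          using lim.hyps(3)[of t k] norm_triangle_ineq4[of "s k t" "f t"] by simp
      qed
    qed (use lim in \<open>auto intro!: integrable_norm borel_measurable_integrable\<close>)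
    \<comment> \<open>Both replacement errors, after \<open>\<tau>p p\<close> and after
      \<open>\<tau>\<close>, equal the integral of \<open>norm (s k t - f t)\<close>, whence the
      factor 2.\<close>
    have bound: "(\<integral>t. norm (f (\<tau>p p t) - f (\<tau> t)) \<partial>M) \<le>
        (\<integral>t. norm (s k (\<tau>p p t) - s k (\<tau> t)) \<partial>M) + 2 * (\<integral>t. norm (s k t - f t) \<partial>M)" for k p
    proof -
      note sk = lim.hyps(1)[of k] and f = lim.hyps(4)
      note df = Bochner_Integration.integrable_diff
      have 1: "integrable M (\<lambda>t. norm (s k t - f t))" 
        by (rule integrable_norm[OF df[OF sk f]])
      have 2: "integrable M (\<lambda>t. norm (s k (\<tau>p p t) - f (\<tau>p p t)))"
        by (rule integrable_norm[OF df[OF ip[OF sk] ip[OF f]]])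
      have 3: "integrable M (\<lambda>t. norm (s k (\<tau> t) - f (\<tau> t)))"
        by (rule integrable_norm[OF df[OF i[OF sk] i[OF f]]])
      have 4: "integrable M (\<lambda>t. norm (s k (\<tau>p p t) - s k (\<tau> t)))"
        by (rule integrable_norm[OF df[OF ip[OF sk] i[OF sk]]])
      have 5: "integrable M (\<lambda>t. norm (f (\<tau>p p t) - f (\<tau> t)))"
        by (rule integrable_norm[OF df[OF ip[OF f] i[OF f]]])
      have "(\<integral>t. norm (f (\<tau>p p t) - f (\<tau> t)) \<partial>M) \<le> 
        (\<integral>t. norm (s k (\<tau>p p t) - s k (\<tau> t)) + (norm (s k (\<tau>p p t) - f (\<tau>p p t)) + norm (s k (\<tau> t) - f (\<tau> t))) \<partial>M)"
      proof (rule integral_mono)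
        show "integrable M (\<lambda>t. norm (f (\<tau>p p t) - f (\<tau> t)))" by (rule 5)
        show "integrable M (\<lambda>t. norm (s k (\<tau>p p t) - s k (\<tau> t)) + (norm (s k (\<tau>p p t) - f (\<tau>p p t)) + norm (s k (\<tau> t) - f (\<tau> t))))"
          using 2 3 4 by auto
        fix t
        have "norm (x' - x) \<le> norm (y' - y) + (norm (y' - x') + norm (y - x))" for x x' y y' :: complex
        proof -
          have "x' - x = ((y' - y) - (y' - x')) + (y - x)" by simp
          then show ?thesis
            by (metis (no_types) add.assoc add_right_mono norm_triangle_ineq norm_triangle_ineq4 order_trans)
        qed
        then show "norm (f (\<tau>p p t) - f (\<tau> t)) \<le> norm (s k (\<tau>p p t) - s k (\<tau> t)) + (norm (s k (\<tau>p p t) - f (\<tau>p p t)) + norm (s k (\<tau> t) - f (\<tau> t)))" .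
      qed
      also have "\<dots> = (\<integral>t. norm (s k (\<tau>p p t) - s k (\<tau> t)) \<partial>M) + ((\<integral>t. norm (s k (\<tau>p p t) - f (\<tau>p p t)) \<partial>M) + (\<integral>t. norm (s k (\<tau> t) - f (\<tau> t)) \<partial>M))"
        using 2 3 4 by simp
      also have "\<dots> = (\<integral>t. norm (s k (\<tau>p p t) - s k (\<tau> t)) \<partial>M) + 2 * (\<integral>t. norm (s k t - f t) \<partial>M)"
        using ep[OF 1] e[OF 1] by simp
      finally show ?thesis .
    qed
    show ?case
    proof (rule LIMSEQ_I)
      fix r :: real assume r: "r > 0"
      have "eventually (\<lambda>k. (\<integral>t. norm (s k t - f t) \<partial>M) < r / 4) sequentially"
        using order_tendstoD(2)[OF sf, of "r/4"] r by simp
      then obtain k where k: "(\<integral>t. norm (s k t - f t) \<partial>M) < r / 4"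
        by (meson eventually_happens trivial_limit_sequentially)
      have "eventually (\<lambda>p. (\<integral>t. norm (s k (\<tau>p p t) - s k (\<tau> t)) \<partial>M) < r / 4) sequentially"
        using order_tendstoD(2)[OF lim.IH[of k], of "r/4"] r by simp
      then obtain p0 where p0: "\<And>p. p \<ge> p0 \<Longrightarrow> (\<integral>t. norm (s k (\<tau>p p t) - s k (\<tau> t)) \<partial>M) < r / 4"
        unfolding eventually_sequentially by blast
      show "\<exists>no. \<forall>n\<ge>no. norm ((\<integral>t. norm (f (\<tau>p n t) - f (\<tau> t)) \<partial>M) - 0) < r"
      proof (intro exI[of _ p0] allI impI)
        fix n assume "n \<ge> p0"
        have "0 \<le> (\<integral>t. norm (f (\<tau>p n t) - f (\<tau> t)) \<partial>M)" by simp
        moreover have "(\<integral>t. norm (f (\<tau>p n t) - f (\<tau> t)) \<partial>M) < r"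
          using bound[of n k] k p0[OF \<open>n \<ge> p0\<close>] r by linarith
        ultimately show "norm ((\<integral>t. norm (f (\<tau>p n t) - f (\<tau> t)) \<partial>M) - 0) < r" by simp
      qed
    qed
  qed
qed

section \<open>Haar measure on a compact group and its powers\<close>

lemma borel_of_basics:
  shows space_borel_of: "space (borel_of T) = topspace T"
    and sets_borel_of: "sets (borel_of T) = sigma_sets (topspace T) {U. openin T U}"
proof -
  have "{U. openin T U} \<subseteq> Pow (topspace T)" using openin_subset by auto
  then show "space (borel_of T) = topspace T" "sets (borel_of T) = sigma_sets (topspace T) {U. openin T U}"
    unfolding borel_of_def by (auto simp: sets_measure_of space_measure_of)
qed

locale haar_compact = topological_group G T for G (structure) and T :: "'a topology" +
  fixes \<mu> :: "'a measure"
  assumes compact: "compact_space T"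
    and second_countable: "second_countable T"
    and haar: "haar_measure G T \<mu>"
begin

lemma sets_haar: "sets \<mu> = sigma_sets (carrier G) {U. openin T U}"
  using haar by (simp add: haar_measure_def sets_borel_of topspace_eq)

lemma space_haar: "space \<mu> = carrier G"
  using haar sets_eq_imp_space_eq[of \<mu> "borel_of T"]
  by (simp add: haar_measure_def space_borel_of topspace_eq)

lemma openin_sets: "openin T U \<Longrightarrow> U \<in> sets \<mu>"
  by (auto simp: sets_haar)

sublocale finite_measure \<mu>
proof
  have "compactin T (space \<mu>)"
    using compact by (simp add: compact_space_def topspace_eq space_haar)
  then show "emeasure \<mu> (space \<mu>) \<noteq> \<infinity>"
    using haar by (auto simp: haar_measure_def)
qed

lemma emeasure_space_neq_0: "emeasure \<mu> (space \<mu>) \<noteq> 0"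
  using haar by (simp add: haar_measure_def)

lemma measurable_into_haar:
  assumes "f \<in> space N \<rightarrow> carrier G" "\<And>U. openin T U \<Longrightarrow> f -` U \<inter> space N \<in> sets N"
  shows "f \<in> measurable N \<mu>"
  by (rule measurable_sigma_sets[OF sets_haar]) (use assms openin_subset[of T] in \<open>auto simp: topspace_eq\<close>)

lemma measurable_continuous: "continuous_map T T f \<Longrightarrow> f \<in> measurable \<mu> \<mu>"
  by (rule measurable_into_haar)
    (auto simp: continuous_map_def topspace_eq space_haar vimage_def Int_def conj_commute intro!: openin_sets)

lemma measurable_inv [measurable]: "(\<lambda>x. inv x) \<in> measurable \<mu> \<mu>"
  by (rule measurable_continuous[OF continuous_inv])

text \<open>A countable base writes an open subset of the product as a countable union of boxes.
  This makes multiplication measurable for the product sigma-algebra, which could otherwise be too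
  small.\<close>

lemma openin_prod_sets:
  assumes W: "openin (prod_topology T T) W"
  shows "W \<in> sets (\<mu> \<Otimes>\<^sub>M \<mu>)"
proof -
  obtain \<B> where \<B>: "countable \<B>" "\<And>V. V \<in> \<B> \<Longrightarrow> openin T V"
    "\<And>U x. openin T U \<Longrightarrow> x \<in> U \<Longrightarrow> \<exists>V\<in>\<B>. x \<in> V \<and> V \<subseteq> U"
    using second_countable unfolding second_countable_def by metis
  let ?C = "{(B, C) \<in> \<B> \<times> \<B>. B \<times> C \<subseteq> W}"
  have "W = (\<Union>(B, C)\<in>?C. B \<times> C)"
  proof
    show "W \<subseteq> (\<Union>(B, C)\<in>?C. B \<times> C)"
    proof
      fix z assume z: "z \<in> W"
      obtain x y where xy: "z = (x, y)" by (cases z)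
      obtain U V where UV: "openin T U" "openin T V" "x \<in> U" "y \<in> V" "U \<times> V \<subseteq> W"
        using openin_prod_topology_alt[THEN iffD1, OF W, rule_format, OF z[unfolded xy]] by auto
      obtain B C where "B \<in> \<B>" "x \<in> B" "B \<subseteq> U" "C \<in> \<B>" "y \<in> C" "C \<subseteq> V"
        using \<B>(3) UV by meson
      then have "(B, C) \<in> ?C" "z \<in> B \<times> C" using UV xy by auto
      then show "z \<in> (\<Union>(B, C)\<in>?C. B \<times> C)" by blast
    qed
  qed auto
  moreover have "countable ?C" by (rule countable_subset[OF _ countable_SIGMA[OF \<B>(1) \<B>(1)]]) auto
  then have "(\<Union>(B, C)\<in>?C. B \<times> C) \<in> sets (\<mu> \<Otimes>\<^sub>M \<mu>)"
    by (intro sets.countable_UN') (use \<B>(2) in \<open>auto intro!: pair_measureI openin_sets\<close>)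
  ultimately show ?thesis by simp
qed

lemma measurable_mult' : "(\<lambda>(x, y). x \<otimes> y) \<in> measurable (\<mu> \<Otimes>\<^sub>M \<mu>) \<mu>"
proof (rule measurable_into_haar)
  show "(\<lambda>(x, y). x \<otimes> y) \<in> space (\<mu> \<Otimes>\<^sub>M \<mu>) \<rightarrow> carrier G"
    by (auto simp: space_pair_measure space_haar)
  fix U assume U: "openin T U"
  have "openin (prod_topology T T) {z \<in> topspace (prod_topology T T). (\<lambda>(x, y). x \<otimes> y) z \<in> U}"
    using continuous_mult U by (rule openin_continuous_map_preimage)
  moreover have "(\<lambda>(x, y). x \<otimes> y) -` U \<inter> space (\<mu> \<Otimes>\<^sub>M \<mu>) =
     {z \<in> topspace (prod_topology T T). (\<lambda>(x, y). x \<otimes> y) z \<in> U}"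
    by (auto simp: space_pair_measure space_haar topspace_eq)
  ultimately show "(\<lambda>(x, y). x \<otimes> y) -` U \<inter> space (\<mu> \<Otimes>\<^sub>M \<mu>) \<in> sets (\<mu> \<Otimes>\<^sub>M \<mu>)"
    using openin_prod_sets by simp
qed

lemma measurable_mult [measurable (raw)]:
  assumes "f \<in> measurable N \<mu>" "g \<in> measurable N \<mu>"
  shows "(\<lambda>x. f x \<otimes> g x) \<in> measurable N \<mu>"
  using measurable_compose[OF measurable_Pair[OF assms] measurable_mult'] by simp

lemma measurable_pow [measurable (raw)]:
  fixes p :: nat
  assumes [measurable]: "f \<in> measurable N \<mu>"
  shows "(\<lambda>x. f x [^] p) \<in> measurable N \<mu>"
proof (induction p)
  case 0
  then show ?case by (simp add: space_haar)
next
  case (Suc p)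
  note [measurable] = Suc.IH
  show ?case by simp
qed

lemma vimage_left_mult:
  assumes g: "g \<in> carrier G" and A: "A \<subseteq> carrier G"
  shows "(\<lambda>x. g \<otimes> x) -` A \<inter> carrier G = inv g <# A"
proof
  show "(\<lambda>x. g \<otimes> x) -` A \<inter> carrier G \<subseteq> inv g <# A"
  proof
    fix x assume "x \<in> (\<lambda>x. g \<otimes> x) -` A \<inter> carrier G"
    then have "x = inv g \<otimes> (g \<otimes> x)" "g \<otimes> x \<in> A" using g by (auto simp: m_assoc[symmetric])
    then show "x \<in> inv g <# A" unfolding l_coset_def by blast
  qed
  show "inv g <# A \<subseteq> (\<lambda>x. g \<otimes> x) -` A \<inter> carrier G"
  proof
    fix x assume "x \<in> inv g <# A"
    then obtain a where a: "a \<in> A" "x = inv g \<otimes> a" by (auto simp: l_coset_def)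
    then have ac: "a \<in> carrier G" using A by auto
    have "g \<otimes> x = a" using g ac by (simp add: a(2) m_assoc[symmetric])
    then show "x \<in> (\<lambda>x. g \<otimes> x) -` A \<inter> carrier G" using a g ac by auto
  qed
qed

lemma measurable_left [measurable]: "g \<in> carrier G \<Longrightarrow> (\<lambda>x. g \<otimes> x) \<in> measurable \<mu> \<mu>"
  by (rule measurable_mult) (auto simp: space_haar)

lemma distr_left:
  assumes g: "g \<in> carrier G" shows "distr \<mu> \<mu> (\<lambda>x. g \<otimes> x) = \<mu>"
proof (rule measure_eqI)
  fix A assume "A \<in> sets (distr \<mu> \<mu> (\<lambda>x. g \<otimes> x))"
  then have A: "A \<in> sets \<mu>" by simp
  have "emeasure \<mu> (inv g <# A) = emeasure \<mu> A"
    using haar g A unfolding haar_measure_def by auto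
  moreover have "A \<subseteq> carrier G" using sets.sets_into_space[OF A] by (simp add: space_haar)
  ultimately show "emeasure (distr \<mu> \<mu> (\<lambda>x. g \<otimes> x)) A = emeasure \<mu> A"
    using A g by (simp add: emeasure_distr vimage_left_mult space_haar)
qed simp

lemma emeasure_left_coset:
  "g \<in> carrier G \<Longrightarrow> A \<in> sets \<mu> \<Longrightarrow> emeasure \<mu> (g <# A) = emeasure \<mu> A"
  using haar unfolding haar_measure_def by auto

lemma left_coset_sets:
  assumes g: "g \<in> carrier G" and A: "A \<in> sets \<mu>" shows "g <# A \<in> sets \<mu>"
proof -
  have "(\<lambda>x. inv g \<otimes> x) -` A \<inter> space \<mu> \<in> sets \<mu>"
    using g A by (intro measurable_sets[OF measurable_left]) auto
  then show ?thesis using vimage_left_mult[of "inv g" A] g sets.sets_into_space[OF A] by (simp add: space_haar)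
qed

text \<open>Infinitely many disjoint translates of equal measure do not fit into a finite measure.\<close>

lemma null_of_disjoint_translates:
  assumes Z: "Z \<in> sets \<mu>" and g: "\<And>m::nat. g m \<in> carrier G"
    and disj: "\<And>l m. l \<noteq> m \<Longrightarrow> (g l <# Z) \<inter> (g m <# Z) = {}"
  shows "Z \<in> null_sets \<mu>"
proof -
  have "(\<lambda>m. measure \<mu> (g m <# Z)) sums measure \<mu> (\<Union>m. g m <# Z)"
    using disj by (intro finite_measure_UNION) (auto simp: left_coset_sets Z g disjoint_family_on_def)
  moreover have "measure \<mu> (g m <# Z) = measure \<mu> Z" for m
    using emeasure_left_coset[OF g Z] by (simp add: measure_def)
  ultimately have "summable (\<lambda>m::nat. measure \<mu> Z)" by (simp add: sums_iff)
  then have "measure \<mu> Z = 0" by (simp add: LIMSEQ_const_iff[symmetric] summable_LIMSEQ_zero)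
  then show ?thesis using Z by (simp add: emeasure_eq_measure null_setsI)
qed

lemma nn_integral_left:
  assumes "g \<in> carrier G" "f \<in> borel_measurable \<mu>"
  shows "(\<integral>\<^sup>+x. f (g \<otimes> x) \<partial>\<mu>) = (\<integral>\<^sup>+x. f x \<partial>\<mu>)"
proof -
  have "(\<integral>\<^sup>+x. f x \<partial>distr \<mu> \<mu> (\<lambda>x. g \<otimes> x)) = (\<integral>\<^sup>+x. f (g \<otimes> x) \<partial>\<mu>)"
    by (rule nn_integral_distr[OF measurable_left[OF assms(1)]]) (use assms(2) in simp)
  then show ?thesis by (simp only: distr_left[OF assms(1)])
qed

end

sublocale haar_compact \<subseteq> product_sigma_finite "\<lambda>_::nat. \<mu>"
  by standard

section \<open>Finite powers: Fubini and translations in one coordinate\<close>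

locale haar_power = haar_compact +
  fixes I :: "nat set"
  assumes finI: "finite I"
begin

abbreviation "M \<equiv> Pi\<^sub>M I (\<lambda>_. \<mu>)"

lemma space_M: "space M = (\<Pi>\<^sub>E i\<in>I. carrier G)"
  by (simp add: space_PiM space_haar)

lemma M_component: "t \<in> space M \<Longrightarrow> i \<in> I \<Longrightarrow> t i \<in> carrier G"
  by (auto simp: space_M)

lemma upd_space: "t \<in> space M \<Longrightarrow> x \<in> carrier G \<Longrightarrow> i \<in> I \<Longrightarrow> t(i := x) \<in> space M"
  by (auto simp: space_M PiE_def extensional_def)

lemma measurable_upd [measurable (raw)]:
  assumes "i \<in> I" "f \<in> measurable N M" "h \<in> measurable N \<mu>"
  shows "(\<lambda>x. (f x)(i := h x)) \<in> measurable N M"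
  using assms by (intro measurable_fun_upd[where J=I]) auto

lemma measurable_comp: "i \<in> I \<Longrightarrow> (\<lambda>t. t i) \<in> measurable M \<mu>"
  by measurable

text \<open>Fubini in a form that keeps slices indexed by points of the whole power: the old value
  of coordinate \<open>i\<close> is overwritten, so integrating over it contributes only the total
  mass of \<open>\<mu>\<close>.\<close>

lemma nn_integral_upd:
  assumes i: "i \<in> I" and f[measurable]: "f \<in> borel_measurable M"
  shows "(\<integral>\<^sup>+t. (\<integral>\<^sup>+x. f (t(i := x)) \<partial>\<mu>) \<partial>M) = emeasure \<mu> (space \<mu>) * (\<integral>\<^sup>+t. f t \<partial>M)"
proof -
  let ?J = "I - {i}"
  have J: "finite ?J" "i \<notin> ?J" "insert i ?J = I" using finI i by auto
  have F: "(\<lambda>t. \<integral>\<^sup>+x. f (t(i := x)) \<partial>\<mu>) \<in> borel_measurable M"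
    using i by measurable
  have "(\<integral>\<^sup>+t. (\<integral>\<^sup>+x. f (t(i := x)) \<partial>\<mu>) \<partial>M) =
     (\<integral>\<^sup>+t. (\<integral>\<^sup>+y. (\<integral>\<^sup>+x. f ((t(i := y))(i := x)) \<partial>\<mu>) \<partial>\<mu>) \<partial>(Pi\<^sub>M ?J (\<lambda>_. \<mu>)))"
    by (rule product_nn_integral_insert[OF J(1,2), unfolded J(3), OF F])
  also have "\<dots> = (\<integral>\<^sup>+t. emeasure \<mu> (space \<mu>) * (\<integral>\<^sup>+x. f (t(i := x)) \<partial>\<mu>) \<partial>(Pi\<^sub>M ?J (\<lambda>_. \<mu>)))"
    by (simp add: mult.commute)
  also have "\<dots> = emeasure \<mu> (space \<mu>) * (\<integral>\<^sup>+t. (\<integral>\<^sup>+x. f (t(i := x)) \<partial>\<mu>) \<partial>(Pi\<^sub>M ?J (\<lambda>_. \<mu>)))"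
  proof (rule nn_integral_cmult)
    have "(\<lambda>(t, x). t(i := x)) \<in> measurable (Pi\<^sub>M ?J (\<lambda>_. \<mu>) \<Otimes>\<^sub>M \<mu>) (Pi\<^sub>M (insert i ?J) (\<lambda>_. \<mu>))"
      by measurable
    then have [measurable]: "(\<lambda>(t, x). t(i := x)) \<in> measurable (Pi\<^sub>M ?J (\<lambda>_. \<mu>) \<Otimes>\<^sub>M \<mu>) M"
      by (simp only: J(3))
    have "(\<lambda>z. f ((\<lambda>(t, x). t(i := x)) z)) \<in> borel_measurable (Pi\<^sub>M ?J (\<lambda>_. \<mu>) \<Otimes>\<^sub>M \<mu>)"
      by measurable
    then show "(\<lambda>t. \<integral>\<^sup>+x. f (t(i := x)) \<partial>\<mu>) \<in> borel_measurable (Pi\<^sub>M ?J (\<lambda>_. \<mu>))"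
      by (intro borel_measurable_nn_integral) (simp add: case_prod_beta)
  qed
  also have "(\<integral>\<^sup>+t. (\<integral>\<^sup>+x. f (t(i := x)) \<partial>\<mu>) \<partial>(Pi\<^sub>M ?J (\<lambda>_. \<mu>))) = (\<integral>\<^sup>+t. f t \<partial>M)"
    by (rule product_nn_integral_insert[OF J(1,2), unfolded J(3), OF f, symmetric])
  finally show ?thesis .
qed

lemma AE_upd:
  assumes i: "i \<in> I" and P: "AE t in M. P t"
  shows "AE t in M. AE x in \<mu>. P (t(i := x))"
proof -
  obtain N where N: "{t\<in>space M. \<not> P t} \<subseteq> N" "N \<in> null_sets M"
    using P unfolding eventually_ae_filter by auto
  then have [measurable]: "N \<in> sets M" by auto
  have "(\<integral>\<^sup>+t. (\<integral>\<^sup>+x. indicator N (t(i := x)) \<partial>\<mu>) \<partial>M) = 0"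
    using N(2) i by (subst nn_integral_upd) auto
  then have ae: "AE t in M. (\<integral>\<^sup>+x. indicator N (t(i := x)) \<partial>\<mu>) = 0"
    using i by (subst (asm) nn_integral_0_iff_AE) measurable
  show ?thesis
  proof (rule AE_mp[OF ae], rule AE_I2, rule impI)
    fix t assume t: "t \<in> space M" and 0: "(\<integral>\<^sup>+x. indicator N (t(i := x)) \<partial>\<mu>) = 0"
    have [measurable]: "(\<lambda>x. t(i := x)) \<in> measurable \<mu> M" using i t by measurable
    have "AE x in \<mu>. indicator N (t(i := x)) = (0::ennreal)"
      using 0 by (subst (asm) nn_integral_0_iff_AE) auto
    then show "AE x in \<mu>. P (t(i := x))"
      by (rule AE_mp, intro AE_I2 impI) (use N(1) upd_space[OF t _ i] in \<open>auto simp: space_haar indicator_def split: if_splits\<close>)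
  qed
qed

text \<open>The converse of \<open>AE_upd\<close>. It needs a measurable predicate, since sections
  that are null do not make an arbitrary set null.\<close>

lemma AE_upd_iff:
  assumes i: "i \<in> I" and [measurable]: "Measurable.pred M P"
    and P: "AE t in M. AE x in \<mu>. P (t(i := x))"
  shows "AE t in M. P t"
proof -
  let ?N = "{t\<in>space M. \<not> P t}"
  have [measurable]: "?N \<in> sets M" by measurable
  have "(\<integral>\<^sup>+t. (\<integral>\<^sup>+x. indicator ?N (t(i := x)) \<partial>\<mu>) \<partial>M) = (\<integral>\<^sup>+t. 0 \<partial>M)"
  proof (rule nn_integral_cong_AE, rule AE_mp[OF P], intro AE_I2 impI)
    fix t assume t: "t \<in> space M" and ae: "AE x in \<mu>. P (t(i := x))"
    have "(\<integral>\<^sup>+x. indicator ?N (t(i := x)) \<partial>\<mu>) = (\<integral>\<^sup>+x. 0 \<partial>\<mu>)"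
      by (rule nn_integral_cong_AE, rule AE_mp[OF ae]) (auto simp: indicator_def)
    then show "(\<integral>\<^sup>+x. indicator ?N (t(i := x)) \<partial>\<mu>) = 0" by simp
  qed
  then have "emeasure \<mu> (space \<mu>) * emeasure M ?N = 0"
    using nn_integral_upd[OF i, of "indicator ?N"] by simp
  then have "emeasure M ?N = 0" using emeasure_space_neq_0 by simp
  then show ?thesis by (intro AE_I[where N="?N"]) auto
qed

definition shift :: "nat \<Rightarrow> ((nat \<Rightarrow> 'a) \<Rightarrow> 'a) \<Rightarrow> (nat \<Rightarrow> 'a) \<Rightarrow> nat \<Rightarrow> 'a" where
  "shift i W t = t(i := W t \<otimes> t i)"

lemma shift_measurable [measurable]:
  "i \<in> I \<Longrightarrow> W \<in> measurable M \<mu> \<Longrightarrow> shift i W \<in> measurable M M"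
  unfolding shift_def[abs_def] by (intro measurable_upd measurable_mult measurable_comp) auto

text \<open>Since \<open>W\<close> ignores coordinate \<open>i\<close>, on each slice the map is
  left translation by a fixed element.\<close>

lemma distr_shift:
  assumes i: "i \<in> I" and W[measurable]: "W \<in> measurable M \<mu>"
    and Wi: "\<And>t x. t \<in> space M \<Longrightarrow> x \<in> carrier G \<Longrightarrow> W (t(i := x)) = W t"
  shows "distr M M (shift i W) = M"
proof (rule measure_eqI)
  fix A assume "A \<in> sets (distr M M (shift i W))"
  then have [measurable]: "A \<in> sets M" by simp
  note [measurable] = shift_measurable[OF i W]
  have "emeasure \<mu> (space \<mu>) * emeasure (distr M M (shift i W)) A = emeasure \<mu> (space \<mu>) * (\<integral>\<^sup>+t. indicator A (shift i W t) \<partial>M)"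
    by (subst nn_integral_indicator[symmetric], simp, subst nn_integral_distr) auto
  also have "\<dots> = (\<integral>\<^sup>+t. (\<integral>\<^sup>+x. indicator A (shift i W (t(i := x))) \<partial>\<mu>) \<partial>M)"
    by (rule nn_integral_upd[symmetric, OF i]) measurable
  also have "\<dots> = (\<integral>\<^sup>+t. (\<integral>\<^sup>+x. indicator A (t(i := x)) \<partial>\<mu>) \<partial>M)"
  proof (rule nn_integral_cong)
    fix t assume t: "t \<in> space M"
    have [measurable]: "(\<lambda>x. t(i := x)) \<in> measurable \<mu> M" using i t by measurable
    have "(\<integral>\<^sup>+x. indicator A (shift i W (t(i := x))) \<partial>\<mu>) = (\<integral>\<^sup>+x. indicator A (t(i := W t \<otimes> x)) \<partial>\<mu>)"
      by (rule nn_integral_cong) (simp add: shift_def Wi t space_haar)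
    also have "\<dots> = (\<integral>\<^sup>+x. indicator A (t(i := x)) \<partial>\<mu>)"
      using measurable_space[OF W t] by (intro nn_integral_left[of "W t" "\<lambda>x. indicator A (t(i := x))"]) (auto simp: space_haar)
    finally show "(\<integral>\<^sup>+x. indicator A (shift i W (t(i := x))) \<partial>\<mu>) = (\<integral>\<^sup>+x. indicator A (t(i := x)) \<partial>\<mu>)" .
  qed
  also have "\<dots> = emeasure \<mu> (space \<mu>) * emeasure M A"
    by (subst nn_integral_upd[OF i]) auto
  finally show "emeasure (distr M M (shift i W)) A = emeasure M A"
    using emeasure_space_neq_0 by (simp add: ennreal_mult_cancel_left emeasure_eq_measure)
qed simp

sublocale M: finite_measure M
proof
  interpret finite_product_sigma_finite "\<lambda>_. \<mu>" I by standard (rule finI)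
  show "emeasure M (space M) \<noteq> \<infinity>"
    by (simp add: space_PiM measure_times emeasure_eq_measure ennreal_power)
qed

text \<open>The generator fed to the convergence lemma: stable under intersection, and open in each
  coordinate, so that coordinatewise convergence eventually enters a box containing the
  limit.\<close>

definition open_boxes :: "(nat \<Rightarrow> 'a) set set" where
  "open_boxes = {Pi\<^sub>E I A | A. \<forall>i\<in>I. openin T (A i)}"

lemma open_boxes_subset: "open_boxes \<subseteq> Pow (space M)"
proof
  fix C assume "C \<in> open_boxes"
  then obtain A where A: "C = Pi\<^sub>E I A" "\<forall>i\<in>I. openin T (A i)" unfolding open_boxes_def by auto
  have "A i \<subseteq> carrier G" if "i \<in> I" for i using A(2) that openin_subset[of T "A i"] by (simp add: topspace_eq)
  then show "C \<in> Pow (space M)" unfolding A(1) space_M by (auto intro: PiE_mono[THEN subsetD])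
qed

lemma sets_M: "sets M = sigma_sets (space M) open_boxes"
proof -
  let ?E = "{U. openin T U}"
  have E: "?E \<subseteq> Pow (carrier G)" using openin_subset[of T] by (auto simp: topspace_eq)
  have c: "carrier G \<in> ?E" using openin_topspace[of T] by (simp add: topspace_eq)
  have "sets M = sets (Pi\<^sub>M I (\<lambda>_. sigma (carrier G) ?E))"
    by (rule sets_PiM_cong) (simp_all add: sets_haar sets_measure_of E)
  also have "\<dots> = sets (sigma (\<Pi>\<^sub>E i\<in>I. carrier G) {{f\<in>(\<Pi>\<^sub>E i\<in>I. carrier G). \<forall>i\<in>j. f i \<in> A i} | A j. j \<in> {I} \<and> A \<in> Pi j (\<lambda>_. ?E)})"
  proof (rule sets_PiM_sigma)
    show "\<exists>S\<subseteq>{U. openin T U}. countable S \<and> carrier G = \<Union>S" by (rule exI[of _ "{carrier G}"]) (use c in auto)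
  qed (use E in \<open>auto simp: finI\<close>)
  also have "{{f\<in>(\<Pi>\<^sub>E i\<in>I. carrier G). \<forall>i\<in>j. f i \<in> A i} | A j. j \<in> {I} \<and> A \<in> Pi j (\<lambda>_. ?E)} = open_boxes"
  proof -
    have "{f\<in>(\<Pi>\<^sub>E i\<in>I. carrier G). \<forall>i\<in>I. f i \<in> A i} = Pi\<^sub>E I A" if "\<forall>i\<in>I. openin T (A i)" for A
    proof -
      have "A i \<subseteq> carrier G" if "i \<in> I" for i using \<open>\<forall>i\<in>I. openin T (A i)\<close> that openin_subset[of T "A i"] by (simp add: topspace_eq)
      then show ?thesis by (auto simp: PiE_def Pi_def)
    qed
    then have "{{f\<in>(\<Pi>\<^sub>E i\<in>I. carrier G). \<forall>i\<in>j. f i \<in> A i} | A j. j \<in> {I} \<and> A \<in> Pi j (\<lambda>_. ?E)}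
        = {Pi\<^sub>E I A | A. A \<in> Pi I (\<lambda>_. ?E)}"
      by (intro Collect_cong iff_exI) (auto simp: Pi_iff)
    also have "\<dots> = open_boxes" unfolding open_boxes_def by (simp add: Pi_iff)
    finally show ?thesis .
  qed
  finally show ?thesis
    using open_boxes_subset by (simp add: sets_measure_of space_M)
qed

lemma Int_stable_open_boxes: "Int_stable open_boxes"
proof (rule Int_stableI)
  fix a b assume "a \<in> open_boxes" "b \<in> open_boxes"
  then obtain A B where "a = Pi\<^sub>E I A" "b = Pi\<^sub>E I B" "\<forall>i\<in>I. openin T (A i)" "\<forall>i\<in>I. openin T (B i)"
    unfolding open_boxes_def by auto
  then show "a \<inter> b \<in> open_boxes" unfolding open_boxes_def
    by (auto simp: PiE_Int intro!: exI[of _ "\<lambda>i. A i \<inter> B i"])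
qed

lemma integral_translation_tendsto_0:
  fixes f :: "_ \<Rightarrow> complex"
  assumes i: "i \<in> I" and g: "\<And>p. g p \<in> carrier G" "limitin T g \<one> sequentially"
    and f: "integrable M f"
  shows "(\<lambda>p. \<integral>t. norm (f (t(i := g p \<otimes> t i)) - f t) \<partial>M) \<longlonglongrightarrow> 0"
proof (rule M.integral_norm_comp_diff_tendsto_0[where \<tau>="\<lambda>t. t" and \<tau>p="\<lambda>p t. t(i := g p \<otimes> t i)" and E=open_boxes])
  have W: "(\<lambda>t. g p) \<in> measurable M \<mu>" for p using g by (simp add: space_haar)
  show "(\<lambda>t. t(i := g p \<otimes> t i)) \<in> measurable M M" for p
    using shift_measurable[OF i W] by (simp add: shift_def[abs_def])
  show "distr M M (\<lambda>t. t(i := g p \<otimes> t i)) = M" for p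
    using distr_shift[OF i W] by (simp add: shift_def[abs_def])
  fix A t assume A: "A \<in> open_boxes" and t: "t \<in> space M" "t \<in> A"
  then obtain B where B: "A = Pi\<^sub>E I B" "\<forall>i\<in>I. openin T (B i)" unfolding open_boxes_def by auto
  have "continuous_map T T (\<lambda>x. x \<otimes> t i)"
  proof -
    have "continuous_map T (prod_topology T T) (\<lambda>x. (x, t i))"
      by (intro continuous_map_pairedI continuous_map_id[unfolded id_def]) (use M_component[OF t(1) i] in \<open>simp add: topspace_eq\<close>)
    from continuous_map_compose[OF this continuous_mult] show ?thesis by (simp add: o_def)
  qed
  from continuous_map_limit[OF this g(2)] have "limitin T (\<lambda>p. g p \<otimes> t i) (t i) sequentially"
    using M_component[OF t(1) i] by (simp add: o_def)
  then have "\<forall>\<^sub>F p in sequentially. g p \<otimes> t i \<in> B i"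
    by (rule limitinD) (use B t i in auto)
  then show "\<forall>\<^sub>F p in sequentially. t(i := g p \<otimes> t i) \<in> A"
    by eventually_elim (use B t i in \<open>auto simp: PiE_def extensional_def\<close>)
qed (use sets_M Int_stable_open_boxes open_boxes_subset f in \<open>auto simp: distr_id\<close>)

end

section \<open>Left stabilisers\<close>

context haar_compact
begin

lemma continuous_right_mult:
  assumes "a \<in> carrier G" shows "continuous_map T T (\<lambda>x. x \<otimes> a)"
proof -
  have "continuous_map T (prod_topology T T) (\<lambda>x. (x, a))"
    by (intro continuous_map_pairedI continuous_map_id[unfolded id_def]) (use assms in \<open>simp add: topspace_eq\<close>)
  from continuous_map_compose[OF this continuous_mult] show ?thesis by (simp add: o_def)
qed

text \<open>Integrate the indicator of \<open>g\<inverse> y \<in> A\<close> over \<open>(g, y)\<close> in both orders.\<close>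

lemma distr_inv: "distr \<mu> \<mu> (\<lambda>x. inv x) = \<mu>"
proof (rule measure_eqI)
  fix A assume "A \<in> sets (distr \<mu> \<mu> (\<lambda>x. inv x))"
  then have A[measurable]: "A \<in> sets \<mu>" by simp
  interpret P: pair_sigma_finite \<mu> \<mu> by standard
  let ?f = "\<lambda>(g, y). indicator A (inv g \<otimes> y) :: ennreal"
  have f: "?f \<in> borel_measurable (\<mu> \<Otimes>\<^sub>M \<mu>)" by measurable
  have 1: "(\<integral>\<^sup>+y. indicator A (inv g \<otimes> y) \<partial>\<mu>) = emeasure \<mu> A" if "g \<in> space \<mu>" for g
    using nn_integral_left[of "inv g" "indicator A"] that by (simp add: space_haar)
  have 2: "(\<integral>\<^sup>+g. indicator A (inv g \<otimes> y) \<partial>\<mu>) = emeasure (distr \<mu> \<mu> (\<lambda>x. inv x)) A" if y: "y \<in> space \<mu>" for y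
  proof -
    have m: "(\<lambda>g. indicator A (inv g \<otimes> y)) \<in> borel_measurable \<mu>" using y by measurable
    have "(\<integral>\<^sup>+g. indicator A (inv g \<otimes> y) \<partial>\<mu>) = (\<integral>\<^sup>+g. indicator A (inv (y \<otimes> g) \<otimes> y) \<partial>\<mu>)"
      using nn_integral_left[OF _ m, of y] y by (simp add: space_haar)
    also have "\<dots> = (\<integral>\<^sup>+g. indicator A (inv g) \<partial>\<mu>)"
      using y by (intro nn_integral_cong) (simp add: space_haar inv_mult_group m_assoc)
    also have "\<dots> = (\<integral>\<^sup>+g. indicator A g \<partial>distr \<mu> \<mu> (\<lambda>x. inv x))"
      by (rule nn_integral_distr[symmetric]) auto
    finally show ?thesis by simp
  qed
  have "(\<integral>\<^sup>+g. \<integral>\<^sup>+y. indicator A (inv g \<otimes> y) \<partial>\<mu> \<partial>\<mu>) = (\<integral>\<^sup>+y. \<integral>\<^sup>+g. indicator A (inv g \<otimes> y) \<partial>\<mu> \<partial>\<mu>)"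
    using P.Fubini[OF f] by simp
  then have "emeasure \<mu> A * emeasure \<mu> (space \<mu>) = emeasure (distr \<mu> \<mu> (\<lambda>x. inv x)) A * emeasure \<mu> (space \<mu>)"
    by (simp add: 1 2 cong: nn_integral_cong)
  then show "emeasure (distr \<mu> \<mu> (\<lambda>x. inv x)) A = emeasure \<mu> A"
    using emeasure_space_neq_0 emeasure_finite[of "space \<mu>"]
    by (simp add: mult.commute[of _ "emeasure \<mu> (space \<mu>)"] ennreal_mult_cancel_left del: emeasure_finite)
qed simp

lemma AE_inv: "AE x in \<mu>. P x \<Longrightarrow> AE x in \<mu>. P (inv x)"
  by (rule AE_distrD[OF measurable_inv]) (subst distr_inv)

lemma AE_left: "g \<in> carrier G \<Longrightarrow> AE x in \<mu>. P x \<Longrightarrow> AE x in \<mu>. P (g \<otimes> x)"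
  by (rule AE_distrD[OF measurable_left]) (auto simp only: distr_left)

text \<open>Right translation is left translation conjugated by inversion, and inversion preserves
  \<open>\<mu>\<close> by \<open>distr_inv\<close>.\<close>

lemma AE_right:
  assumes g: "g \<in> carrier G" and P: "AE x in \<mu>. P (x \<otimes> g)"
  shows "AE x in \<mu>. P x"
proof -
  have "AE x in \<mu>. P (inv x \<otimes> g)" using AE_inv[OF P] .
  from AE_left[OF g this] have "AE x in \<mu>. P (inv (g \<otimes> x) \<otimes> g)" .
  then have "AE x in \<mu>. P (inv x)"
    by (rule AE_mp) (use g in \<open>auto intro!: AE_I2 simp: space_haar inv_mult_group m_assoc\<close>)
  from AE_inv[OF this] show ?thesis
    by (rule AE_mp) (auto intro!: AE_I2 simp: space_haar)
qed

lemma AE_E_witness: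
  assumes "AE x in \<mu>. P x" shows "\<exists>x\<in>carrier G. P x"
proof (rule ccontr)
  assume "\<not> ?thesis"
  then have "AE x in \<mu>. \<not> P x" by (intro AE_I2) (auto simp: space_haar)
  with assms have "AE x in \<mu>. False" by (rule AE_mp[OF _ AE_mp]) (auto intro!: AE_I2)
  then have "emeasure \<mu> (space \<mu>) = 0" by (simp add: AE_iff_measurable[OF sets.top])
  then show False using emeasure_space_neq_0 by simp
qed

text \<open>The stabiliser of the class of \<open>\<phi>\<close> modulo null sets; the exceptional
  set may depend on \<open>g\<close>.\<close>

definition left_stab :: "('a \<Rightarrow> complex) \<Rightarrow> 'a set" where
  "left_stab \<phi> = {g \<in> carrier G. AE x in \<mu>. \<phi> (g \<otimes> x) = \<phi> x}"

definition seq_closed_subgroup :: "'a set \<Rightarrow> bool" where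
  "seq_closed_subgroup S \<longleftrightarrow> subgroup S G \<and>
     (\<forall>\<sigma> x. (\<forall>n. \<sigma> n \<in> S) \<longrightarrow> limitin T \<sigma> x sequentially \<longrightarrow> x \<in> S)"

text \<open>The \<open>g n\<close> need only stabilise \<open>\<phi>\<close> asymptotically.
  Translation is continuous in \<open>L\<^sup>1\<close>, so translation by \<open>w\<close> differs
  from the identity on \<open>\<phi>\<close> by two quantities that tend to 0. This turns small
  perturbations into exact invariance.\<close>

lemma left_stab_limit:
  assumes \<phi>: "integrable \<mu> \<phi>" and g: "\<And>n. g n \<in> carrier G" and lim: "limitin T g w sequentially"
    and zero: "(\<lambda>n. \<integral>x. norm (\<phi> (g n \<otimes> x) - \<phi> x) \<partial>\<mu>) \<longlonglongrightarrow> 0"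
  shows "w \<in> left_stab \<phi>"
proof -
  have w: "w \<in> carrier G" using limitin_topspace[OF lim] by (simp add: topspace_eq)
  have tr: "(\<lambda>n. \<integral>x. norm (\<phi> (g n \<otimes> x) - \<phi> (w \<otimes> x)) \<partial>\<mu>) \<longlonglongrightarrow> 0"
  proof (rule integral_norm_comp_diff_tendsto_0[where E="{U. openin T U}"])
    show "{U. openin T U} \<subseteq> Pow (space \<mu>)" using openin_subset[of T] by (auto simp: space_haar topspace_eq)
    show "Int_stable {U. openin T U}" by (auto simp: Int_stable_def)
    fix A t assume A: "A \<in> {U. openin T U}" and t: "t \<in> space \<mu>" "w \<otimes> t \<in> A"
    have "limitin T (\<lambda>n. g n \<otimes> t) (w \<otimes> t) sequentially"
      using continuous_map_limit[OF continuous_right_mult lim, of t] t by (simp add: o_def space_haar)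
    then show "\<forall>\<^sub>F p in sequentially. g p \<otimes> t \<in> A"
      by (rule limitinD) (use A t in auto)
  qed (use g w \<phi> in \<open>auto simp: distr_left sets_haar space_haar\<close>)
  have int: "integrable \<mu> (\<lambda>x. \<phi> (h \<otimes> x))" if "h \<in> carrier G" for h
    by (rule integrable_distr[of _ \<mu> \<mu>]) (use that \<phi> in \<open>auto simp: distr_left\<close>)
  let ?L = "\<integral>x. norm (\<phi> (w \<otimes> x) - \<phi> x) \<partial>\<mu>"
  have bound: "?L \<le> (\<integral>x. norm (\<phi> (g n \<otimes> x) - \<phi> (w \<otimes> x)) \<partial>\<mu>) + (\<integral>x. norm (\<phi> (g n \<otimes> x) - \<phi> x) \<partial>\<mu>)" for n
  proof -
    note i1 = Bochner_Integration.integrable_diff[OF int[OF g[of n]] int[OF w], THEN integrable_norm]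
    note i2 = Bochner_Integration.integrable_diff[OF int[OF g[of n]] \<phi>, THEN integrable_norm]
    note i3 = Bochner_Integration.integrable_diff[OF int[OF w] \<phi>, THEN integrable_norm]
    have "?L \<le> (\<integral>x. norm (\<phi> (g n \<otimes> x) - \<phi> (w \<otimes> x)) + norm (\<phi> (g n \<otimes> x) - \<phi> x) \<partial>\<mu>)"
    proof (rule integral_mono[OF i3 Bochner_Integration.integrable_add[OF i1 i2]])
      fix x
      show "norm (\<phi> (w \<otimes> x) - \<phi> x) \<le> norm (\<phi> (g n \<otimes> x) - \<phi> (w \<otimes> x)) + norm (\<phi> (g n \<otimes> x) - \<phi> x)"
        using norm_triangle_ineq4[of "\<phi> (g n \<otimes> x) - \<phi> x" "\<phi> (g n \<otimes> x) - \<phi> (w \<otimes> x)"] by simp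
    qed
    then show ?thesis using Bochner_Integration.integral_add[OF i1 i2] by simp
  qed
  have "(\<lambda>n. (\<integral>x. norm (\<phi> (g n \<otimes> x) - \<phi> (w \<otimes> x)) \<partial>\<mu>) + (\<integral>x. norm (\<phi> (g n \<otimes> x) - \<phi> x) \<partial>\<mu>)) \<longlonglongrightarrow> 0 + 0"
    by (rule tendsto_add[OF tr zero])
  then have "?L \<le> 0 + 0" by (rule LIMSEQ_le_const) (use bound in auto)
  moreover have "0 \<le> ?L" by simp
  ultimately have "?L = 0" by linarith
  then have "AE x in \<mu>. norm (\<phi> (w \<otimes> x) - \<phi> x) = 0"
    by (subst (asm) integral_nonneg_eq_0_iff_AE)
      (auto intro!: integrable_norm Bochner_Integration.integrable_diff int w \<phi>)
  then show ?thesis using w by (simp add: left_stab_def)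
qed

lemma seq_closed_left_stab:
  assumes \<phi>: "integrable \<mu> \<phi>"
  shows "seq_closed_subgroup (left_stab \<phi>)"
  unfolding seq_closed_subgroup_def
proof (intro conjI allI impI)
  show "subgroup (left_stab \<phi>) G"
  proof
    show "left_stab \<phi> \<subseteq> carrier G" by (auto simp: left_stab_def)
    show "\<one> \<in> left_stab \<phi>" by (auto simp: left_stab_def space_haar intro!: AE_I2)
    fix g h assume g: "g \<in> left_stab \<phi>" and h: "h \<in> left_stab \<phi>"
    have "AE x in \<mu>. \<phi> (g \<otimes> (h \<otimes> x)) = \<phi> (h \<otimes> x)"
      using g h by (intro AE_left) (auto simp: left_stab_def)
    moreover have "AE x in \<mu>. \<phi> (h \<otimes> x) = \<phi> x" using h by (simp add: left_stab_def)
    ultimately have "AE x in \<mu>. \<phi> (g \<otimes> h \<otimes> x) = \<phi> x"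
      by (rule AE_mp[OF _ AE_mp]) (use g h in \<open>auto intro!: AE_I2 simp: left_stab_def space_haar m_assoc\<close>)
    then show "g \<otimes> h \<in> left_stab \<phi>" using g h by (simp add: left_stab_def)
  next
    fix g assume g: "g \<in> left_stab \<phi>"
    then have gc: "g \<in> carrier G" and "AE x in \<mu>. \<phi> (g \<otimes> x) = \<phi> x" by (auto simp: left_stab_def)
    then have "AE x in \<mu>. \<phi> (g \<otimes> (inv g \<otimes> x)) = \<phi> (inv g \<otimes> x)"
      by (intro AE_left[of "inv g"]) auto
    then have "AE x in \<mu>. \<phi> (inv g \<otimes> x) = \<phi> x"
      by (rule AE_mp) (use gc in \<open>auto intro!: AE_I2 simp: space_haar m_assoc[symmetric]\<close>)
    then show "inv g \<in> left_stab \<phi>" using gc by (simp add: left_stab_def)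
  qed
  fix \<sigma> x assume \<sigma>: "\<forall>n. \<sigma> n \<in> left_stab \<phi>" and lim: "limitin T \<sigma> x sequentially"
  have "(\<integral>x. norm (\<phi> (\<sigma> n \<otimes> x) - \<phi> x) \<partial>\<mu>) = 0" for n
  proof -
    have "AE x in \<mu>. \<phi> (\<sigma> n \<otimes> x) = \<phi> x" using \<sigma> by (simp add: left_stab_def)
    then show ?thesis by (intro integral_eq_zero_AE) (auto elim: AE_mp)
  qed
  then show "x \<in> left_stab \<phi>"
    by (intro left_stab_limit[OF \<phi> _ lim]) (use \<sigma> in \<open>auto simp: left_stab_def\<close>)
qed

text \<open>Fubini exchanges the quantifiers: some \<open>x\<close> satisfies
  \<open>\<phi> (g \<otimes> x) = \<phi> x\<close> for almost every \<open>g\<close>, and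
  \<open>AE_right\<close> removes the factor \<open>x\<close>.\<close>

lemma left_stab_full_imp_const:
  assumes \<phi>: "integrable \<mu> \<phi>" and full: "left_stab \<phi> = carrier G"
  shows "\<exists>c. AE x in \<mu>. \<phi> x = c"
proof -
  interpret P: pair_sigma_finite \<mu> \<mu> by standard
  have [measurable]: "\<phi> \<in> borel_measurable \<mu>" using \<phi> by auto
  have "AE g in \<mu>. AE x in \<mu>. \<phi> (g \<otimes> x) = \<phi> x"
    using full by (intro AE_I2[where P="\<lambda>g. AE x in \<mu>. \<phi> (g \<otimes> x) = \<phi> x"]) (auto simp: left_stab_def space_haar)
  then have "AE x in \<mu>. AE g in \<mu>. \<phi> (g \<otimes> x) = \<phi> x"
    by (subst (asm) P.AE_commute) measurable
  then obtain x where x: "x \<in> carrier G" "AE g in \<mu>. \<phi> (g \<otimes> x) = \<phi> x"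
    using AE_E_witness[where P="\<lambda>x. AE g in \<mu>. \<phi> (g \<otimes> x) = \<phi> x"] by blast
  from AE_right[OF this] show ?thesis by blast
qed

text \<open>The element \<open>\<omega>\<^sub>p\<close> of the overview, with
  \<open>x\<^sub>j = a\<close>.\<close>

definition pert :: "(nat \<Rightarrow> 'a) \<Rightarrow> nat \<Rightarrow> 'a \<Rightarrow> 'a" where
  "pert g p a = (g p \<otimes> a) [^] p \<otimes> inv (a [^] p)"

lemma pert_closed: "g p \<in> carrier G \<Longrightarrow> a \<in> carrier G \<Longrightarrow> pert g p a \<in> carrier G"
  by (simp add: pert_def)

lemma pert_pow: "g p \<in> carrier G \<Longrightarrow> a \<in> carrier G \<Longrightarrow> pert g p a \<otimes> a [^] p = (g p \<otimes> a) [^] p"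
  by (simp add: pert_def m_assoc)

end

context haar_power
begin

lemma measurable_pert [measurable (raw)]:
  assumes "g p \<in> carrier G" and [measurable]: "f \<in> measurable N \<mu>"
  shows "(\<lambda>x. pert g p (f x)) \<in> measurable N \<mu>"
proof -
  have [measurable]: "(\<lambda>_. g p) \<in> measurable N \<mu>" using assms by (simp add: space_haar)
  show ?thesis unfolding pert_def by measurable
qed

lemma shift_props:
  assumes i: "i \<in> I" and W: "W \<in> measurable M \<mu>"
    and Wi: "\<And>t x. t \<in> space M \<Longrightarrow> x \<in> carrier G \<Longrightarrow> W (t(i := x)) = W t"
  shows integrable_shift: "\<And>f :: _ \<Rightarrow> 'c :: {banach, second_countable_topology}. integrable M f \<Longrightarrow> integrable M (\<lambda>t. f (t(i := W t \<otimes> t i)))"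
    and integral_shift: "\<And>f :: _ \<Rightarrow> 'c. f \<in> borel_measurable M \<Longrightarrow> (\<integral>t. f (t(i := W t \<otimes> t i)) \<partial>M) = (\<integral>t. f t \<partial>M)"
    and AE_shift: "\<And>P. AE t in M. P t \<Longrightarrow> AE t in M. P (t(i := W t \<otimes> t i))"
proof -
  note sm = shift_measurable[OF i W, unfolded shift_def[abs_def]]
  note d = distr_shift[OF assms, unfolded shift_def[abs_def]]
  show "integrable M (\<lambda>t. f (t(i := W t \<otimes> t i)))" if "integrable M f" for f :: "_ \<Rightarrow> 'c"
    by (rule integrable_distr[OF sm]) (simp add: d that)
  show "(\<integral>t. f (t(i := W t \<otimes> t i)) \<partial>M) = (\<integral>t. f t \<partial>M)" if "f \<in> borel_measurable M" for f :: "_ \<Rightarrow> 'c"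
    using integral_distr[OF sm that] by (simp add: d)
  show "AE t in M. P (t(i := W t \<otimes> t i))" if "AE t in M. P t" for P
    by (rule AE_distrD[OF sm]) (simp only: d that)
qed

lemma slice_measurable:
  assumes i: "i \<in> I" and f: "f \<in> borel_measurable M" and t: "t \<in> space M"
  shows "(\<lambda>x. f (t(i := x))) \<in> borel_measurable \<mu>"
proof -
  have "(\<lambda>x. t(i := x)) \<in> measurable \<mu> M" using i t by measurable
  from measurable_compose[OF this f] show ?thesis .
qed

lemma slice_lint_measurable:
  fixes f :: "_ \<Rightarrow> 'c :: {banach, second_countable_topology}"
  assumes i: "i \<in> I" and f[measurable]: "f \<in> borel_measurable M"
  shows "(\<lambda>t. \<integral>x. f (t(i := x)) \<partial>\<mu>) \<in> borel_measurable M"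
  using i by measurable

lemma AE_slice_integrable:
  fixes f :: "_ \<Rightarrow> 'c :: {banach, second_countable_topology}"
  assumes i: "i \<in> I" and f: "integrable M f"
  shows "AE t in M. integrable \<mu> (\<lambda>x. f (t(i := x)))"
proof -
  have fm[measurable]: "f \<in> borel_measurable M" using f by auto
  have "(\<integral>\<^sup>+t. (\<integral>\<^sup>+x. norm (f (t(i := x))) \<partial>\<mu>) \<partial>M) = emeasure \<mu> (space \<mu>) * (\<integral>\<^sup>+t. norm (f t) \<partial>M)"
    by (rule nn_integral_upd[OF i]) measurable
  also have "\<dots> < \<infinity>"
    using f emeasure_finite[of "space \<mu>"] unfolding integrable_iff_bounded
    by (simp add: ennreal_mult_eq_top_iff less_top[symmetric] del: emeasure_finite)
  finally have fin: "(\<integral>\<^sup>+t. (\<integral>\<^sup>+x. norm (f (t(i := x))) \<partial>\<mu>) \<partial>M) < \<infinity>" .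
  then have "AE t in M. (\<integral>\<^sup>+x. norm (f (t(i := x))) \<partial>\<mu>) \<noteq> \<infinity>"
    using fin i by (intro nn_integral_PInf_AE) (auto simp: less_top)
  then show ?thesis
    by (rule AE_mp) (auto intro!: AE_I2 simp: integrable_iff_bounded slice_measurable[OF i fm] less_top)
qed

text \<open>An upper bound is all that is claimed: a slice that is not integrable has Bochner
  integral 0 by convention, which lies below its nonnegative integral.\<close>

lemma slice_integral:
  assumes i: "i \<in> I" and f: "integrable M f" and nn: "\<And>t. 0 \<le> (f t :: real)"
  shows "integrable M (\<lambda>t. \<integral>x. f (t(i := x)) \<partial>\<mu>)"
    and "(\<integral>t. (\<integral>x. f (t(i := x)) \<partial>\<mu>) \<partial>M) \<le> measure \<mu> (space \<mu>) * (\<integral>t. f t \<partial>M)"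
proof -
  have fm[measurable]: "f \<in> borel_measurable M" using f by auto
  have m: "(\<lambda>t. \<integral>x. f (t(i := x)) \<partial>\<mu>) \<in> borel_measurable M" by (rule slice_lint_measurable[OF i fm])
  have le: "(\<integral>\<^sup>+t. ennreal (\<integral>x. f (t(i := x)) \<partial>\<mu>) \<partial>M) \<le> ennreal (measure \<mu> (space \<mu>) * (\<integral>t. f t \<partial>M))"
  proof -
    have "(\<integral>\<^sup>+t. ennreal (\<integral>x. f (t(i := x)) \<partial>\<mu>) \<partial>M) \<le> (\<integral>\<^sup>+t. (\<integral>\<^sup>+x. f (t(i := x)) \<partial>\<mu>) \<partial>M)"
    proof (rule nn_integral_mono)
      fix t
      show "ennreal (\<integral>x. f (t(i := x)) \<partial>\<mu>) \<le> (\<integral>\<^sup>+x. f (t(i := x)) \<partial>\<mu>)"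
        by (cases "integrable \<mu> (\<lambda>x. f (t(i := x)))") (auto simp: nn_integral_eq_integral nn not_integrable_integral_eq)
    qed
    also have "\<dots> = emeasure \<mu> (space \<mu>) * (\<integral>\<^sup>+t. f t \<partial>M)"
      by (rule nn_integral_upd[OF i]) measurable
    also have "\<dots> = ennreal (measure \<mu> (space \<mu>) * (\<integral>t. f t \<partial>M))"
      using f nn by (simp add: nn_integral_eq_integral emeasure_eq_measure ennreal_mult)
    finally show ?thesis .
  qed
  show int: "integrable M (\<lambda>t. \<integral>x. f (t(i := x)) \<partial>\<mu>)"
    by (rule integrableI_nonneg[OF m]) (use le nn in \<open>auto simp: less_top[symmetric] top_unique intro!: AE_I2 integral_nonneg\<close>)
  show "(\<integral>t. (\<integral>x. f (t(i := x)) \<partial>\<mu>) \<partial>M) \<le> measure \<mu> (space \<mu>) * (\<integral>t. f t \<partial>M)"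
    using le nn by (subst (asm) nn_integral_eq_integral[OF int]) (auto simp: ennreal_le_iff mult_nonneg_nonneg)
qed

end

section \<open>Square-integrable functions and perturbation\<close>

lemma sq_integrable_mult_cnj:
  assumes "f \<in> sq_integrable M" "g \<in> sq_integrable M"
  shows "integrable M (\<lambda>t. f t * cnj (g t))"
proof (rule Bochner_Integration.integrable_bound)
  show "integrable M (\<lambda>t. (cmod (f t))\<^sup>2 + (cmod (g t))\<^sup>2)"
    using assms by (intro Bochner_Integration.integrable_add) (auto simp: sq_integrable_def)
  have [measurable]: "f \<in> borel_measurable M" "g \<in> borel_measurable M" using assms by (auto simp: sq_integrable_def)
  show "(\<lambda>t. f t * cnj (g t)) \<in> borel_measurable M"
    by (intro borel_measurable_times borel_measurable_continuous_on[of cnj] continuous_intros) auto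
  have "cmod a * cmod b \<le> (cmod a)\<^sup>2 + (cmod b)\<^sup>2" for a b
    using sum_squares_bound[of "cmod a" "cmod b"] mult_nonneg_nonneg[OF norm_ge_zero[of a] norm_ge_zero[of b]] by linarith
  then show "AE t in M. norm (f t * cnj (g t)) \<le> norm ((cmod (f t))\<^sup>2 + (cmod (g t))\<^sup>2)"
    by (intro AE_I2) (simp add: norm_mult)
qed

lemma sq_integrable_scale: "f \<in> sq_integrable M \<Longrightarrow> (\<lambda>t. c * f t) \<in> sq_integrable M"
  by (auto simp: sq_integrable_def norm_mult power_mult_distrib)

lemma sq_integrable_add:
  assumes "f \<in> sq_integrable M" "g \<in> sq_integrable M"
  shows "(\<lambda>t. f t + g t) \<in> sq_integrable M"
  unfolding sq_integrable_def
proof (intro CollectI conjI)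
  have [measurable]: "f \<in> borel_measurable M" "g \<in> borel_measurable M" using assms by (auto simp: sq_integrable_def)
  show "(\<lambda>t. f t + g t) \<in> borel_measurable M" by measurable
  show "integrable M (\<lambda>t. (cmod (f t + g t))\<^sup>2)"
  proof (rule Bochner_Integration.integrable_bound)
    show "integrable M (\<lambda>t. 2 * (cmod (f t))\<^sup>2 + 2 * (cmod (g t))\<^sup>2)"
      using assms by (intro Bochner_Integration.integrable_add integrable_mult_right) (auto simp: sq_integrable_def)
    have "(cmod (a + b))\<^sup>2 \<le> 2 * (cmod a)\<^sup>2 + 2 * (cmod b)\<^sup>2" for a b
    proof -
      have "(cmod (a + b))\<^sup>2 \<le> (cmod a + cmod b)\<^sup>2" by (intro power_mono norm_triangle_ineq) auto
      also have "\<dots> \<le> 2 * (cmod a)\<^sup>2 + 2 * (cmod b)\<^sup>2"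
        using sum_squares_bound[of "cmod a" "cmod b"] by (simp add: power2_sum)
      finally show ?thesis .
    qed
    then show "AE t in M. norm ((cmod (f t + g t))\<^sup>2) \<le> norm (2 * (cmod (f t))\<^sup>2 + 2 * (cmod (g t))\<^sup>2)"
      by (intro AE_I2) simp
  qed measurable
qed

lemma sq_integrable_zero: "(\<lambda>t. 0) \<in> sq_integrable M"
  by (simp add: sq_integrable_def)

lemma sq_integrable_sum:
  "(\<And>k::nat. k < m \<Longrightarrow> h k \<in> sq_integrable M) \<Longrightarrow> (\<lambda>t. \<Sum>k<m. c k * h k t) \<in> sq_integrable M"
  by (induction m) (auto simp: sq_integrable_zero intro!: sq_integrable_add sq_integrable_scale)

lemma (in finite_measure) sq_integrable_imp_integrable:
  assumes "f \<in> sq_integrable M" shows "integrable M f"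
  using sq_integrable_mult_cnj[OF assms, of "\<lambda>_. 1"] by (simp add: sq_integrable_def)

lemma ip_combination:
  assumes e: "\<And>k::nat. k < r \<Longrightarrow> e k \<in> sq_integrable M"
    and on: "\<And>k l. k < r \<Longrightarrow> l < r \<Longrightarrow> (\<integral>t. e k t * cnj (e l t) \<partial>M) = (if k = l then 1 else 0)"
    and l: "l < r"
  shows "(\<integral>t. (\<Sum>k<r. d k * e k t) * cnj (e l t) \<partial>M) = d l"
proof -
  have "(\<integral>t. (\<Sum>k<r. d k * e k t) * cnj (e l t) \<partial>M) = (\<integral>t. (\<Sum>k<r. d k * (e k t * cnj (e l t))) \<partial>M)"
    by (simp add: sum_distrib_right mult.assoc)
  also have "\<dots> = (\<Sum>k<r. d k * (\<integral>t. e k t * cnj (e l t) \<partial>M))"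
    using e l by (subst Bochner_Integration.integral_sum) (auto intro!: integrable_mult_right sq_integrable_mult_cnj)
  also have "\<dots> = (\<Sum>k<r. if k = l then d k else 0)" using on l by (intro sum.cong) auto
  also have "\<dots> = d l" using l by (simp add: sum.delta)
  finally show ?thesis .
qed

text \<open>An orthonormal system is wanted because its coefficients are controlled by the
  \<open>L\<^sup>2\<close> norm of the combination. The given functions may be dependent, so the new
  number \<open>r\<close> is existential, and the identities hold only almost everywhere.\<close>

lemma gram_schmidt:
  assumes "\<forall>k<m::nat. h k \<in> sq_integrable M"
  shows "\<exists>(r::nat) e. (\<forall>k<r. e k \<in> sq_integrable M) \<and>
    (\<forall>k<r. \<forall>l<r. (\<integral>t. e k t * cnj (e l t) \<partial>M) = (if k = l then 1 else 0)) \<and>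
    (\<forall>c. \<exists>d. AE t in M. (\<Sum>k<m. c k * h k t) = (\<Sum>k<r. d k * e k t))"
  using assms
proof (induction m)
  case 0
  then show ?case by (intro exI[of _ 0]) simp
next
  case (Suc m)
  have "\<forall>k<m. h k \<in> sq_integrable M" using Suc.prems by simp
  from Suc.IH[OF this] obtain r :: nat and e where
    e1: "\<forall>k<r. e k \<in> sq_integrable M"
    and on1: "\<forall>k<r. \<forall>l<r. (\<integral>t. e k t * cnj (e l t) \<partial>M) = (if k = l then 1 else 0)"
    and sp1: "\<forall>c. \<exists>d. AE t in M. (\<Sum>k<m. c k * h k t) = (\<Sum>k<r. d k * e k t)"
    by (elim exE conjE) (rule that)
  note e = e1[rule_format] and on = on1[rule_format] and sp = sp1[rule_format]
  have hm: "h m \<in> sq_integrable M" using Suc.prems by simp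
  define a where "a k = (\<integral>t. h m t * cnj (e k t) \<partial>M)" for k
  define w where "w t = h m t + (-1) * (\<Sum>k<r. a k * e k t)" for t
  have w: "w \<in> sq_integrable M"
    unfolding w_def by (intro sq_integrable_add sq_integrable_scale sq_integrable_sum hm e)
  have orth: "(\<integral>t. w t * cnj (e l t) \<partial>M) = 0" if l: "l < r" for l
  proof -
    have "(\<integral>t. w t * cnj (e l t) \<partial>M) = (\<integral>t. h m t * cnj (e l t) - (\<Sum>k<r. a k * e k t) * cnj (e l t) \<partial>M)"
      by (intro Bochner_Integration.integral_cong) (auto simp: w_def algebra_simps)
    also have "\<dots> = a l - (\<integral>t. (\<Sum>k<r. a k * e k t) * cnj (e l t) \<partial>M)"
      unfolding a_def by (intro Bochner_Integration.integral_diff sq_integrable_mult_cnj hm e l sq_integrable_sum)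
    also have "\<dots> = 0" using ip_combination[OF e on l, of a] by simp
    finally show ?thesis .
  qed
  define s where "s = (\<integral>t. (cmod (w t))\<^sup>2 \<partial>M)"
  have s0: "s \<ge> 0" by (simp add: s_def)
  have hw: "h m t = w t + (\<Sum>k<r. a k * e k t)" for t by (simp add: w_def)
  show ?case
  proof (cases "s = 0")
    \<comment> \<open>The remainder \<open>w\<close> vanishes almost everywhere: \<open>h m\<close>
      is already a combination of the old system, which is kept.\<close>
    case True
    have w0: "AE t in M. w t = 0"
      using True w unfolding s_def by (subst (asm) integral_nonneg_eq_0_iff_AE) (auto simp: sq_integrable_def)
    have "\<exists>d. AE t in M. (\<Sum>k<Suc m. c k * h k t) = (\<Sum>k<r. d k * e k t)" for c
    proof -
      obtain d where d: "AE t in M. (\<Sum>k<m. c k * h k t) = (\<Sum>k<r. d k * e k t)" using sp by blast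
      from d w0 have "AE t in M. (\<Sum>k<Suc m. c k * h k t) = (\<Sum>k<r. (d k + c m * a k) * e k t)"
        by eventually_elim (simp add: hw distrib_right sum.distrib sum_distrib_left mult.assoc)
      then show ?thesis by (rule exI[where x="\<lambda>k. d k + c m * a k"])
    qed
    with e on show ?thesis by (intro exI[of _ r] exI[of _ e]) auto
  next
    case False
    define u where "u t = (1 / of_real (sqrt s)) * w t" for t
    have u: "u \<in> sq_integrable M" unfolding u_def by (intro sq_integrable_scale w)
    define e' where "e' k = (if k = r then u else e k)" for k
    have sq: "sqrt s > 0" using False s0 by simp
    have uu: "(\<integral>t. u t * cnj (u t) \<partial>M) = 1"
    proof -
      have "(\<integral>t. u t * cnj (u t) \<partial>M) = (\<integral>t. complex_of_real ((1 / s) * (cmod (w t))\<^sup>2) \<partial>M)"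
      proof (intro Bochner_Integration.integral_cong refl)
        fix t
        have "u t * cnj (u t) = complex_of_real ((cmod (u t))\<^sup>2)" using complex_norm_square[of "u t"] by simp
        also have "(cmod (u t))\<^sup>2 = (1 / s) * (cmod (w t))\<^sup>2"
          using s0 by (simp add: u_def norm_mult norm_divide power_mult_distrib power_divide)
        finally show "u t * cnj (u t) = complex_of_real ((1 / s) * (cmod (w t))\<^sup>2)" .
      qed
      also have "\<dots> = complex_of_real ((1 / s) * s)" unfolding s_def by (subst integral_complex_of_real) simp
      finally show ?thesis using False by simp
    qed
    have ue: "(\<integral>t. u t * cnj (e l t) \<partial>M) = 0" if "l < r" for l
      using orth[OF that] by (simp add: u_def mult.assoc)
    have eu: "(\<integral>t. e l t * cnj (u t) \<partial>M) = 0" if "l < r" for l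
    proof -
      have "(\<integral>t. e l t * cnj (u t) \<partial>M) = (\<integral>t. cnj (u t * cnj (e l t)) \<partial>M)"
        by (intro Bochner_Integration.integral_cong refl) (simp add: mult.commute)
      also have "\<dots> = cnj (\<integral>t. u t * cnj (e l t) \<partial>M)" by (rule Bochner_Integration.integral_cnj)
      finally show ?thesis using ue[OF that] by simp
    qed
    have "\<exists>d. AE t in M. (\<Sum>k<Suc m. c k * h k t) = (\<Sum>k<Suc r. d k * e' k t)" for c
    proof -
      obtain d where d: "AE t in M. (\<Sum>k<m. c k * h k t) = (\<Sum>k<r. d k * e k t)" using sp by blast
      define d' where "d' k = (if k = r then c m * of_real (sqrt s) else d k + c m * a k)" for k
      from d have "AE t in M. (\<Sum>k<Suc m. c k * h k t) = (\<Sum>k<Suc r. d' k * e' k t)"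
      proof eventually_elim
        fix t assume t: "(\<Sum>k<m. c k * h k t) = (\<Sum>k<r. d k * e k t)"
        have "(\<Sum>k<r. d' k * e' k t) = (\<Sum>k<r. (d k + c m * a k) * e k t)"
          by (intro sum.cong) (auto simp: d'_def e'_def)
        moreover have "d' r * e' r t = c m * w t" using sq by (simp add: d'_def e'_def u_def)
        ultimately show "(\<Sum>k<Suc m. c k * h k t) = (\<Sum>k<Suc r. d' k * e' k t)"
          using t by (simp add: hw distrib_right distrib_left sum.distrib sum_distrib_left mult.assoc)
      qed
      then show ?thesis by blast
    qed
    moreover have "\<forall>k<Suc r. e' k \<in> sq_integrable M" using e u by (auto simp: e'_def less_Suc_eq)
    moreover have "\<forall>k<Suc r. \<forall>l<Suc r. (\<integral>t. e' k t * cnj (e' l t) \<partial>M) = (if k = l then 1 else 0)"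
      using on uu ue eu by (auto simp: e'_def less_Suc_eq)
    ultimately show ?thesis by blast
  qed
qed

text \<open>The bound depends on \<open>f\<close> only through its \<open>L\<^sup>2\<close> norm,
  which transvections preserve; this gives one constant for all powers. The summand 1 is the squared
  norm of \<open>e l\<close>, from estimating a product by the sum of the squares instead of by
  Cauchy-Schwarz.\<close>

lemma orthonormal_coefficient_bound:
  assumes e: "\<And>k::nat. k < r \<Longrightarrow> e k \<in> sq_integrable M"
    and on: "\<And>k l. k < r \<Longrightarrow> l < r \<Longrightarrow> (\<integral>t. e k t * cnj (e l t) \<partial>M) = (if k = l then 1 else 0)"
    and l: "l < r" and f: "f \<in> sq_integrable M" and eq: "AE t in M. f t = (\<Sum>k<r. d k * e k t)"
  shows "norm (d l) \<le> (\<integral>t. (cmod (f t))\<^sup>2 \<partial>M) + 1"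
proof -
  have [measurable]: "f \<in> borel_measurable M" using f by (simp add: sq_integrable_def)
  have ne: "(\<integral>t. (cmod (e l t))\<^sup>2 \<partial>M) = 1"
  proof -
    have "complex_of_real (\<integral>t. (cmod (e l t))\<^sup>2 \<partial>M) = (\<integral>t. e l t * cnj (e l t) \<partial>M)"
      by (subst integral_complex_of_real[symmetric]) (simp only: complex_norm_square)
    also have "\<dots> = 1" using on[OF l l] by simp
    finally show ?thesis using of_real_eq_1_iff by blast
  qed
  have "d l = (\<integral>t. (\<Sum>k<r. d k * e k t) * cnj (e l t) \<partial>M)" using ip_combination[OF e on l] by simp
  also have "\<dots> = (\<integral>t. f t * cnj (e l t) \<partial>M)"
    using eq borel_measurable_integrable[OF sq_integrable_mult_cnj[OF sq_integrable_sum[of r e M d, OF e] e[OF l]]]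
      borel_measurable_integrable[OF sq_integrable_mult_cnj[OF f e[OF l]]]
    by (intro integral_cong_AE) (auto elim!: AE_mp)
  finally have "norm (d l) \<le> (\<integral>t. norm (f t * cnj (e l t)) \<partial>M)" by simp
  also have "\<dots> \<le> (\<integral>t. (cmod (f t))\<^sup>2 + (cmod (e l t))\<^sup>2 \<partial>M)"
  proof (rule integral_mono)
    show "integrable M (\<lambda>t. norm (f t * cnj (e l t)))" by (intro integrable_norm sq_integrable_mult_cnj f e l)
    show "integrable M (\<lambda>t. (cmod (f t))\<^sup>2 + (cmod (e l t))\<^sup>2)" using f e[OF l] by (auto simp: sq_integrable_def)
    fix t
    show "norm (f t * cnj (e l t)) \<le> (cmod (f t))\<^sup>2 + (cmod (e l t))\<^sup>2"
      using sum_squares_bound[of "cmod (f t)" "cmod (e l t)"] mult_nonneg_nonneg[OF norm_ge_zero[of "f t"] norm_ge_zero[of "e l t"]]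
      unfolding norm_mult complex_mod_cnj by linarith
  qed
  also have "\<dots> = (\<integral>t. (cmod (f t))\<^sup>2 \<partial>M) + 1"
    using f e[OF l] by (subst Bochner_Integration.integral_add) (auto simp: sq_integrable_def ne)
  finally show ?thesis .
qed

section \<open>Perturbing one coordinate\<close>

context haar_power
begin

text \<open>Substituting \<open>t j [^] p \<otimes> t i\<close> for \<open>t i\<close> turns the
  perturbation into the replacement of \<open>t j\<close> by \<open>g p \<otimes> t j\<close> inside
  the power. The functions \<open>f1\<close> so obtained vary with \<open>p\<close>, but they are
  combinations of fixed functions \<open>e k\<close> with coefficients bounded by \<open>C\<close>,
  so finitely many continuity statements control them all.\<close>

lemma perturbation_tendsto_0:
  fixes f :: "(nat \<Rightarrow> 'a) \<Rightarrow> complex" and e :: "nat \<Rightarrow> (nat \<Rightarrow> 'a) \<Rightarrow> complex"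
  assumes ij: "i \<in> I" "j \<in> I" "i \<noteq> j"
    and g: "\<And>p. g p \<in> carrier G" "limitin T g \<one> sequentially"
    and f: "integrable M f" and e: "\<And>k. k < r \<Longrightarrow> integrable M (e k)"
    and rep: "\<And>p::nat. \<exists>c. (\<forall>k<r. norm (c k) \<le> C) \<and> (AE t in M. f (t(i := t j [^] p \<otimes> t i)) = (\<Sum>k<r. c k * e k t))"
  shows "(\<lambda>p. \<integral>t. norm (f (t(i := pert g p (t j) \<otimes> t i)) - f t) \<partial>M) \<longlonglongrightarrow> 0"
proof -
  let ?E = "\<lambda>h p. \<integral>t. norm (h (t(j := g p \<otimes> t j)) - h t) \<partial>M"
  note Wj = measurable_comp[OF ij(2)]
  have bound: "(\<integral>t. norm (f (t(i := pert g p (t j) \<otimes> t i)) - f t) \<partial>M) \<le> ?E f p + C * (\<Sum>k<r. ?E (e k) p)" for p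
  proof -
    define W1 where "W1 t = t j [^] p" for t :: "nat \<Rightarrow> 'a"
    define W2 where "W2 t = (g p \<otimes> t j) [^] p" for t :: "nat \<Rightarrow> 'a"
    define Q where "Q t = pert g p (t j)" for t :: "nat \<Rightarrow> 'a"
    have gm: "(\<lambda>_. g p) \<in> measurable M \<mu>" using g by (simp add: space_haar)
    have W1: "W1 \<in> measurable M \<mu>" unfolding W1_def[abs_def] by (intro measurable_pow Wj)
    have W2: "W2 \<in> measurable M \<mu>" unfolding W2_def[abs_def] by (intro measurable_pow measurable_mult gm Wj)
    have Q: "Q \<in> measurable M \<mu>" unfolding Q_def[abs_def] by (intro measurable_pert g Wj)
    have W1i: "W1 (t(i := x)) = W1 t" and W2i: "W2 (t(i := x)) = W2 t" and Qi: "Q (t(i := x)) = Q t" for t x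
      using ij by (auto simp: W1_def W2_def Q_def)
    define F1 where "F1 t = f (t(i := Q t \<otimes> t i)) - f t" for t
    define f1 where "f1 t = f (t(i := W1 t \<otimes> t i))" for t
    define \<tau> where "\<tau> t = t(j := g p \<otimes> t j)" for t :: "nat \<Rightarrow> 'a"
    \<comment> \<open>Composing \<open>f1\<close> with \<open>\<tau>\<close> also moves the
      coordinate \<open>j\<close> itself, not only the power of it used in coordinate
      \<open>i\<close>; \<open>H\<close> corrects for this.\<close>
    define H where "H t = f t - f (\<tau> t)" for t
    have F1: "integrable M F1" unfolding F1_def[abs_def]
      by (intro Bochner_Integration.integrable_diff f integrable_shift[OF ij(1) Q]) (simp add: Qi)
    have f1: "integrable M f1" unfolding f1_def[abs_def]
      by (intro f integrable_shift[OF ij(1) W1]) (simp add: W1i)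
    have h\<tau>: "integrable M (\<lambda>t. h (\<tau> t))" if "integrable M h" for h :: "_ \<Rightarrow> complex"
      unfolding \<tau>_def by (intro that integrable_shift[OF ij(2) gm]) simp
    have H: "integrable M H" unfolding H_def[abs_def]
      by (rule Bochner_Integration.integrable_diff[OF f h\<tau>[OF f]])
    have d1: "integrable M (\<lambda>t. f1 (\<tau> t) - f1 t)"
      by (rule Bochner_Integration.integrable_diff[OF h\<tau>[OF f1] f1])
    have "(\<integral>t. norm (F1 t) \<partial>M) = (\<integral>t. norm (F1 (t(i := W1 t \<otimes> t i))) \<partial>M)"
      by (rule integral_shift[OF ij(1) W1, symmetric]) (use F1 W1i in auto)
    also have "\<dots> = (\<integral>t. norm (H (t(i := W2 t \<otimes> t i)) + (f1 (\<tau> t) - f1 t)) \<partial>M)"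
    proof (intro Bochner_Integration.integral_cong refl arg_cong[where f=norm])
      fix t assume t: "t \<in> space M"
      have c: "t i \<in> carrier G" "t j \<in> carrier G" "g p \<in> carrier G" using M_component[OF t] ij g by auto
      have e1: "Q t \<otimes> (W1 t \<otimes> t i) = W2 t \<otimes> t i"
        using c pert_pow[of g p "t j"] by (simp add: Q_def W1_def W2_def m_assoc[symmetric] pert_closed)
      have e2: "F1 (t(i := W1 t \<otimes> t i)) = f (t(i := W2 t \<otimes> t i)) - f (t(i := W1 t \<otimes> t i))"
        by (simp add: F1_def Qi e1)
      have "(\<tau> t)(i := W1 (\<tau> t) \<otimes> \<tau> t i) = \<tau> (t(i := W2 t \<otimes> t i))"
        by (rule ext) (use ij in \<open>auto simp: \<tau>_def W1_def W2_def\<close>)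
      then have e3: "f1 (\<tau> t) = f (\<tau> (t(i := W2 t \<otimes> t i)))"
        unfolding f1_def by (rule arg_cong)
      show "F1 (t(i := W1 t \<otimes> t i)) = H (t(i := W2 t \<otimes> t i)) + (f1 (\<tau> t) - f1 t)"
        by (simp only: e2 e3 H_def) (simp add: f1_def)
    qed
    also have "\<dots> \<le> (\<integral>t. norm (H (t(i := W2 t \<otimes> t i))) + norm (f1 (\<tau> t) - f1 t) \<partial>M)"
    proof (rule integral_mono)
      have H2: "integrable M (\<lambda>t. H (t(i := W2 t \<otimes> t i)))"
        by (intro H integrable_shift[OF ij(1) W2]) (simp add: W2i)
      show "integrable M (\<lambda>t. norm (H (t(i := W2 t \<otimes> t i)) + (f1 (\<tau> t) - f1 t)))"
        by (intro integrable_norm Bochner_Integration.integrable_add H2 d1)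
      show "integrable M (\<lambda>t. norm (H (t(i := W2 t \<otimes> t i))) + norm (f1 (\<tau> t) - f1 t))"
        by (intro integrable_norm Bochner_Integration.integrable_add H2 d1)
    qed (rule norm_triangle_ineq)
    also have "\<dots> = (\<integral>t. norm (H (t(i := W2 t \<otimes> t i))) \<partial>M) + (\<integral>t. norm (f1 (\<tau> t) - f1 t) \<partial>M)"
      by (intro Bochner_Integration.integral_add integrable_norm d1 integrable_shift[OF ij(1) W2] H) (simp add: W2i)
    also have "(\<integral>t. norm (H (t(i := W2 t \<otimes> t i))) \<partial>M) = (\<integral>t. norm (H t) \<partial>M)"
      by (rule integral_shift[OF ij(1) W2]) (use H W2i in auto)
    also have "\<dots> = ?E f p" by (simp add: H_def \<tau>_def norm_minus_commute)
    also have "(\<integral>t. norm (f1 (\<tau> t) - f1 t) \<partial>M) \<le> C * (\<Sum>k<r. ?E (e k) p)"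
    proof -
      \<comment> \<open>These coefficients depend on \<open>p\<close>; only the bound
        \<open>C\<close> is uniform.\<close>
      obtain c where c: "\<And>k. k < r \<Longrightarrow> norm (c k) \<le> C" and ae: "AE t in M. f1 t = (\<Sum>k<r. c k * e k t)"
        using rep[of p] unfolding f1_def W1_def by blast
      have ae2: "AE t in M. f1 (\<tau> t) = (\<Sum>k<r. c k * e k (\<tau> t))"
        using AE_shift[OF ij(2) gm _ ae] unfolding \<tau>_def by simp
      have ie: "integrable M (\<lambda>t. norm (e k (\<tau> t) - e k t))" if "k < r" for k
        by (intro integrable_norm Bochner_Integration.integrable_diff h\<tau> e that)
      have "(\<integral>t. norm (f1 (\<tau> t) - f1 t) \<partial>M) \<le> (\<integral>t. C * (\<Sum>k<r. norm (e k (\<tau> t) - e k t)) \<partial>M)"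
      proof (rule integral_mono_AE)
        show "integrable M (\<lambda>t. norm (f1 (\<tau> t) - f1 t))" using d1 by (rule integrable_norm)
        show "integrable M (\<lambda>t. C * (\<Sum>k<r. norm (e k (\<tau> t) - e k t)))"
          by (intro integrable_mult_right Bochner_Integration.integrable_sum ie) auto
        show "AE t in M. norm (f1 (\<tau> t) - f1 t) \<le> C * (\<Sum>k<r. norm (e k (\<tau> t) - e k t))"
          using ae ae2
        proof eventually_elim
          fix t assume a: "f1 t = (\<Sum>k<r. c k * e k t)" "f1 (\<tau> t) = (\<Sum>k<r. c k * e k (\<tau> t))"
          have "f1 (\<tau> t) - f1 t = (\<Sum>k<r. c k * (e k (\<tau> t) - e k t))"
            unfolding a by (simp add: sum_subtractf right_diff_distrib)
          also have "norm \<dots> \<le> (\<Sum>k<r. C * norm (e k (\<tau> t) - e k t))"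
            by (intro sum_norm_le) (auto simp: norm_mult intro!: mult_right_mono c)
          finally show "norm (f1 (\<tau> t) - f1 t) \<le> C * (\<Sum>k<r. norm (e k (\<tau> t) - e k t))"
            by (simp add: sum_distrib_left)
        qed
      qed
      also have "\<dots> = C * (\<Sum>k<r. ?E (e k) p)"
        using ie by (simp add: Bochner_Integration.integral_sum \<tau>_def)
      finally show ?thesis .
    qed
    finally show ?thesis by (simp only: F1_def Q_def)
  qed
  have "(\<lambda>p. ?E f p + C * (\<Sum>k<r. ?E (e k) p)) \<longlonglongrightarrow> 0 + C * (\<Sum>k<r. 0)"
    by (intro tendsto_add tendsto_mult tendsto_const tendsto_sum integral_translation_tendsto_0 ij g f e) auto
  then have lim: "(\<lambda>p. ?E f p + C * (\<Sum>k<r. ?E (e k) p)) \<longlonglongrightarrow> 0" by simp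
  show ?thesis
    by (rule tendsto_sandwich[OF _ _ tendsto_const lim]) (use bound in auto)
qed

end

section \<open>From invariance of slices to constancy\<close>

context haar_power
begin

lemma AE_pair_component:
  assumes jk: "j \<in> I" "k \<in> I" "j \<noteq> k"
    and Bad[measurable]: "Bad \<in> sets (\<mu> \<Otimes>\<^sub>M \<mu>)" and null: "AE a in \<mu>. AE b in \<mu>. (a, b) \<notin> Bad"
  shows "AE t in M. (t j, t k) \<notin> Bad"
proof -
  note [measurable] = measurable_comp[OF jk(1)] measurable_comp[OF jk(2)]
  let ?N = "{t \<in> space M. (t j, t k) \<in> Bad}"
  have [measurable]: "?N \<in> sets M" by measurable
  have N2: "(\<lambda>t. \<integral>\<^sup>+y. indicator ?N (t(k := y)) \<partial>\<mu>) \<in> borel_measurable M"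
    using jk by measurable
  have "emeasure \<mu> (space \<mu>) * (emeasure \<mu> (space \<mu>) * emeasure M ?N)
     = emeasure \<mu> (space \<mu>) * (\<integral>\<^sup>+t. (\<integral>\<^sup>+y. indicator ?N (t(k := y)) \<partial>\<mu>) \<partial>M)"
    by (subst nn_integral_upd[OF jk(2)]) auto
  also have "\<dots> = (\<integral>\<^sup>+t. (\<integral>\<^sup>+x. (\<integral>\<^sup>+y. indicator ?N ((t(j := x))(k := y)) \<partial>\<mu>) \<partial>\<mu>) \<partial>M)"
    by (rule nn_integral_upd[OF jk(1) N2, symmetric])
  also have "\<dots> = (\<integral>\<^sup>+t. 0 \<partial>M)"
  proof (rule nn_integral_cong)
    fix t assume t: "t \<in> space M"
    have "(\<integral>\<^sup>+x. (\<integral>\<^sup>+y. indicator ?N ((t(j := x))(k := y)) \<partial>\<mu>) \<partial>\<mu>) = (\<integral>\<^sup>+x. 0 \<partial>\<mu>)"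
    proof (rule nn_integral_cong_AE, rule AE_mp[OF null], rule AE_I2, rule impI)
      fix x assume x: "AE b in \<mu>. (x, b) \<notin> Bad"
      have "(\<integral>\<^sup>+y. indicator ?N ((t(j := x))(k := y)) \<partial>\<mu>) = (\<integral>\<^sup>+y. 0 \<partial>\<mu>)"
        by (rule nn_integral_cong_AE, rule AE_mp[OF x], rule AE_I2) (use jk in \<open>auto simp: indicator_def\<close>)
      then show "(\<integral>\<^sup>+y. indicator ?N ((t(j := x))(k := y)) \<partial>\<mu>) = 0" by simp
    qed
    then show "(\<integral>\<^sup>+x. (\<integral>\<^sup>+y. indicator ?N ((t(j := x))(k := y)) \<partial>\<mu>) \<partial>\<mu>) = 0" by simp
  qed
  finally have "emeasure M ?N = 0" using emeasure_space_neq_0 by simp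
  then show ?thesis by (intro AE_I[where N="?N"]) auto
qed

text \<open>The constant of a slice is known only to exist. Replacing it by the average of the slice
  gives a measurable function that ignores coordinate \<open>i\<close>, so that
  \<open>AE_upd_iff\<close> can compare it with \<open>f\<close>.\<close>

lemma AE_slice_const_imp_indep:
  assumes i: "i \<in> I" and f: "integrable M (f :: _ \<Rightarrow> complex)"
    and c: "AE t in M. \<exists>c. AE x in \<mu>. f (t(i := x)) = c"
  shows "AE t in M. AE x in \<mu>. f (t(i := x)) = f t"
proof -
  have fm[measurable]: "f \<in> borel_measurable M" using f by auto
  define av where "av t = (\<integral>x. f (t(i := x)) \<partial>\<mu>) / measure \<mu> (space \<mu>)" for t
  have avm[measurable]: "av \<in> borel_measurable M"
    unfolding av_def using slice_lint_measurable[OF i fm] by measurable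
  have avi: "av (t(i := x)) = av t" for t x by (simp add: av_def)
  have m0: "measure \<mu> (space \<mu>) \<noteq> 0" using emeasure_space_neq_0 by (simp add: emeasure_eq_measure)
  have 1: "AE t in M. AE x in \<mu>. f (t(i := x)) = av t"
  proof (rule AE_mp[OF c], rule AE_I2, rule impI)
    fix t assume t: "t \<in> space M" and "\<exists>c. AE x in \<mu>. f (t(i := x)) = c"
    then obtain c where c: "AE x in \<mu>. f (t(i := x)) = c" by blast
    have "(\<integral>x. f (t(i := x)) \<partial>\<mu>) = (\<integral>x. c \<partial>\<mu>)"
      by (rule integral_cong_AE[OF slice_measurable[OF i fm t] _ c]) simp
    then have "av t = c" using m0 by (simp add: av_def scaleR_conv_of_real)
    then show "AE x in \<mu>. f (t(i := x)) = av t" using c by simp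
  qed
  have "AE t in M. f t = av t"
  proof (rule AE_upd_iff[OF i])
    show "AE t in M. AE x in \<mu>. f (t(i := x)) = av (t(i := x))" using 1 by (simp add: avi)
    show "Measurable.pred M (\<lambda>t. f t = av t)"
      unfolding pred_def by (rule measurable_equality_set[OF fm avm])
  qed
  with 1 show ?thesis by eventually_elim simp
qed

text \<open>Coordinates are removed one at a time, replacing \<open>f\<close> by an almost
  everywhere equal function that ignores the coordinates in \<open>J\<close>. The replacements are
  obtained by choice and need not be measurable, which \<open>AE_upd\<close> tolerates.\<close>

lemma AE_indep_imp_const:
  fixes f :: "_ \<Rightarrow> complex"
  assumes ind: "\<And>i. i \<in> I \<Longrightarrow> AE t in M. AE x in \<mu>. f (t(i := x)) = f t"
  shows "\<exists>c. AE t in M. f t = c"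
proof -
  have "\<exists>h. (AE t in M. f t = h t) \<and>
      (\<forall>t\<in>space M. \<forall>t'\<in>space M. (\<forall>i\<in>I - J. t i = t' i) \<longrightarrow> h t = h t')"
    if "finite J" "J \<subseteq> I" for J
    using that
  proof (induction J rule: finite_induct)
    case empty
    have "t = t'" if "t \<in> space M" "t' \<in> space M" "\<forall>i\<in>I - {}. t i = t' i" for t t'
      using that by (intro PiE_ext[of t I "\<lambda>_. carrier G" t']) (auto simp: space_M)
    show ?case
    proof (intro exI[of _ f] conjI ballI impI)
      fix t t' assume "t \<in> space M" "t' \<in> space M" "\<forall>i\<in>I - {}. t i = t' i"
      then have "t = t'" by (rule \<open>\<And>t t'. t \<in> space M \<Longrightarrow> t' \<in> space M \<Longrightarrow> \<forall>i\<in>I - {}. t i = t' i \<Longrightarrow> t = t'\<close>)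
      then show "f t = f t'" by (rule arg_cong)
    qed simp
  next
    case (insert j J)
    have "J \<subseteq> I" using insert.prems by simp
    from insert.IH[OF this] obtain h where h: "AE t in M. f t = h t"
      and dep': "\<forall>t\<in>space M. \<forall>t'\<in>space M. (\<forall>i\<in>I - J. t i = t' i) \<longrightarrow> h t = h t'"
      by (elim exE conjE) (rule that)
    note dep = dep'[rule_format]
    have j: "j \<in> I" using insert.prems by simp
    \<comment> \<open>The choice depends on \<open>t\<close> only through the slice of
      \<open>h\<close>, so \<open>h'\<close> ignores \<open>j\<close> and keeps ignoring the
      coordinates in \<open>J\<close>.\<close>
    define h' where "h' t = (SOME c. AE x in \<mu>. h (t(j := x)) = c)" for t
    have "AE t in M. f t = h' t"
      using ind[OF j] AE_upd[OF j h]
    proof (eventually_elim)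
      fix t assume "AE x in \<mu>. f (t(j := x)) = f t" "AE x in \<mu>. f (t(j := x)) = h (t(j := x))"
      then have ae: "AE x in \<mu>. h (t(j := x)) = f t" by eventually_elim simp
      have "AE x in \<mu>. h (t(j := x)) = h' t" unfolding h'_def by (rule someI[where P="\<lambda>c. AE x in \<mu>. h (t(j := x)) = c", OF ae])
      with ae have "AE x in \<mu>. f t = h' t" by eventually_elim simp
      then show "f t = h' t" using AE_E_witness by blast
    qed
    moreover have "h' t = h' t'" if t: "t \<in> space M" "t' \<in> space M" "\<forall>i\<in>I - insert j J. t i = t' i" for t t'
    proof -
      have "h (t(j := x)) = h (t'(j := x))" if "x \<in> space \<mu>" for x
        using t that j by (intro dep upd_space) (auto simp: space_haar)
      then have "(AE x in \<mu>. h (t(j := x)) = c) = (AE x in \<mu>. h (t'(j := x)) = c)" for c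
        by (intro AE_cong) simp
      then show ?thesis by (simp add: h'_def)
    qed
    ultimately show ?case by blast
  qed
  from this[OF finI subset_refl] obtain h where h: "AE t in M. f t = h t"
    and const': "\<forall>t\<in>space M. \<forall>t'\<in>space M. (\<forall>i\<in>I - I. t i = t' i) \<longrightarrow> h t = h t'"
    by (elim exE conjE) (rule that)
  have const: "h t = h t'" if "t \<in> space M" "t' \<in> space M" for t t'
    using const'[rule_format, OF that] by simp
  obtain t0 where t0: "t0 \<in> space M"
    by (rule that[of "\<lambda>i\<in>I. \<one>"]) (auto simp: space_M)
  have "AE t in M. f t = h t0"
    using h AE_space by eventually_elim (metis const t0)
  then show ?thesis by blast
qed

text \<open>The analytic half of the argument. The group enters only through \<open>gen\<close>:
  outside a null set \<open>Bad\<close> of pairs, a closed subgroup containing the limits of the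
  perturbations in \<open>GG\<close> is everything. Countability of \<open>GG\<close> lets one null
  set serve all its sequences.\<close>

theorem transvection_invariant_const:
  fixes F :: "((nat \<Rightarrow> 'a) \<Rightarrow> complex) set" and h :: "nat \<Rightarrow> (nat \<Rightarrow> 'a) \<Rightarrow> complex"
  assumes F_sq: "\<And>f. f \<in> F \<Longrightarrow> f \<in> sq_integrable M"
    and h: "\<And>k. k < m \<Longrightarrow> h k \<in> sq_integrable M"
    and span: "\<And>f. f \<in> F \<Longrightarrow> \<exists>c. AE t in M. f t = (\<Sum>k<m. c k * h k t)"
    and closed: "\<And>f i j. f \<in> F \<Longrightarrow> i \<in> I \<Longrightarrow> j \<in> I \<Longrightarrow> i \<noteq> j \<Longrightarrow>
      \<exists>f'\<in>F. \<forall>t\<in>space M. f' t = f (t(i := t j \<otimes> t i))"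
    and GG: "countable GG" "\<And>g p. g \<in> GG \<Longrightarrow> g p \<in> carrier G" "\<And>g. g \<in> GG \<Longrightarrow> limitin T g \<one> sequentially"
    and Bad: "Bad \<in> sets (\<mu> \<Otimes>\<^sub>M \<mu>)" "AE a in \<mu>. AE b in \<mu>. (a, b) \<notin> Bad"
    and gen: "\<And>a b S. a \<in> carrier G \<Longrightarrow> b \<in> carrier G \<Longrightarrow> (a, b) \<notin> Bad \<Longrightarrow> seq_closed_subgroup S \<Longrightarrow>
      (\<And>g c w. g \<in> GG \<Longrightarrow> c \<in> {a, b} \<Longrightarrow> limitin T (\<lambda>p. pert g p c) w sequentially \<Longrightarrow> w \<in> S) \<Longrightarrow> S = carrier G"
    and cardI: "card I \<ge> 3" and f: "f \<in> F"
  shows "\<exists>c. AE t in M. f t = c"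
proof -
  have fsq: "f \<in> sq_integrable M" and fi: "integrable M f"
    using F_sq[OF f] M.sq_integrable_imp_integrable by auto
  have "\<forall>k<m. h k \<in> sq_integrable M" using h by simp
  from gram_schmidt[OF this] obtain r :: nat and e where
    e1: "\<forall>k<r. e k \<in> sq_integrable M"
    and on1: "\<forall>k<r. \<forall>l<r. (\<integral>t. e k t * cnj (e l t) \<partial>M) = (if k = l then 1 else 0)"
    and sp1: "\<forall>c. \<exists>d. AE t in M. (\<Sum>k<m. c k * h k t) = (\<Sum>k<r. d k * e k t)"
    by (elim exE conjE) (rule that)
  have ei: "integrable M (e k)" if "k < r" for k using e1 that M.sq_integrable_imp_integrable by blast
  define C where "C = (\<integral>t. (cmod (f t))\<^sup>2 \<partial>M) + 1"
  have rep: "\<exists>c. (\<forall>k<r. norm (c k) \<le> C) \<and> (AE t in M. f (t(i := t j [^] p \<otimes> t i)) = (\<Sum>k<r. c k * e k t))"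
    if ij: "i \<in> I" "j \<in> I" "i \<noteq> j" for i j and p :: nat
  proof -
    \<comment> \<open>Iterating a transvection \<open>p\<close> times stays in \<open>F\<close>,
      hence in the same finite-dimensional span.\<close>
    have "\<exists>f'\<in>F. \<forall>t\<in>space M. f' t = f (t(i := t j [^] p \<otimes> t i))"
    proof (induction p)
      case 0
      have "t(i := \<one> \<otimes> t i) = t" if "t \<in> space M" for t using M_component[OF that ij(1)] by simp
      then show ?case using f by (intro bexI[of _ f]) auto
    next
      case (Suc p)
      from Suc.IH obtain f' where f': "f' \<in> F" "\<forall>t\<in>space M. f' t = f (t(i := t j [^] p \<otimes> t i))" ..
      from closed[OF f'(1) ij] obtain f'' where f'': "f'' \<in> F" "\<forall>t\<in>space M. f'' t = f' (t(i := t j \<otimes> t i))" ..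
      have "f'' t = f (t(i := t j [^] Suc p \<otimes> t i))" if t: "t \<in> space M" for t
      proof -
        note c = M_component[OF t ij(1)] M_component[OF t ij(2)]
        have "f'' t = f ((t(i := t j \<otimes> t i))(i := t j [^] p \<otimes> (t j \<otimes> t i)))"
          using f''(2)[rule_format, OF t] f'(2)[rule_format, OF upd_space[OF t _ ij(1), of "t j \<otimes> t i"]] c ij by simp
        then show ?thesis using c by (simp add: m_assoc)
      qed
      with f''(1) show ?case by blast
    qed
    then obtain f' where f': "f' \<in> F" "\<forall>t\<in>space M. f' t = f (t(i := t j [^] p \<otimes> t i))" ..
    note f'2 = f'(2)[rule_format]
    from span[OF f'(1)] obtain c where c: "AE t in M. f' t = (\<Sum>k<m. c k * h k t)" ..
    from sp1[rule_format, of c] obtain d where "AE t in M. (\<Sum>k<m. c k * h k t) = (\<Sum>k<r. d k * e k t)" ..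
    with c have d: "AE t in M. f' t = (\<Sum>k<r. d k * e k t)" by eventually_elim simp
    have W: "(\<lambda>t. t j [^] p) \<in> measurable M \<mu>" by (intro measurable_pow measurable_comp ij)
    have "(\<integral>t. (cmod (f' t))\<^sup>2 \<partial>M) = (\<integral>t. (cmod (f (t(i := t j [^] p \<otimes> t i))))\<^sup>2 \<partial>M)"
      by (intro Bochner_Integration.integral_cong refl) (simp only: f'2)
    also have "\<dots> = (\<integral>t. (cmod (f t))\<^sup>2 \<partial>M)"
      by (rule integral_shift[OF ij(1) W]) (use ij fsq in \<open>auto simp: sq_integrable_def\<close>)
    finally have "norm (d k) \<le> C" if "k < r" for k
      using orthonormal_coefficient_bound[of r e M k f' d] e1 on1 that F_sq[OF f'(1)] d by (simp add: C_def)
    moreover have "AE t in M. f (t(i := t j [^] p \<otimes> t i)) = (\<Sum>k<r. d k * e k t)"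
      using d AE_space by eventually_elim (simp only: f'2)
    ultimately show ?thesis by blast
  qed
  \<comment> \<open>Mean convergence of the slice integrals gives pointwise convergence only along a
    subsequence. That is enough, because \<open>gen\<close> asks only about limits of the full
    sequence of perturbations, which subsequences inherit.\<close>
  have subseq: "\<exists>s :: nat \<Rightarrow> nat. strict_mono s \<and>
      (AE t in M. (\<lambda>n. \<integral>x. norm (f (t(i := pert g (s n) (t j) \<otimes> x)) - f (t(i := x))) \<partial>\<mu>) \<longlonglongrightarrow> 0)"
    if g: "g \<in> GG" and ij: "i \<in> I" "j \<in> I" "i \<noteq> j" for g i j
  proof -
    define D where "D p t = norm (f (t(i := pert g p (t j) \<otimes> t i)) - f t)" for p t
    have Q: "(\<lambda>t. pert g p (t j)) \<in> measurable M \<mu>" for p by (intro measurable_pert GG(2) g measurable_comp ij)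
    have D: "integrable M (D p)" for p unfolding D_def[abs_def]
      by (intro integrable_norm Bochner_Integration.integrable_diff fi integrable_shift[OF ij(1) Q]) (use ij in simp)
    have lim: "(\<lambda>p. \<integral>t. D p t \<partial>M) \<longlonglongrightarrow> 0"
      unfolding D_def by (rule perturbation_tendsto_0[OF ij GG(2)[OF g] GG(3)[OF g] fi ei rep[OF ij]])
    have slice_eq: "(\<integral>x. D p (t(i := x)) \<partial>\<mu>) = (\<integral>x. norm (f (t(i := pert g p (t j) \<otimes> x)) - f (t(i := x))) \<partial>\<mu>)" for p t
      using ij by (simp add: D_def)
    let ?u = "\<lambda>p t. \<integral>x. D p (t(i := x)) \<partial>\<mu>"
    have ui: "integrable M (?u p)" and ul: "(\<integral>t. ?u p t \<partial>M) \<le> measure \<mu> (space \<mu>) * (\<integral>t. D p t \<partial>M)" for p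
      using slice_integral[OF ij(1) D] by (auto simp: D_def)
    have u0: "0 \<le> ?u p t" for p t by (simp add: D_def)
    have "(\<lambda>p. measure \<mu> (space \<mu>) * (\<integral>t. D p t \<partial>M)) \<longlonglongrightarrow> measure \<mu> (space \<mu>) * 0"
      by (intro tendsto_mult tendsto_const lim)
    then have lim2: "(\<lambda>p. measure \<mu> (space \<mu>) * (\<integral>t. D p t \<partial>M)) \<longlonglongrightarrow> 0" by simp
    have "(\<lambda>p. \<integral>t. norm (?u p t) \<partial>M) \<longlonglongrightarrow> 0"
      by (rule tendsto_sandwich[OF _ _ tendsto_const lim2]) (use ul u0 in \<open>auto simp: abs_of_nonneg\<close>)
    from tendsto_L1_AE_subseq[OF ui this] obtain s :: "nat \<Rightarrow> nat" where
      "strict_mono s" "AE t in M. (\<lambda>n. ?u (s n) t) \<longlonglongrightarrow> 0" by blast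
    then show ?thesis unfolding slice_eq by blast
  qed
  have indep: "AE t in M. AE x in \<mu>. f (t(i := x)) = f t" if i: "i \<in> I" for i
  proof (rule AE_slice_const_imp_indep[OF i fi])
    \<comment> \<open>Two further coordinates besides \<open>i\<close> supply the pair that must
      avoid \<open>Bad\<close>.\<close>
    obtain j k where jk: "j \<in> I" "k \<in> I" "j \<noteq> k" "i \<noteq> j" "i \<noteq> k"
    proof -
      have 2: "card (I - {i}) \<ge> 2" using cardI i finI by simp
      then have "I - {i} \<noteq> {}" by force
      then obtain j where j: "j \<in> I - {i}" by blast
      have "card (I - {i} - {j}) \<ge> 1" using 2 j finI by simp
      then have "I - {i} - {j} \<noteq> {}" by force
      then obtain k where k: "k \<in> I - {i} - {j}" by blast
      show ?thesis by (rule that[of j k]) (use j k in auto)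
    qed
    define Q where "Q g c s \<longleftrightarrow> (AE t in M. (\<lambda>n. \<integral>x. norm (f (t(i := pert g (s n) (t c) \<otimes> x)) - f (t(i := x))) \<partial>\<mu>) \<longlonglongrightarrow> 0)"
      for g c and s :: "nat \<Rightarrow> nat"
    \<comment> \<open>The subsequence must be fixed for each \<open>g\<close> and \<open>c\<close>
      before the countable intersection of full sets is taken.\<close>
    define s where "s g c = (SOME s. strict_mono s \<and> Q g c s)" for g c
    have sQ: "strict_mono (s g c) \<and> Q g c (s g c)" if "g \<in> GG" "c \<in> {j, k}" for g c
    proof -
      have c: "c \<in> I" "i \<noteq> c" using that(2) jk by auto
      have "\<exists>s. strict_mono s \<and> Q g c s" unfolding Q_def by (rule subseq[OF that(1) i c])
      from someI_ex[OF this] show ?thesis unfolding s_def .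
    qed
    have s: "strict_mono (s g c)" if "g \<in> GG" "c \<in> {j, k}" for g c
      using sQ[OF that] ..
    have sl: "AE t in M. (\<lambda>n. \<integral>x. norm (f (t(i := pert g (s g c n) (t c) \<otimes> x)) - f (t(i := x))) \<partial>\<mu>) \<longlonglongrightarrow> 0"
      if "g \<in> GG" "c \<in> {j, k}" for g c
      using sQ[OF that] unfolding Q_def ..
    have "AE t in M. \<forall>g\<in>GG. \<forall>c\<in>{j, k}. (\<lambda>n. \<integral>x. norm (f (t(i := pert g (s g c n) (t c) \<otimes> x)) - f (t(i := x))) \<partial>\<mu>) \<longlonglongrightarrow> 0"
      using GG(1) sl by (subst AE_ball_countable, blast, subst AE_ball_countable) blast+
    with AE_slice_integrable[OF i fi] AE_pair_component[OF jk(1-3) Bad] AE_space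
    show "AE t in M. \<exists>c. AE x in \<mu>. f (t(i := x)) = c"
    proof eventually_elim
      fix t assume int: "integrable \<mu> (\<lambda>x. f (t(i := x)))" and good: "(t j, t k) \<notin> Bad"
        and t: "t \<in> space M"
        and lim: "\<forall>g\<in>GG. \<forall>c\<in>{j, k}. (\<lambda>n. \<integral>x. norm (f (t(i := pert g (s g c n) (t c) \<otimes> x)) - f (t(i := x))) \<partial>\<mu>) \<longlonglongrightarrow> 0"
      show "\<exists>c. AE x in \<mu>. f (t(i := x)) = c"
      proof (rule left_stab_full_imp_const[OF int], rule gen[OF _ _ good seq_closed_left_stab[OF int]])
        show tc: "t j \<in> carrier G" "t k \<in> carrier G" using M_component[OF t] jk by auto
        fix g c w assume g: "g \<in> GG" and c: "c \<in> {t j, t k}" and w: "limitin T (\<lambda>p. pert g p c) w sequentially"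
        from c obtain c' where c': "c' \<in> {j, k}" "c = t c'" by auto
        show "w \<in> left_stab (\<lambda>x. f (t(i := x)))"
        proof (rule left_stab_limit[OF int])
          show "pert g (s g c' n) c \<in> carrier G" for n using c tc GG(2)[OF g] by (auto intro!: pert_closed)
          show "limitin T (\<lambda>n. pert g (s g c' n) c) w sequentially"
            using limitin_subsequence[OF s[OF g c'(1)] w] by (simp add: o_def)
          show "(\<lambda>n. \<integral>x. norm (f (t(i := pert g (s g c' n) c \<otimes> x)) - f (t(i := x))) \<partial>\<mu>) \<longlonglongrightarrow> 0"
            using lim g c' by auto
        qed
      qed
    qed
  qed
  show ?thesis by (rule AE_indep_imp_const[OF indep])
qed

end

section \<open>Quaternions\<close>

text \<open>The pair \<open>(\<alpha>, \<beta>)\<close> stands for the matrix with first column \<open>\<alpha>, \<beta>\<close> and second column \<open>- cnj \<beta>, cnj \<alpha>\<close>.\<close>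

definition qm :: "complex \<times> complex \<Rightarrow> complex \<times> complex \<Rightarrow> complex \<times> complex" where
  "qm p q = (fst p * fst q - cnj (snd p) * snd q, snd p * fst q + cnj (fst p) * snd q)"

definition qc :: "complex \<times> complex \<Rightarrow> complex \<times> complex" where
  "qc p = (cnj (fst p), - snd p)"

definition q1 :: "complex \<times> complex" where "q1 = (1, 0)"

lemma q1_simps [simp]: "fst q1 = 1" "snd q1 = 0" "norm q1 = 1" "q1 \<noteq> 0"
  by (simp_all add: q1_def norm_Pair prod_eq_iff)

text \<open>For a unit quaternion \<open>Q\<close> this is \<open>Q v Q\<^sup>-\<^sup>1\<close>, as
  \<open>qc Q\<close> is then the inverse.\<close>

definition qconj :: "complex \<times> complex \<Rightarrow> complex \<times> complex \<Rightarrow> complex \<times> complex" where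
  "qconj Q v = qm Q (qm v (qc Q))"

lemma qm_assoc: "qm (qm p q) r = qm p (qm q r)"
  by (simp add: qm_def algebra_simps)

lemma qm_1 [simp]: "qm q1 p = p" "qm p q1 = p"
  by (simp_all add: qm_def prod_eq_iff)

lemma qm_distrib: "qm (p + q) r = qm p r + qm q r" "qm p (q + r) = qm p q + qm p r"
  "qm (p - q) r = qm p r - qm q r" "qm p (q - r) = qm p q - qm p r"
  "qm (- p) q = - qm p q" "qm p (- q) = - qm p q"
  "qm (a *\<^sub>R p) q = a *\<^sub>R qm p q" "qm p (a *\<^sub>R q) = a *\<^sub>R qm p q"
  by (simp_all add: qm_def prod_eq_iff algebra_simps scaleR_conv_of_real)

lemma qc_qm: "qc (qm p q) = qm (qc q) (qc p)"
  by (simp add: qm_def qc_def algebra_simps)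

lemma qc_qc [simp]: "qc (qc p) = p" by (simp add: qc_def)

lemma qc_1 [simp]: "qc q1 = q1" by (simp add: qc_def prod_eq_iff)

lemma norm_quat: "norm (p :: complex \<times> complex) ^ 2 = (cmod (fst p))\<^sup>2 + (cmod (snd p))\<^sup>2"
  by (cases p) (simp add: norm_Pair)

lemma qm_qc: "qm p (qc p) = ((norm p)\<^sup>2 :: real) *\<^sub>R q1" "qm (qc p) p = (norm p)\<^sup>2 *\<^sub>R q1"
  unfolding norm_quat
  by (simp_all add: qm_def qc_def prod_eq_iff complex_eq_iff cmod_power2) (simp_all add: power2_eq_square)

lemma norm_qc [simp]: "norm (qc p) = norm p"
  by (cases p) (simp add: qc_def norm_Pair)

lemma norm_qm: "norm (qm p q) = norm p * norm q"
proof -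
  have "(norm (qm p q))\<^sup>2 *\<^sub>R q1 = qm (qm p q) (qc (qm p q))" by (simp add: qm_qc)
  also have "\<dots> = qm p (qm (qm q (qc q)) (qc p))" by (simp add: qc_qm qm_assoc)
  also have "\<dots> = ((norm p * norm q)\<^sup>2) *\<^sub>R q1" by (simp add: qm_qc qm_distrib power_mult_distrib)
  finally have "(norm (qm p q))\<^sup>2 = (norm p * norm q)\<^sup>2" by simp
  then show ?thesis by (simp add: power2_eq_iff_nonneg)
qed

lemma qc_cancel:
  assumes "norm p = 1"
  shows "qm p (qc p) = q1" "qm (qc p) p = q1" "qm p (qm (qc p) r) = r" "qm (qc p) (qm p r) = r"
  using assms by (simp_all add: qm_qc qm_assoc[symmetric])

lemma qconj_props:
  assumes Q: "norm Q = 1"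
  shows qconj_1: "qconj Q q1 = q1" and qconj_mult: "qconj Q (qm p q) = qm (qconj Q p) (qconj Q q)"
    and qconj_inv: "qconj (qc Q) (qconj Q p) = p" "qconj Q (qconj (qc Q) p) = p"
    and norm_qconj: "norm (qconj Q p) = norm p"
    and qconj_qc: "qconj Q (qc p) = qc (qconj Q p)"
    and norm_qconj_1: "norm (qconj Q p - q1) = norm (p - q1)"
proof -
  show 1: "qconj Q q1 = q1" using Q by (simp add: qconj_def qc_cancel)
  show "qconj Q (qm p q) = qm (qconj Q p) (qconj Q q)" using Q by (simp add: qconj_def qm_assoc qc_cancel)
  show "qconj (qc Q) (qconj Q p) = p" "qconj Q (qconj (qc Q) p) = p" using Q by (simp_all add: qconj_def qm_assoc qc_cancel)
  show n: "norm (qconj Q p) = norm p" for p using Q by (simp add: qconj_def norm_qm)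
  show "qconj Q (qc p) = qc (qconj Q p)" by (simp add: qconj_def qc_qm qm_assoc)
  have "qconj Q p - q1 = qconj Q (p - q1)" using 1 by (simp add: qconj_def qm_distrib)
  then show "norm (qconj Q p - q1) = norm (p - q1)" using n by simp
qed

lemma qconj_qm: "qconj (qm P Q) v = qconj P (qconj Q v)"
  by (simp add: qconj_def qc_qm qm_assoc)

lemma norm_qm_1:
  assumes "norm q = 1" shows "norm (qm p q - q1) \<le> norm (p - q1) + norm (q - q1)"
proof -
  have "qm p q - q1 = qm (p - q1) q + (q - q1)" by (simp add: qm_distrib)
  then have "norm (qm p q - q1) \<le> norm (qm (p - q1) q) + norm (q - q1)" by (metis norm_triangle_ineq)
  then show ?thesis using assms by (simp add: norm_qm)
qed

text \<open>For an imaginary unit \<open>Z\<close> this is \<open>exp (h Z)\<close>, by Euler's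
  formula and \<open>Z\<^sup>2 = -1\<close>.\<close>

definition gam :: "complex \<times> complex \<Rightarrow> real \<Rightarrow> complex \<times> complex" where
  "gam Z h = cos h *\<^sub>R q1 + sin h *\<^sub>R Z"

definition imag_unit :: "complex \<times> complex \<Rightarrow> bool" where
  "imag_unit Z \<longleftrightarrow> Re (fst Z) = 0 \<and> norm Z = 1"

text \<open>The three standard imaginary units, a basis of the Lie algebra of \<open>SU(2)\<close>.
  Finitely many directions keep the family of test sequences countable.\<close>

definition axes :: "(complex \<times> complex) set" where
  "axes = {(\<i>, 0), (0, 1), (0, \<i>)}"

lemma imag_unit_axes: "Z \<in> axes \<Longrightarrow> imag_unit Z"
  by (auto simp: axes_def imag_unit_def norm_Pair)

lemma imag_unit_sq: "imag_unit Z \<Longrightarrow> qm Z Z = - q1"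
proof -
  assume Z: "imag_unit Z"
  then have "qc Z = - Z" by (simp add: imag_unit_def qc_def prod_eq_iff complex_eq_iff)
  then have "- qm Z Z = qm Z (qc Z)" by (simp add: qm_distrib)
  then have "- qm Z Z = q1" using Z by (simp add: qm_qc imag_unit_def)
  then show ?thesis by (metis minus_minus)
qed

lemma gam_add: "imag_unit Z \<Longrightarrow> qm (gam Z x) (gam Z y) = gam Z (x + y)"
  by (simp add: gam_def qm_distrib imag_unit_sq cos_add sin_add scaleR_add_left scaleR_diff_left algebra_simps)

lemma gam_0 [simp]: "gam Z 0 = q1" by (simp add: gam_def)

lemma norm_gam: assumes "imag_unit Z" shows "norm (gam Z h) = 1"
proof -
  have "qc Z = - Z" using assms by (simp add: imag_unit_def qc_def prod_eq_iff complex_eq_iff)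
  then have "qc (gam Z h) = gam Z (- h)" by (simp add: gam_def qc_def prod_eq_iff)
  then have "(norm (gam Z h))\<^sup>2 *\<^sub>R q1 = gam Z (h + - h)" using gam_add[OF assms, of h "- h"] qm_qc(1)[of "gam Z h"] by simp
  then have "(norm (gam Z h))\<^sup>2 = 1" by (simp add: prod_eq_iff complex_eq_iff)
  then show ?thesis by (simp add: abs_square_eq_1)
qed

lemma qc_gam: assumes "imag_unit Z" shows "qc (gam Z h) = gam Z (- h)"
proof -
  have "qc Z = - Z" using assms by (simp add: imag_unit_def qc_def prod_eq_iff complex_eq_iff)
  then show ?thesis by (simp add: gam_def qc_def prod_eq_iff)
qed

lemma one_minus_cos_le: "\<bar>1 - cos (h::real)\<bar> \<le> h\<^sup>2 / 2"
proof -
  have "1 - cos h = 2 * (sin (h/2))\<^sup>2" using cos_double_sin[of "h/2"] by simp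
  moreover have "(sin (h/2))\<^sup>2 \<le> (h/2)\<^sup>2" using abs_sin_x_le_abs_x[of "h/2"] unfolding abs_le_square_iff .
  ultimately show ?thesis by (simp add: power_divide)
qed

lemma norm_gam_1: assumes "imag_unit Z" shows "norm (gam Z h - q1) \<le> \<bar>h\<bar>"
proof -
  have fz: "fst Z = \<i> * of_real (Im (fst Z))" using assms by (simp add: imag_unit_def complex_eq_iff)
  have n: "(cmod (fst Z))\<^sup>2 + (cmod (snd Z))\<^sup>2 = 1" using assms norm_quat[of Z] by (simp add: imag_unit_def)
  have c: "(cmod (fst Z))\<^sup>2 = (Im (fst Z))\<^sup>2" using assms by (simp add: imag_unit_def cmod_power2)
  have "(norm (gam Z h - q1))\<^sup>2 = (cos h - 1)\<^sup>2 + (sin h)\<^sup>2 * ((cmod (fst Z))\<^sup>2 + (cmod (snd Z))\<^sup>2)"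
    unfolding norm_quat using assms
    by (simp add: gam_def cmod_power2 imag_unit_def power_mult_distrib algebra_simps)
  also have "\<dots> = 2 * (1 - cos h)" using sin_cos_squared_add[of h] unfolding n by (simp add: power2_eq_square algebra_simps)
  also have "\<dots> \<le> h\<^sup>2" using abs_le_D1[OF one_minus_cos_le[of h]] by simp
  finally show ?thesis by (simp add: abs_le_square_iff[symmetric])
qed

text \<open>The spectral theorem for \<open>SU(2)\<close>. The condition on \<open>d\<^sup>2\<close>
  says that the two eigenvalues \<open>d\<close> and \<open>cnj d\<close> differ.\<close>

lemma diagonalize:
  assumes Q: "norm Q = 1" and nc: "Q \<noteq> q1" "Q \<noteq> - q1"
  shows "\<exists>K d. norm K = 1 \<and> cmod d = 1 \<and> d\<^sup>2 \<noteq> 1 \<and> Q = qconj K (d, 0)"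
proof (cases "snd Q = 0")
  case True
  have "cmod (fst Q) = 1" using Q True norm_quat[of Q] by (simp add: abs_square_eq_1)
  moreover have "(fst Q)\<^sup>2 \<noteq> 1" using nc True by (auto simp: power2_eq_1_iff prod_eq_iff)
  moreover have "Q = qconj q1 (fst Q, 0)" using True by (simp add: qconj_def prod_eq_iff)
  ultimately show ?thesis by (intro exI[of _ q1] exI[of _ "fst Q"]) (auto simp: norm_Pair)
next
  case False
  define a b where "a = Re (fst Q)" and "b = Im (fst Q)"
  have n: "a\<^sup>2 + b\<^sup>2 + (cmod (snd Q))\<^sup>2 = 1" using Q norm_quat[of Q] by (simp add: a_def b_def cmod_power2)
  have s0: "1 - a\<^sup>2 > 0" 
  proof -
    have "(cmod (snd Q))\<^sup>2 > 0" using False by simp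
    then show ?thesis using n zero_le_power2[of b] by linarith
  qed
  \<comment> \<open>Half the trace is \<open>a\<close>, so the eigenvalues are \<open>a\<close> plus
    or minus \<open>\<i> \<sigma>\<close>.\<close>
  define \<sigma> where "\<sigma> = sqrt (1 - a\<^sup>2)"
  have \<sigma>: "\<sigma> > 0" "\<sigma>\<^sup>2 = 1 - a\<^sup>2" using s0 by (auto simp: \<sigma>_def)
  define d where "d = Complex a \<sigma>"
  have d1: "cmod d = 1" using \<sigma> by (simp add: d_def cmod_def)
  have d2: "d\<^sup>2 \<noteq> 1"
  proof
    assume "d\<^sup>2 = 1"
    then have "d = 1 \<or> d = - 1" by (simp add: power2_eq_1_iff)
    then have "Im d = 0" by auto
    then show False using \<sigma> by (simp add: d_def)
  qed
  \<comment> \<open>An eigenvector for \<open>d\<close>, read off from the second row of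
    \<open>Q - d\<close>; as the first column of a quaternion matrix it diagonalises
    \<open>Q\<close>.\<close>
  define k where "k = (\<i> * of_real (b + \<sigma>), snd Q)"
  have fQ: "fst Q = Complex a b" by (simp add: a_def b_def complex_eq_iff)
  have bb: "cnj (snd Q) * snd Q = of_real (\<sigma>\<^sup>2 - b\<^sup>2)"
  proof -
    have "(cmod (snd Q))\<^sup>2 = \<sigma>\<^sup>2 - b\<^sup>2" using n \<sigma> by simp
    moreover have "cnj (snd Q) * snd Q = of_real ((cmod (snd Q))\<^sup>2)"
      by (simp only: complex_norm_square) (simp add: mult.commute)
    ultimately show ?thesis by simp
  qed
  have Qk: "qm Q k = qm k (d, 0)"
    unfolding qm_def k_def fst_conv snd_conv fQ bb
    by (simp add: complex_eq_iff d_def power2_eq_square algebra_simps)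
  have k0: "norm k \<noteq> 0" using False by (simp add: k_def prod_eq_iff)
  define K where "K = (1 / norm k) *\<^sub>R k"
  have K: "norm K = 1" using k0 by (simp add: K_def)
  have "qm Q K = qm K (d, 0)" using Qk by (simp add: K_def qm_distrib)
  then have "Q = qconj K (d, 0)" using K by (metis qconj_def qm_assoc qc_cancel(1) qm_1(2))
  with K d1 d2 show ?thesis by blast
qed

text \<open>The number in question is the component of \<open>Z\<close> along the axis of the torus
  conjugated by \<open>K\<close>. That axis is a unit vector, so it is not orthogonal to all three
  standard axes.\<close>

lemma axis_component:
  assumes K: "norm K = 1"
  shows "\<exists>Z\<in>axes. Im (fst (qconj (qc K) Z)) \<noteq> 0"
proof (rule ccontr)
  assume "\<not> ?thesis"
  then have z: "Im (fst (qconj (qc K) (\<i>, 0))) = 0" "Im (fst (qconj (qc K) (0, 1))) = 0" "Im (fst (qconj (qc K) (0, \<i>))) = 0"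
    by (auto simp: axes_def)
  obtain a b c d where Kd: "K = (Complex a b, Complex c d)" by (metis complex_surj surj_pair)
  have 1: "a\<^sup>2 + b\<^sup>2 + (c\<^sup>2 + d\<^sup>2) = 1" using K norm_quat[of K] by (simp add: Kd cmod_power2)
  have 2: "a\<^sup>2 + b\<^sup>2 = c\<^sup>2 + d\<^sup>2" "a * d = b * c" "a * c + b * d = 0"
    using z by (simp_all add: Kd qconj_def qm_def qc_def power2_eq_square algebra_simps)
  \<comment> \<open>The two-square identity forces one factor to vanish; being equal, both vanish,
    against \<open>norm K = 1\<close>.\<close>
  have "(a\<^sup>2 + b\<^sup>2) * (c\<^sup>2 + d\<^sup>2) = (a * d - b * c)\<^sup>2 + (a * c + b * d)\<^sup>2" by (simp add: power2_eq_square algebra_simps)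
  then have "(a\<^sup>2 + b\<^sup>2) * (c\<^sup>2 + d\<^sup>2) = 0" using 2 by simp
  with 1 2(1) show False by auto
qed

lemma imag_unit_qconj:
  assumes K: "norm K = 1" and Z: "imag_unit Z"
  shows "imag_unit (qconj K Z)"
proof -
  have "qc Z = - Z" using Z by (simp add: imag_unit_def qc_def prod_eq_iff complex_eq_iff)
  then have "qc (qconj K Z) = - qconj K Z" using qconj_qc[OF K, of Z] by (simp add: qconj_def qm_distrib)
  then have "Re (fst (qconj K Z)) = 0" by (simp add: qc_def prod_eq_iff complex_eq_iff)
  then show ?thesis using Z norm_qconj[OF K] by (simp add: imag_unit_def)
qed

lemma qconj_gam:
  assumes K: "norm K = 1" shows "qconj K (gam Z h) = gam (qconj K Z) h"
  using qconj_1[OF K] by (simp add: gam_def qconj_def qm_distrib)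

lemma not_commute_axis:
  assumes Q: "norm Q = 1" and nc: "Q \<noteq> q1" "Q \<noteq> - q1"
  shows "\<exists>Z\<in>axes. qm Q Z \<noteq> qm Z Q"
proof (rule ccontr)
  assume "\<not> ?thesis"
  then have z: "qm Q (\<i>, 0) = qm (\<i>, 0) Q" "qm Q (0, 1) = qm (0, 1) Q"
    by (auto simp: axes_def)
  then have "snd Q = 0" "Im (fst Q) = 0" by (auto simp: qm_def complex_eq_iff)
  moreover from this have "(Re (fst Q))\<^sup>2 = 1" using Q norm_quat[of Q] by (simp add: cmod_power2)
  ultimately show False using nc by (auto simp: power2_eq_1_iff prod_eq_iff complex_eq_iff)
qed

text \<open>This number is half the trace.\<close>

lemma Re_fst_qconj: "norm K = 1 \<Longrightarrow> Re (fst (qconj K v)) = Re (fst v)"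
proof -
  assume K: "norm K = 1"
  have r: "2 * Re (fst v) = Re (fst (v + qc v))" for v by (simp add: qc_def)
  have e: "v + qc v = (2 * Re (fst v)) *\<^sub>R q1" for v by (simp add: qc_def prod_eq_iff complex_eq_iff)
  have "qconj K v + qc (qconj K v) = qconj K (v + qc v)" using qconj_qc[OF K, of v] by (simp add: qconj_def qm_distrib)
  also have "\<dots> = (2 * Re (fst v)) *\<^sub>R q1" unfolding e using qconj_1[OF K] by (simp add: qconj_def qm_distrib)
  finally show ?thesis using e[of "qconj K v"] by (simp add: prod_eq_iff)
qed

lemma gam_not_commute:
  assumes Q: "norm Q = 1" and Z: "qm Q Z \<noteq> qm Z Q" and h: "0 < \<bar>h\<bar>" "\<bar>h\<bar> < 1"
  shows "qm Q (gam Z h) \<noteq> qm (gam Z h) Q"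
proof
  have "sin \<bar>h\<bar> > 0" using h pi_gt3 by (intro sin_gt_zero) auto
  then have s: "sin h \<noteq> 0" by (auto simp: abs_if split: if_splits)
  assume "qm Q (gam Z h) = qm (gam Z h) Q"
  then have "sin h *\<^sub>R qm Q Z = sin h *\<^sub>R qm Z Q" by (simp add: gam_def qm_distrib)
  then show False using s Z by simp
qed

text \<open>Anticommuting would make the rotation conjugate to its negative, but half its trace is
  \<open>cos h\<close>, which is positive for small \<open>h\<close>.\<close>

lemma gam_not_anticommute:
  assumes Q: "norm Q = 1" and Z: "imag_unit Z" and h: "\<bar>h\<bar> < 1"
  shows "qm Q (gam Z h) \<noteq> - qm (gam Z h) Q"
proof
  have c: "cos h > 0" using h pi_gt3 by (intro cos_gt_zero_pi) auto
  have r: "Re (fst (gam Z h)) = cos h" using Z by (simp add: gam_def imag_unit_def)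
  assume "qm Q (gam Z h) = - qm (gam Z h) Q"
  then have "qconj Q (gam Z h) = - gam Z h"
    using Q by (metis qconj_def qm_assoc qc_cancel(1) qm_1(2) qm_distrib(5))
  then have "cos h = - cos h" using Re_fst_qconj[OF Q, of "gam Z h"] r by simp
  with c show False by simp
qed

section \<open>Limits of perturbed powers of unit quaternions\<close>

lemma norm_component_le: "cmod (fst p) \<le> norm p" "cmod (snd p) \<le> norm p"
  by (cases p, simp add: norm_fst_le norm_snd_le)+

lemma norm_le_sum: "norm (p :: complex \<times> complex) \<le> cmod (fst p) + cmod (snd p)"
  by (cases p) (simp add: norm_Pair sqrt_sum_squares_le_sum)

lemma cmod_cos_sin_le_1:
  assumes x: "\<bar>x\<bar> \<le> 1"
  shows "cmod (Complex (cos h) (x * sin h)) \<le> 1"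
proof -
  have "x\<^sup>2 \<le> 1" using x by (simp add: abs_square_le_1)
  then have "x\<^sup>2 * (sin h)\<^sup>2 \<le> 1 * (sin h)\<^sup>2" by (rule mult_right_mono) simp
  then have "(cos h)\<^sup>2 + (x * sin h)\<^sup>2 \<le> 1"
    using sin_cos_squared_add[of h] unfolding power_mult_distrib by linarith
  then show ?thesis by (simp add: cmod_def)
qed

text \<open>The base agrees with \<open>cis (x * h)\<close> up to order \<open>h\<^sup>2\<close>
  where \<open>h = s / p\<close>. Both have modulus at most 1, so \<open>p\<close> factors
  accumulate an error of order \<open>1 / p\<close>.\<close>

lemma cos_add_i_sin_power_tendsto:
  fixes x s :: real
  assumes x: "\<bar>x\<bar> \<le> 1"
  shows "(\<lambda>p. Complex (cos (s / real p)) (x * sin (s / real p)) ^ p) \<longlonglongrightarrow> cis (s * x)"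
proof -
  have sb: "\<bar>sin h - h\<bar> \<le> h\<^sup>2 / 2" for h :: real
    using Maclaurin_sin_bound[of h 2] by (simp add: numeral_2_eq_2 sin_coeff_def)
  have bound: "cmod (Complex (cos h) (x * sin h) - cis (x * h)) \<le> 3 * h\<^sup>2" for h
  proof -
    have x2: "x\<^sup>2 \<le> 1" using x by (simp add: abs_square_le_1)
    have xh: "(x * h)\<^sup>2 \<le> h\<^sup>2" using mult_right_mono[OF x2, of "h\<^sup>2"] by (simp add: power_mult_distrib)
    have "\<bar>cos h - cos (x * h)\<bar> \<le> h\<^sup>2 / 2 + (x * h)\<^sup>2 / 2"
      using one_minus_cos_le[of h] one_minus_cos_le[of "x * h"] by linarith
    moreover have "\<bar>x * sin h - sin (x * h)\<bar> \<le> h\<^sup>2 / 2 + (x * h)\<^sup>2 / 2"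
    proof -
      have "\<bar>x * (sin h - h)\<bar> \<le> 1 * (h\<^sup>2 / 2)" unfolding abs_mult using x sb by (intro mult_mono) auto
      moreover have "x * sin h - sin (x * h) = x * (sin h - h) - (sin (x * h) - x * h)" by (simp add: algebra_simps)
      ultimately show ?thesis using sb[of "x * h"] by linarith
    qed
    moreover have "cmod (Complex (cos h) (x * sin h) - cis (x * h)) \<le> \<bar>cos h - cos (x * h)\<bar> + \<bar>x * sin h - sin (x * h)\<bar>"
      using cmod_le[of "Complex (cos h) (x * sin h) - cis (x * h)"] by simp
    ultimately show ?thesis using xh zero_le_power2[of h] by linarith
  qed
  have n1: "cmod (Complex (cos h) (x * sin h)) \<le> 1" for h
    by (rule cmod_cos_sin_le_1[OF x])
  have le: "cmod (Complex (cos (s / real p)) (x * sin (s / real p)) ^ p - cis (s * x)) \<le> 3 * s\<^sup>2 * inverse (real p)" if p: "p > 0" for p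
  proof -
    have e: "cis (s * x) = cis (x * (s / real p)) ^ p" using p by (simp add: Complex.DeMoivre mult.commute)
    have "cmod (Complex (cos (s / real p)) (x * sin (s / real p)) ^ p - cis (x * (s / real p)) ^ p)
        \<le> real p * cmod (Complex (cos (s / real p)) (x * sin (s / real p)) - cis (x * (s / real p)))"
      by (rule norm_power_diff) (use n1 in auto)
    also have "\<dots> \<le> real p * (3 * (s / real p)\<^sup>2)" by (intro mult_left_mono bound) auto
    also have "\<dots> = 3 * s\<^sup>2 * inverse (real p)" using p by (simp add: power2_eq_square field_simps)
    finally show ?thesis by (simp add: e)
  qed
  have "(\<lambda>p. 3 * s\<^sup>2 * inverse (real p)) \<longlonglongrightarrow> 3 * s\<^sup>2 * 0"
    by (intro tendsto_intros LIMSEQ_inverse_real_of_nat[THEN LIMSEQ_imp_Suc])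
  then have lim: "(\<lambda>p. 3 * s\<^sup>2 * inverse (real p)) \<longlonglongrightarrow> 0" by simp
  show ?thesis
    by (rule LIM_zero_cancel, rule tendsto_norm_zero_cancel, rule tendsto_sandwich[OF _ _ tendsto_const lim])
      (auto intro!: eventually_sequentiallyI[of 1] le)
qed

text \<open>
  With \<open>h = s / p\<close>, the vector \<open>(1, c sin h)\<close>, \<open>c = w / (1 - \<delta>)\<close>, is up to \<open>O(h\<^sup>2)\<close> an eigenvector of
  the isometry \<open>N\<close> with eigenvalue \<open>cos h + \<i> x sin h\<close>, so \<open>N\<^sup>p\<close> moves \<open>(1, 0)\<close> close to \<open>(e\<^sup>i\<^sup>s\<^sup>x, 0)\<close>.
\<close>

lemma twisted_power_tendsto:
  fixes x s :: real and w \<delta> :: complex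
  assumes n: "x\<^sup>2 + (cmod w)\<^sup>2 = 1" and \<delta>: "cmod \<delta> = 1" "\<delta> \<noteq> 1"
  defines "N \<equiv> \<lambda>h y. qm (gam (\<i> * of_real x, w) h) (fst y, \<delta> * snd y)"
  shows "(\<lambda>p. (N (s / real p) ^^ p) q1) \<longlonglongrightarrow> (cis (s * x), 0)"
proof -
  have iu: "imag_unit (\<i> * of_real x, w)"
    using n by (simp add: imag_unit_def norm_Pair norm_mult)
  have x1: "\<bar>x\<bar> \<le> 1"
  proof -
    have "x\<^sup>2 \<le> 1" using n zero_le_power2[of "cmod w"] by linarith
    then show ?thesis by (simp add: abs_square_le_1)
  qed
  have w1: "cmod w \<le> 1"
  proof -
    have "(cmod w)\<^sup>2 \<le> 1" using n zero_le_power2[of x] by linarith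
    then show ?thesis by (simp add: abs_square_le_1)
  qed
  \<comment> \<open>Chosen to cancel the first-order term in the second component of the eigenvector
    equation; this is where \<open>\<delta> \<noteq> 1\<close> is used.\<close>
  define c where "c = w / (1 - \<delta>)"
  have c: "w + \<delta> * c - c = 0" using \<delta> by (simp add: c_def field_simps)
  define A where "A h = Complex (cos h) (x * sin h)" for h
  define z where "z h = (1 :: complex, c * of_real (sin h))" for h
  \<comment> \<open>Complex scalar multiplication of a column. \<open>N h\<close> commutes with it,
    because \<open>qm\<close> applies the matrix of its first argument to its second argument as a
    column.\<close>
  define sm where "sm y a = (fst y * a, snd y * a)" for y :: "complex \<times> complex" and a :: complex
  \<comment> \<open>In the error of the eigenvector equation the first component contributes
    \<open>cmod c * h\<^sup>2\<close> and the second \<open>4 * cmod c * h\<^sup>2\<close>.\<close>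
  define C where "C = 5 * cmod c"
  have normN: "norm (N h y) = norm y" for h y
    using norm_gam[OF iu, of h] \<delta>(1) by (cases y) (simp add: N_def norm_qm norm_Pair norm_mult)
  have diffN: "N h (y - y') = N h y - N h y'" for h y y'
  proof -
    have "(fst (y - y'), \<delta> * snd (y - y')) = (fst y, \<delta> * snd y) - (fst y', \<delta> * snd y')" by (simp add: algebra_simps)
    then show ?thesis by (simp only: N_def qm_distrib)
  qed
  have smN: "N h (sm y a) = sm (N h y) a" for h y a
    by (simp add: N_def qm_def sm_def algebra_simps)
  have norm_sm: "norm (sm y a) = norm y * cmod a" for y a
    by (cases y) (simp add: sm_def norm_Pair norm_mult power_mult_distrib real_sqrt_mult flip: distrib_right)
  have A1: "cmod (A h) \<le> 1" for h
    unfolding A_def by (rule cmod_cos_sin_le_1[OF x1])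
  have AA: "cmod (A h - 1) \<le> 2 * \<bar>h\<bar>" for h
  proof -
    have 1: "cmod (A h - 1) \<le> \<bar>cos h - 1\<bar> + \<bar>x * sin h\<bar>" using cmod_le[of "A h - 1"] by (simp add: A_def)
    have 2: "\<bar>x * sin h\<bar> \<le> 1 * \<bar>h\<bar>" unfolding abs_mult using x1 abs_sin_x_le_abs_x by (intro mult_mono) auto
    have "norm (gam (\<i>, 0) h - q1) \<le> \<bar>h\<bar>" by (rule norm_gam_1) (simp add: imag_unit_def norm_Pair)
    moreover have "\<bar>cos h - 1\<bar> \<le> cmod (fst (gam (\<i>, 0) h - q1))"
      using abs_Re_le_cmod[of "fst (gam (\<i>, 0) h - q1)"] by (simp add: gam_def)
    moreover have "cmod (fst (gam (\<i>, 0) h - q1)) \<le> norm (gam (\<i>, 0) h - q1)" by (rule norm_component_le)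
    ultimately show ?thesis using 1 2 by linarith
  qed
  have eig: "norm (N h (z h) - sm (z h) (A h)) \<le> C * h\<^sup>2" for h
  proof -
    let ?s = "complex_of_real (sin h)"
    have g: "gam (\<i> * of_real x, w) h = (A h, ?s * w)"
      by (simp add: gam_def A_def prod_eq_iff complex_eq_iff)
    have 1: "fst (N h (z h) - sm (z h) (A h)) = - (cnj w * \<delta> * c * ?s * ?s)"
      by (simp add: N_def g qm_def z_def sm_def algebra_simps)
    have "snd (N h (z h) - sm (z h) (A h)) = ?s * ((cnj (A h) - 1) * (\<delta> * c) - (A h - 1) * c + (w + \<delta> * c - c))"
      by (simp add: N_def g qm_def z_def sm_def algebra_simps)
    then have 2: "snd (N h (z h) - sm (z h) (A h)) = ?s * ((cnj (A h) - 1) * (\<delta> * c) - (A h - 1) * c)"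
      by (simp add: c)
    have sh: "\<bar>sin h\<bar> \<le> \<bar>h\<bar>" by (rule abs_sin_x_le_abs_x)
    have "cmod (fst (N h (z h) - sm (z h) (A h))) = cmod w * cmod c * (\<bar>sin h\<bar> * \<bar>sin h\<bar>)"
      unfolding 1 using \<delta> by (simp add: norm_mult)
    also have "\<dots> \<le> 1 * cmod c * (\<bar>h\<bar> * \<bar>h\<bar>)" using w1 sh by (intro mult_mono) auto
    finally have f: "cmod (fst (N h (z h) - sm (z h) (A h))) \<le> cmod c * h\<^sup>2" by (simp add: power2_eq_square)
    have cA: "cmod (cnj (A h) - 1) = cmod (A h - 1)" by (metis complex_cnj_diff complex_cnj_one complex_mod_cnj)
    have "cmod ((cnj (A h) - 1) * (\<delta> * c) - (A h - 1) * c) \<le> cmod ((cnj (A h) - 1) * (\<delta> * c)) + cmod ((A h - 1) * c)"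
      by (rule norm_triangle_ineq4)
    also have "\<dots> = 2 * (cmod (A h - 1) * cmod c)" using \<delta> by (simp add: norm_mult cA)
    also have "\<dots> \<le> 2 * (2 * \<bar>h\<bar> * cmod c)" by (intro mult_left_mono mult_right_mono AA) auto
    finally have "cmod (snd (N h (z h) - sm (z h) (A h))) \<le> \<bar>h\<bar> * (2 * (2 * \<bar>h\<bar> * cmod c))"
      unfolding 2 norm_mult using sh by (intro mult_mono) auto
    also have "\<dots> = 4 * cmod c * h\<^sup>2" by (simp add: power2_eq_square)
    finally show ?thesis using norm_le_sum[of "N h (z h) - sm (z h) (A h)"] f by (simp add: C_def)
  qed
  have normNp: "norm ((N h ^^ m) y - (N h ^^ m) y') = norm (y - y')" for h m y y'
    by (induction m) (auto simp: normN simp flip: diffN)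
  \<comment> \<open>Errors only add up, since \<open>N h\<close> is an isometry and the eigenvalue
    \<open>A h\<close> has modulus at most 1.\<close>
  have approx: "norm ((N h ^^ m) (z h) - sm (z h) (A h ^ m)) \<le> real m * (C * h\<^sup>2)" for h m
  proof (induction m)
    case 0 then show ?case by (simp add: sm_def)
  next
    case (Suc m)
    have "(N h ^^ Suc m) (z h) - sm (z h) (A h ^ Suc m)
        = N h ((N h ^^ m) (z h) - sm (z h) (A h ^ m)) + sm (N h (z h) - sm (z h) (A h)) (A h ^ m)"
      by (simp add: diffN smN) (simp add: sm_def prod_eq_iff algebra_simps)
    then have "norm ((N h ^^ Suc m) (z h) - sm (z h) (A h ^ Suc m)) \<le>
        norm ((N h ^^ m) (z h) - sm (z h) (A h ^ m)) + norm (N h (z h) - sm (z h) (A h)) * cmod (A h ^ m)"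
      using norm_triangle_ineq[of "N h ((N h ^^ m) (z h) - sm (z h) (A h ^ m))" "sm (N h (z h) - sm (z h) (A h)) (A h ^ m)"]
      by (simp add: normN norm_sm)
    also have "\<dots> \<le> real m * (C * h\<^sup>2) + (C * h\<^sup>2) * 1"
    proof (intro add_mono Suc.IH mult_mono eig)
      show "cmod (A h ^ m) \<le> 1" using A1[of h] by (simp add: norm_power power_le_one)
    qed (auto simp: C_def)
    finally show ?case by (simp add: algebra_simps)
  qed
  have zq: "norm (z h - q1) \<le> cmod c * \<bar>h\<bar>" for h
  proof -
    have "norm (z h - q1) = cmod c * \<bar>sin h\<bar>" by (simp add: z_def norm_Pair q1_def norm_mult)
    also have "\<dots> \<le> cmod c * \<bar>h\<bar>" by (intro mult_left_mono abs_sin_x_le_abs_x) auto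
    finally show ?thesis .
  qed
  have zA: "norm (sm (z h) (A h ^ m) - (A h ^ m, 0)) \<le> cmod c * \<bar>h\<bar>" for h m
  proof -
    have "sm (z h) (A h ^ m) - (A h ^ m, 0) = sm (z h - q1) (A h ^ m)" by (simp add: sm_def z_def prod_eq_iff)
    then have "norm (sm (z h) (A h ^ m) - (A h ^ m, 0)) \<le> norm (z h - q1) * 1"
      using A1[of h] by (simp only: norm_sm) (intro mult_left_mono, auto simp: norm_power power_le_one)
    then show ?thesis using zq[of h] by simp
  qed
  have total: "norm ((N h ^^ m) q1 - (A h ^ m, 0)) \<le> 2 * (cmod c * \<bar>h\<bar>) + real m * (C * h\<^sup>2)" for h m
  proof -
    have "(N h ^^ m) q1 - (A h ^ m, 0) = ((N h ^^ m) q1 - (N h ^^ m) (z h)) +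
       (((N h ^^ m) (z h) - sm (z h) (A h ^ m)) + (sm (z h) (A h ^ m) - (A h ^ m, 0)))" by simp
    then have "norm ((N h ^^ m) q1 - (A h ^ m, 0)) \<le> norm ((N h ^^ m) q1 - (N h ^^ m) (z h)) +
       (norm ((N h ^^ m) (z h) - sm (z h) (A h ^ m)) + norm (sm (z h) (A h ^ m) - (A h ^ m, 0)))"
      by (metis (no_types) norm_triangle_le add_left_mono norm_triangle_ineq)
    then show ?thesis using zq[of h] approx[of m h] zA[of h m] normNp[of m h q1 "z h"]
      by (simp add: norm_minus_commute)
  qed
  have inv0: "(\<lambda>p. inverse (real p)) \<longlonglongrightarrow> 0"
    by (intro LIMSEQ_inverse_real_of_nat[THEN LIMSEQ_imp_Suc])
  have "(\<lambda>p. 2 * (cmod c * \<bar>s\<bar>) * inverse (real p) + C * s\<^sup>2 * inverse (real p)) \<longlonglongrightarrow> 2 * (cmod c * \<bar>s\<bar>) * 0 + C * s\<^sup>2 * 0"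
    by (intro tendsto_intros inv0)
  then have lim: "(\<lambda>p. 2 * (cmod c * \<bar>s\<bar>) * inverse (real p) + C * s\<^sup>2 * inverse (real p)) \<longlonglongrightarrow> 0" by simp
  have d0: "(\<lambda>p. (N (s / real p) ^^ p) q1 - (A (s / real p) ^ p, 0)) \<longlonglongrightarrow> 0"
  proof (rule tendsto_norm_zero_cancel, rule tendsto_sandwich[OF _ _ tendsto_const lim])
    show "\<forall>\<^sub>F p in sequentially. norm ((N (s / real p) ^^ p) q1 - (A (s / real p) ^ p, 0)) \<le>
        2 * (cmod c * \<bar>s\<bar>) * inverse (real p) + C * s\<^sup>2 * inverse (real p)"
    proof (rule eventually_sequentiallyI[of 1])
      fix p :: nat assume p: "1 \<le> p"
      have "2 * (cmod c * \<bar>s / real p\<bar>) + real p * (C * (s / real p)\<^sup>2) = 2 * (cmod c * \<bar>s\<bar>) * inverse (real p) + C * s\<^sup>2 * inverse (real p)"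
        using p by (simp add: power2_eq_square field_simps)
      then show "norm ((N (s / real p) ^^ p) q1 - (A (s / real p) ^ p, 0)) \<le>
        2 * (cmod c * \<bar>s\<bar>) * inverse (real p) + C * s\<^sup>2 * inverse (real p)"
        using total[of p "s / real p"] by simp
    qed
  qed simp
  have "(\<lambda>p. (A (s / real p) ^ p, 0)) \<longlonglongrightarrow> (cis (s * x), 0 :: complex)"
    unfolding A_def by (intro tendsto_intros cos_add_i_sin_power_tendsto x1)
  from tendsto_add[OF d0 this] show ?thesis by simp
qed

section \<open>Two different tori generate a neighbourhood of the identity\<close>

abbreviation eT :: "real \<Rightarrow> complex \<times> complex" where "eT s \<equiv> gam (\<i>, 0) s"

lemma eT_props: "eT s = (cis s, 0)" "imag_unit (\<i>, 0)"
  by (auto simp: gam_def imag_unit_def norm_Pair prod_eq_iff complex_eq_iff)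

lemma small_angle:
  assumes "\<sigma> > 0"
  shows "\<exists>\<epsilon>>0. \<forall>u. cmod u = 1 \<longrightarrow> cmod (u - 1) < \<epsilon> \<longrightarrow> (\<exists>\<theta>. \<bar>\<theta>\<bar> \<le> \<sigma> \<and> u = cis \<theta>)"
proof -
  have "isCont Ln 1" by (intro continuous_at_Ln) (simp add: complex_nonpos_Reals_iff)
  then have "\<exists>\<epsilon>>0. \<forall>u. dist u 1 < \<epsilon> \<longrightarrow> dist (Ln u) (Ln 1) < \<sigma>"
    using assms unfolding continuous_at_eps_delta by blast
  then obtain \<epsilon> where e: "\<epsilon> > 0" "\<And>u. dist u 1 < \<epsilon> \<Longrightarrow> dist (Ln u) (Ln 1) < \<sigma>" by blast
  have "\<exists>\<theta>. \<bar>\<theta>\<bar> \<le> \<sigma> \<and> u = cis \<theta>" if u: "cmod u = 1" "cmod (u - 1) < \<epsilon>" for u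
  proof (intro exI conjI)
    have u0: "u \<noteq> 0" using u by auto
    have "cmod (Ln u) < \<sigma>" using e(2)[of u] u by (simp add: dist_norm)
    then show "\<bar>Im (Ln u)\<bar> \<le> \<sigma>" using abs_Im_le_cmod[of "Ln u"] by linarith
    have "Re (Ln u) = 0" using u u0 by simp
    then have "Ln u = \<i> * of_real (Im (Ln u))" by (simp add: complex_eq_iff)
    then show "u = cis (Im (Ln u))" using exp_Ln[OF u0] by (metis cis_conv_exp)
  qed
  with e(1) show ?thesis by blast
qed

text \<open>
  Conjugating one torus into diagonal form, elements with the same \<open>\<bar>\<beta>\<bar>\<close> lie in the same double coset of it;
  the other torus contains elements of every small \<open>\<bar>\<beta>\<bar>\<close>.
\<close>

lemma two_tori_generate:
  assumes \<rho>: "\<rho> > 0" and \<sigma>: "\<sigma> > 0"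
    and mult: "\<And>p q. p \<in> \<Sigma> \<Longrightarrow> q \<in> \<Sigma> \<Longrightarrow> norm p = 1 \<Longrightarrow> norm q = 1 \<Longrightarrow> norm (p - q1) < \<rho> \<Longrightarrow> norm (q - q1) < \<rho> \<Longrightarrow>
      norm (qm p q - q1) < \<rho> \<Longrightarrow> qm p q \<in> \<Sigma>"
    and K: "norm K = 1" and L: "norm L = 1"
    and t1: "\<And>s. \<bar>s\<bar> \<le> \<sigma> \<Longrightarrow> qconj K (eT s) \<in> \<Sigma>"
    and t2: "\<And>s. \<bar>s\<bar> \<le> \<sigma> \<Longrightarrow> qconj L (eT s) \<in> \<Sigma>"
    and R: "fst (qm (qc K) L) \<noteq> 0" "snd (qm (qc K) L) \<noteq> 0"
  shows "\<exists>\<eta>>0. \<forall>q. norm q = 1 \<longrightarrow> norm (q - q1) < \<eta> \<longrightarrow> q \<in> \<Sigma>"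
proof -
  define \<tau> where "\<tau> s = qconj K (eT s)" for s
  have iu: "imag_unit (\<i>, 0)" by (rule eT_props)
  have \<tau>1: "norm (\<tau> s) = 1" for s using norm_gam[OF iu] by (simp add: \<tau>_def norm_qconj[OF K])
  have \<tau>s: "norm (\<tau> s - q1) = norm (eT s - q1)" for s by (simp add: \<tau>_def norm_qconj_1[OF K])
  have \<tau>le: "norm (\<tau> s - q1) \<le> \<bar>s\<bar>" for s using norm_gam_1[OF iu, of s] by (simp add: \<tau>s)
  have \<tau>add: "qm (\<tau> x) (\<tau> y) = \<tau> (x + y)" for x y
    using gam_add[OF iu, of x y] by (simp add: \<tau>_def flip: qconj_mult[OF K])
  have \<tau>c: "qc (\<tau> s) = \<tau> (- s)" for s using qc_gam[OF iu] qconj_qc[OF K, of "eT s"] by (simp add: \<tau>_def)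
  \<comment> \<open>\<open>\<Sigma>\<close> is closed under products only inside the ball of radius
    \<open>\<rho>\<close>, so conjugation must be checked factor by factor.\<close>
  have conj1: "qconj (\<tau> s) w \<in> \<Sigma>" if w: "w \<in> \<Sigma>" "norm w = 1" "norm (w - q1) < \<rho> / 3" and s: "\<bar>s\<bar> \<le> \<sigma>" "\<bar>s\<bar> < \<rho> / 3" for s w
  proof -
    have ts: "\<tau> s \<in> \<Sigma>" "\<tau> (- s) \<in> \<Sigma>" using t1 s by (auto simp: \<tau>_def)
    have n: "norm (\<tau> s - q1) < \<rho> / 3" "norm (\<tau> (- s) - q1) < \<rho> / 3" using \<tau>le[of s] \<tau>le[of "- s"] s by auto
    have m1: "norm (qm w (\<tau> (- s)) - q1) < 2 * \<rho> / 3" using norm_qm_1[OF \<tau>1, of w "- s"] n w by linarith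
    have "qm w (\<tau> (- s)) \<in> \<Sigma>" by (rule mult) (use w ts n m1 \<tau>1 \<rho> in auto)
    moreover have "norm (qm (\<tau> s) (qm w (\<tau> (- s))) - q1) = norm (w - q1)"
      using norm_qconj_1[OF \<tau>1[of s], of w] by (simp add: qconj_def \<tau>c)
    ultimately have "qm (\<tau> s) (qm w (\<tau> (- s))) \<in> \<Sigma>"
      by (intro mult) (use w ts n m1 \<tau>1 \<rho> in \<open>auto simp: norm_qm\<close>)
    then show ?thesis by (simp add: qconj_def \<tau>c)
  qed
  \<comment> \<open>A large angle is split into small ones. Each conjugation preserves the distance
    to \<open>q1\<close>, so the intermediate elements stay in the ball.\<close>
  have conj: "qconj (\<tau> s) w \<in> \<Sigma>" if w: "w \<in> \<Sigma>" "norm w = 1" "norm (w - q1) < \<rho> / 3" for s w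
  proof -
    have "\<exists>N::nat. \<bar>s\<bar> / min \<sigma> (\<rho> / 4) < real N" by (rule reals_Archimedean2)
    then obtain N :: nat where N: "\<bar>s\<bar> / min \<sigma> (\<rho> / 4) < real N" by blast
    have mp: "min \<sigma> (\<rho> / 4) > 0" using \<sigma> \<rho> by simp
    have N0: "real N > 0" using N divide_nonneg_pos[OF abs_ge_zero[of s] mp] by linarith
    define s0 where "s0 = s / real N"
    have "\<bar>s\<bar> < real N * min \<sigma> (\<rho> / 4)" using N mp by (simp add: pos_divide_less_eq)
    then have "\<bar>s0\<bar> < min \<sigma> (\<rho> / 4)" unfolding s0_def abs_divide abs_of_pos[OF N0]
      by (subst pos_divide_less_eq[OF N0]) (simp only: mult.commute)
    then have s0: "\<bar>s0\<bar> \<le> \<sigma>" "\<bar>s0\<bar> < \<rho> / 3" using \<rho> by auto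
    have "qconj (\<tau> (real m * s0)) w \<in> \<Sigma>" for m
    proof (induction m)
      case 0 then show ?case using w by (simp add: \<tau>_def qconj_1[OF K]) (simp add: qconj_def)
    next
      case (Suc m)
      have "qconj (\<tau> s0) (qconj (\<tau> (real m * s0)) w) \<in> \<Sigma>"
        by (rule conj1[OF Suc.IH _ _ s0]) (use w norm_qconj_1[OF \<tau>1] norm_qconj[OF \<tau>1] in auto)
      then show ?case by (simp add: \<tau>add algebra_simps flip: qconj_qm)
    qed
    from this[of N] show ?thesis using N0 by (simp add: s0_def)
  qed
  \<comment> \<open>The relative position of the tori. Both of its components are nonzero, so
    conjugation by \<open>r\<close> produces nonzero off-diagonal entries.\<close>
  define r where "r = qm (qc K) L"
  have r1: "norm r = 1" using K L by (simp add: r_def norm_qm)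
  define ab where "ab = cmod (fst r) * cmod (snd r)"
  have ab: "ab > 0" using R by (simp add: ab_def r_def)
  obtain \<epsilon> where \<epsilon>: "\<epsilon> > 0" "\<And>u. cmod u = 1 \<Longrightarrow> cmod (u - 1) < \<epsilon> \<Longrightarrow> \<exists>\<theta>. \<bar>\<theta>\<bar> \<le> \<sigma> \<and> u = cis \<theta>"
    using small_angle[OF \<sigma>] by blast
  define \<epsilon>' where "\<epsilon>' = min \<epsilon> \<rho>"
  have \<epsilon>': "\<epsilon>' > 0" "\<epsilon>' \<le> \<epsilon>" "\<epsilon>' \<le> \<rho>" using \<epsilon> \<rho> by (auto simp: \<epsilon>'_def)
  define s1 where "s1 = min (min \<sigma> (\<rho> / 4)) (min 1 (\<epsilon>' / 4))"
  have s1: "s1 > 0" "s1 \<le> \<sigma>" "s1 \<le> \<rho> / 4" "s1 \<le> 1" "s1 \<le> \<epsilon>' / 4" using \<sigma> \<rho> \<epsilon>' by (auto simp: s1_def)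
  have ss: "sin s1 > 0" using s1 pi_gt3 by (intro sin_gt_zero) auto
  \<comment> \<open>The first bound lets the second torus reach the off-diagonal modulus of
    \<open>q'\<close> with an angle at most \<open>s1\<close>; \<open>\<epsilon>' / 4\<close> keeps
    \<open>\<theta>1\<close> small, and \<open>1 / 2\<close> keeps \<open>\<alpha>\<close> away from
    0.\<close>
  define \<eta> where "\<eta> = min (min (2 * ab * sin s1) (\<epsilon>' / 4)) (min (\<rho> / 4) (1 / 2))"
  have \<eta>: "\<eta> > 0" "\<eta> \<le> 2 * ab * sin s1" "\<eta> \<le> \<epsilon>' / 4" "\<eta> \<le> \<rho> / 4" "\<eta> \<le> 1 / 2"
    using ab ss \<rho> \<epsilon>' by (auto simp: \<eta>_def)
  have "q \<in> \<Sigma>" if q: "norm q = 1" "norm (q - q1) < \<eta>" for q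
  proof -
    have Kc: "norm (qc K) = 1" using K by simp
    define q' where "q' = qconj (qc K) q"
    define \<alpha> \<beta> where "\<alpha> = fst q'" and "\<beta> = snd q'"
    have q'n: "norm q' = 1" "norm (q' - q1) < \<eta>" using q norm_qconj[OF Kc] norm_qconj_1[OF Kc] by (auto simp: q'_def)
    have b: "cmod \<beta> < \<eta>" using norm_component_le(2)[of "q' - q1"] q'n(2) by (simp add: \<beta>_def)
    have al: "cmod (\<alpha> - 1) < \<eta>" using norm_component_le(1)[of "q' - q1"] q'n(2) by (simp add: \<alpha>_def)
    \<comment> \<open>Solves \<open>2 * ab * sin s = cmod \<beta>\<close>, the left side being the
      off-diagonal modulus of \<open>w'\<close> below.\<close>
    define s where "s = arcsin (cmod \<beta> / (2 * ab))"
    have bb: "0 \<le> cmod \<beta> / (2 * ab)" "cmod \<beta> / (2 * ab) < sin s1"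
      using ab b \<eta>(2) by (auto simp: pos_divide_less_eq mult.commute)
    have bb1: "cmod \<beta> / (2 * ab) \<le> 1" using bb sin_le_one[of s1] by linarith
    have sins: "sin s = cmod \<beta> / (2 * ab)" unfolding s_def using bb bb1 by (intro sin_arcsin) auto
    have s0: "0 \<le> s" unfolding s_def using bb bb1 by (intro arcsin_nonneg) auto
    have sr: "s \<le> s1"
    proof (rule ccontr)
      assume "\<not> s \<le> s1"
      moreover have "s \<le> pi / 2" unfolding s_def using bb bb1 arcsin_bounded[of "cmod \<beta> / (2 * ab)"] by auto
      ultimately have "sin s1 \<le> sin s" using s1 pi_gt3 by (subst sin_mono_le_eq) auto
      then show False using sins bb by simp
    qed
    define w where "w = qconj L (eT s)"
    have w\<Sigma>: "w \<in> \<Sigma>" unfolding w_def using t2 s0 sr s1 by auto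
    have wn: "norm w = 1" unfolding w_def using norm_qconj[OF L] norm_gam[OF iu] by simp
    have ws: "norm (w - q1) \<le> s1" unfolding w_def using norm_qconj_1[OF L] norm_gam_1[OF iu, of s] s0 sr by simp
    define w' where "w' = qconj (qc K) w"
    have w'n: "norm w' = 1" "norm (w' - q1) \<le> s1" using wn ws norm_qconj[OF Kc] norm_qconj_1[OF Kc] by (auto simp: w'_def)
    have w'r: "w' = qconj r (eT s)" by (simp add: w'_def w_def r_def qconj_qm)
    have "snd w' = cnj (fst r) * snd r * (2 * \<i> * of_real (sin s))"
      unfolding w'r eT_props(1) by (simp add: qconj_def qm_def qc_def complex_eq_iff algebra_simps)
    then have "cmod (snd w') = ab * (2 * \<bar>sin s\<bar>)" by (simp only: norm_mult) (simp add: ab_def)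
    then have cb: "cmod (snd w') = cmod \<beta>" using sins ab bb by simp
    have ca: "cmod (fst w') = cmod \<alpha>"
    proof -
      have e1: "1 = (cmod (fst w'))\<^sup>2 + (cmod (snd w'))\<^sup>2" using norm_quat[of w'] w'n by simp
      have e2: "1 = (cmod \<alpha>)\<^sup>2 + (cmod \<beta>)\<^sup>2" using norm_quat[of q'] q'n by (simp add: \<alpha>_def \<beta>_def)
      have "(cmod (fst w'))\<^sup>2 = (cmod \<alpha>)\<^sup>2" using e1 e2 unfolding cb by linarith
      then show ?thesis by (simp add: power2_eq_iff_nonneg)
    qed
    have a2: "cmod \<alpha> \<ge> 1 / 2" using norm_triangle_ineq2[of 1 \<alpha>] al \<eta>(5) by (simp add: norm_minus_commute)
    define u1 where "u1 = \<alpha> / fst w'"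
    have fw0: "fst w' \<noteq> 0" using a2 ca by auto
    have u1n: "cmod u1 = 1" using ca a2 by (auto simp: u1_def norm_divide)
    have "u1 - 1 = ((\<alpha> - 1) - (fst w' - 1)) / fst w'" using fw0 by (simp add: u1_def field_simps)
    then have "cmod (u1 - 1) = cmod ((\<alpha> - 1) - (fst w' - 1)) / cmod \<alpha>" by (simp only: norm_divide ca)
    also have "\<dots> \<le> cmod ((\<alpha> - 1) - (fst w' - 1)) / (1 / 2)" using a2 by (intro divide_left_mono) auto
    also have "\<dots> \<le> 2 * (cmod (\<alpha> - 1) + cmod (fst w' - 1))" using norm_triangle_ineq4[of "\<alpha> - 1" "fst w' - 1"] by simp
    also have "\<dots> < 2 * (\<epsilon>' / 4 + \<epsilon>' / 4)"
      using al \<eta>(3) norm_component_le(1)[of "w' - q1"] w'n(2) s1(5) by simp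
    finally have u1e: "cmod (u1 - 1) < \<epsilon>'" by simp
    obtain \<theta>1 where \<theta>1: "\<bar>\<theta>1\<bar> \<le> \<sigma>" "u1 = cis \<theta>1" using \<epsilon>(2)[OF u1n] u1e \<epsilon>' by auto
    obtain \<theta>2 where \<theta>2: "\<beta> = cis \<theta>2 * snd w'"
    proof (cases "snd w' = 0")
      case True
      then have "\<beta> = cis 0 * snd w'" using cb by simp
      then show ?thesis by (rule that)
    next
      case False
      have c1: "cmod (\<beta> / snd w') = 1" unfolding norm_divide using cb False by (metis divide_self norm_eq_zero)
      then have "\<beta> / snd w' \<noteq> 0" by auto
      from cis_Arg[OF this] have "\<beta> / snd w' = cis (Arg (\<beta> / snd w'))"
        using c1 by (simp add: sgn_div_norm)
      then have "\<beta> = cis (Arg (\<beta> / snd w')) * snd w'" using False by (simp add: field_simps)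
      then show ?thesis by (rule that)
    qed
    \<comment> \<open>Multiplying by \<open>eT x\<close> on the left and \<open>eT y\<close> on the
      right turns the diagonal entry by \<open>x + y\<close> and the off-diagonal one by
      \<open>y - x\<close>. The phase \<open>\<theta>2\<close> may be large.\<close>
    define x where "x = (\<theta>1 - \<theta>2) / 2"
    define y where "y = (\<theta>1 + \<theta>2) / 2"
    have xy: "x + y = \<theta>1" "y - x = \<theta>2" by (auto simp: x_def y_def field_simps)
    have q'e: "q' = qm (eT x) (qm w' (eT y))"
    proof -
      have "fst (qm (eT x) (qm w' (eT y))) = cis (x + y) * fst w'"
        unfolding eT_props by (simp add: qm_def cis_mult[symmetric])
      also have "\<dots> = \<alpha>" using xy \<theta>1 fw0 by (simp add: u1_def field_simps)
      finally have 1: "fst (qm (eT x) (qm w' (eT y))) = \<alpha>" .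
      have "snd (qm (eT x) (qm w' (eT y))) = cis (y - x) * snd w'"
        unfolding eT_props by (simp add: qm_def cis_cnj cis_divide[symmetric] field_simps flip: cis_inverse)
      also have "\<dots> = \<beta>" using xy \<theta>2 by simp
      finally show ?thesis using 1 by (simp add: prod_eq_iff \<alpha>_def \<beta>_def)
    qed
    have "q = qconj K q'" using qconj_inv(2)[OF K] by (simp add: q'_def)
    \<comment> \<open>Regrouped so that the possibly large angle \<open>x\<close> occurs only in a
      conjugation, while the remaining torus factor has the small angle
      \<open>\<theta>1\<close>.\<close>
    also have "q' = qm (qconj (eT x) w') (eT \<theta>1)"
    proof -
      have "- x + \<theta>1 = y" using xy by simp
      then show ?thesis by (simp only: q'e qconj_def qc_gam[OF iu] qm_assoc gam_add[OF iu])
    qed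
    also have "qconj K \<dots> = qm (qconj K (qconj (eT x) w')) (\<tau> \<theta>1)"
      by (simp add: qconj_mult[OF K] \<tau>_def)
    also have "qconj K (qconj (eT x) w') = qconj (\<tau> x) w"
      by (simp add: w'_def \<tau>_def flip: qconj_qm) (simp add: qconj_def qm_assoc)
    finally have qe: "q = qm (qconj (\<tau> x) w) (\<tau> \<theta>1)" .
    have "qconj (\<tau> x) w \<in> \<Sigma>" by (rule conj[OF w\<Sigma> wn]) (use ws s1 \<rho> in linarith)
    moreover have "\<tau> \<theta>1 \<in> \<Sigma>" using t1 \<theta>1 by (simp add: \<tau>_def)
    moreover have "norm (\<tau> \<theta>1 - q1) < \<rho>"
    proof -
      have "norm (\<tau> \<theta>1 - q1) = cmod (u1 - 1)" unfolding \<tau>s eT_props \<theta>1(2) by (simp add: q1_def norm_Pair)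
      then show ?thesis using u1e \<epsilon>' by linarith
    qed
    moreover have "norm (qconj (\<tau> x) w - q1) < \<rho>" using norm_qconj_1[OF \<tau>1[of x], of w] ws s1 \<rho> by linarith
    ultimately show ?thesis
      unfolding qe by (intro mult) (use q \<eta> \<rho> \<tau>1 norm_qconj[OF \<tau>1] wn qe in auto)
  qed
  with \<eta>(1) show ?thesis by blast
qed

text \<open>Conjugating by \<open>K\<close> makes \<open>Q\<close> diagonal; conjugation by
  \<open>Q\<close> then multiplies the off-diagonal entry by
  \<open>\<delta> = (cnj d)\<^sup>2\<close>, which is not 1, and
  \<open>twisted_power_tendsto\<close> applies. The surviving angle is \<open>s\<close> times the
  component of \<open>Z\<close> along the axis of \<open>Q\<close>.\<close>

lemma conj_power_tendsto:
  assumes K: "norm K = 1" and d: "cmod d = 1" "d\<^sup>2 \<noteq> 1" and Q: "Q = qconj K (d, 0)" and Z: "imag_unit Z"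
  shows "(\<lambda>p. ((\<lambda>v. qm (gam Z (s / real p)) (qconj Q v)) ^^ p) q1) \<longlonglongrightarrow>
    qconj K (eT (s * Im (fst (qconj (qc K) Z))))"
proof -
  define Z' where "Z' = qconj (qc K) Z"
  have Kc: "norm (qc K) = 1" using K by simp
  have Z': "imag_unit Z'" unfolding Z'_def by (rule imag_unit_qconj[OF Kc Z])
  define x w where "x = Im (fst Z')" and "w = snd Z'"
  have Ze: "Z' = (\<i> * of_real x, w)" using Z' by (simp add: imag_unit_def x_def w_def prod_eq_iff complex_eq_iff)
  have n: "x\<^sup>2 + (cmod w)\<^sup>2 = 1" using Z' norm_quat[of Z'] by (simp add: imag_unit_def Ze norm_mult)
  define \<delta> where "\<delta> = (cnj d)\<^sup>2"
  have \<delta>: "cmod \<delta> = 1" "\<delta> \<noteq> 1"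
  proof -
    show "cmod \<delta> = 1" using d by (simp add: \<delta>_def norm_power)
    have "\<delta> = cnj (d\<^sup>2)" by (simp add: \<delta>_def)
    then show "\<delta> \<noteq> 1" using d(2) by (metis complex_cnj_cnj complex_cnj_one)
  qed
  have dd: "d * cnj d = 1" using d(1) complex_norm_square[of d] by simp
  have step: "qconj (qc K) (qm (gam Z h) (qconj Q v)) = qm (gam Z' h) (fst (qconj (qc K) v), \<delta> * snd (qconj (qc K) v))" for h v
  proof -
    have "qconj (qc K) (qconj Q v) = qconj (d, 0) (qconj (qc K) v)"
      unfolding Q using K by (simp add: qconj_def qc_qm qm_assoc qc_cancel)
    also have "\<dots> = (fst (qconj (qc K) v), \<delta> * snd (qconj (qc K) v))"
      using dd by (simp add: qconj_def[of "(d, 0)"] qm_def qc_def \<delta>_def power2_eq_square algebra_simps)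
    finally show ?thesis using qconj_mult[OF Kc] qconj_gam[OF Kc, of Z h] by (simp add: Z'_def)
  qed
  have iter: "qconj (qc K) (((\<lambda>v. qm (gam Z h) (qconj Q v)) ^^ m) q1) =
      ((\<lambda>y. qm (gam (\<i> * of_real x, w) h) (fst y, \<delta> * snd y)) ^^ m) q1" for h m
    by (induction m) (simp_all add: step Ze[symmetric] qconj_1[OF Kc])
  have "(\<lambda>p. qconj (qc K) (((\<lambda>v. qm (gam Z (s / real p)) (qconj Q v)) ^^ p) q1)) \<longlonglongrightarrow> (cis (s * x), 0)"
    unfolding iter by (rule twisted_power_tendsto[OF n \<delta>])
  moreover have "continuous_on UNIV (qconj K)"
    unfolding qconj_def[abs_def] qm_def by (intro continuous_intros)
  ultimately have "(\<lambda>p. qconj K (qconj (qc K) (((\<lambda>v. qm (gam Z (s / real p)) (qconj Q v)) ^^ p) q1))) \<longlonglongrightarrow> qconj K (cis (s * x), 0)"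
    by (intro continuous_on_tendsto_compose[of UNIV "qconj K"]) auto
  then show ?thesis using qconj_inv(2)[OF K] by (simp add: eT_props x_def Z'_def)
qed

text \<open>Equality modulo the centre of \<open>SU(2)\<close>, which is all that conjugation can
  detect.\<close>

definition sign_eq :: "complex \<times> complex \<Rightarrow> complex \<times> complex \<Rightarrow> bool" where
  "sign_eq p q \<longleftrightarrow> p = q \<or> p = - q"

lemma sign_eq_refl [simp]: "sign_eq p p" by (simp add: sign_eq_def)

lemma sign_eq_sym: "sign_eq p q \<Longrightarrow> sign_eq q p" by (auto simp: sign_eq_def)

lemma sign_eq_trans: "sign_eq p q \<Longrightarrow> sign_eq q r \<Longrightarrow> sign_eq p r" by (auto simp: sign_eq_def)

lemma sign_eq_qm: "sign_eq p p' \<Longrightarrow> sign_eq q q' \<Longrightarrow> sign_eq (qm p q) (qm p' q')"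
  by (auto simp: sign_eq_def qm_distrib)

lemma sign_eq_qconj: "sign_eq P Q \<Longrightarrow> qconj P v = qconj Q v"
proof -
  have "qc (- Q) = - qc Q" by (simp add: qc_def)
  then show "sign_eq P Q \<Longrightarrow> qconj P v = qconj Q v" by (auto simp: sign_eq_def qconj_def qm_distrib)
qed

text \<open>The quotient of \<open>P\<close> and \<open>Q\<close> commutes with all unit quaternions
  near 1, in particular with small rotations about every axis, so it is central.\<close>

lemma sign_eq_of_qconj:
  assumes P: "norm P = 1" and Q: "norm Q = 1" and r: "r > 0"
    and eq: "\<And>q. norm q = 1 \<Longrightarrow> norm (q - q1) < r \<Longrightarrow> qconj P q = qconj Q q"
  shows "sign_eq P Q"
proof -
  define R where "R = qm (qc Q) P"
  have R: "norm R = 1" using P Q by (simp add: R_def norm_qm)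
  have RQ: "P = qm Q R" using Q by (simp add: R_def qc_cancel)
  have comm: "qm R q = qm q R" if q: "norm q = 1" "norm (q - q1) < r" for q
  proof -
    have "qconj R q = q"
      using eq[OF q] qconj_inv(1)[OF Q, of q] by (simp add: R_def qconj_qm)
    then show ?thesis using R by (metis qconj_def qm_assoc qc_cancel(2) qm_1(2))
  qed
  have "R = q1 \<or> R = - q1"
  proof (rule ccontr)
    assume "\<not> ?thesis"
    then obtain Z where Z: "Z \<in> axes" "qm R Z \<noteq> qm Z R" using not_commute_axis[OF R] by blast
    define h where "h = min (r / 2) (1 / 2)"
    have h: "0 < \<bar>h\<bar>" "\<bar>h\<bar> < 1" "\<bar>h\<bar> < r" using r by (auto simp: h_def)
    have iu: "imag_unit Z" using Z imag_unit_axes by blast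
    have "qm R (gam Z h) = qm (gam Z h) R"
      by (rule comm) (use norm_gam[OF iu] norm_gam_1[OF iu, of h] h in auto)
    with gam_not_commute[OF R Z(2) h(1,2)] show False by simp
  qed
  then show ?thesis unfolding RQ by (auto simp: sign_eq_def qm_distrib)
qed

section \<open>Local coordinates on the group\<close>

type_synonym param = "(nat \<Rightarrow> complex \<times> complex) \<times> (nat \<Rightarrow> complex)"

definition small :: "real \<Rightarrow> param \<Rightarrow> bool" where
  "small r v \<longleftrightarrow> (\<forall>i. norm (fst v i) = 1 \<and> norm (fst v i - q1) < r) \<and> (\<forall>j. cmod (snd v j) = 1 \<and> cmod (snd v j - 1) < r)"

definition pmul :: "param \<Rightarrow> param \<Rightarrow> param" where
  "pmul v w = (\<lambda>i. qm (fst v i) (fst w i), \<lambda>j. snd v j * snd w j)"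

definition pconj :: "(nat \<Rightarrow> complex \<times> complex) \<Rightarrow> param \<Rightarrow> param" where
  "pconj Q v = (\<lambda>i. qconj (Q i) (fst v i), snd v)"

definition pone :: param where "pone = (\<lambda>_. q1, \<lambda>_. 1)"

definition incq :: "nat \<Rightarrow> complex \<times> complex \<Rightarrow> param" where
  "incq i q = ((\<lambda>_. q1)(i := q), \<lambda>_. 1)"

definition incz :: "nat \<Rightarrow> complex \<Rightarrow> param" where
  "incz j z = (\<lambda>_. q1, (\<lambda>_. 1)(j := z))"

lemma small_pone: "r > 0 \<Longrightarrow> small r pone" by (simp add: small_def pone_def)

lemma small_incq: "r > 0 \<Longrightarrow> small r (incq i q) \<longleftrightarrow> norm q = 1 \<and> norm (q - q1) < r"
  by (auto simp: small_def incq_def)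

lemma small_incz: "r > 0 \<Longrightarrow> small r (incz j z) \<longleftrightarrow> cmod z = 1 \<and> cmod (z - 1) < r"
  by (auto simp: small_def incz_def)

lemma small_mono: "small r v \<Longrightarrow> r \<le> r' \<Longrightarrow> small r' v" unfolding small_def by (meson order_less_le_trans)

lemma small_pconj: "(\<And>i. norm (Q i) = 1) \<Longrightarrow> small r v \<Longrightarrow> small r (pconj Q v)"
  by (simp add: small_def pconj_def norm_qconj norm_qconj_1)

lemma small_pmul:
  assumes "small r v" "small r' w" shows "small (r + r') (pmul v w)"
proof -
  have "cmod (a * b - 1) \<le> cmod (a - 1) + cmod (b - 1)" if "cmod b = 1" for a b
  proof -
    have "a * b - 1 = (a - 1) * b + (b - 1)" by (simp add: algebra_simps)
    then have "cmod (a * b - 1) \<le> cmod ((a - 1) * b) + cmod (b - 1)" by (metis norm_triangle_ineq)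
    then show ?thesis using that by (simp add: norm_mult)
  qed
  then show ?thesis using assms norm_qm_1
    by (simp add: small_def pmul_def norm_qm norm_mult) (meson add_strict_mono le_less_trans)
qed

lemma pmul_simps [simp]:
  "pmul pone v = v" "pmul v pone = v"
  "pmul (incq i p) (incq i q) = incq i (qm p q)"
  "pmul (incz j y) (incz j z) = incz j (y * z)"
  by (auto simp: pmul_def pone_def incq_def incz_def fun_eq_iff prod_eq_iff)

lemma pconj_simps [simp]:
  "(\<And>i. norm (Q i) = 1) \<Longrightarrow> pconj Q (incq i q) = incq i (qconj (Q i) q)"
  "(\<And>i. norm (Q i) = 1) \<Longrightarrow> pconj Q (incz j z) = incz j z"
  by (auto simp: pconj_def incq_def incz_def fun_eq_iff qconj_1)

lemma inc_one [simp]: "incq i q1 = pone" "incz j 1 = pone"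
  by (auto simp: pone_def incq_def incz_def)

declare split_paired_All [simp del] split_paired_Ex [simp del]

text \<open>
  \<open>J\<close> is the inverse of the local isomorphism. Only the components \<open>i < k\<close> and \<open>j < l\<close> of a parameter
  matter, although \<open>small\<close> constrains all of them.
\<close>

locale haar_chart = haar_compact +
  fixes k l :: nat and J :: "param \<Rightarrow> 'a" and \<rho> :: real
  assumes Hausdorff: "Hausdorff_space T" and conn: "connected_space T"
    and \<rho>: "\<rho> > 0"
    and J_closed: "small \<rho> v \<Longrightarrow> J v \<in> carrier G"
    and J_mult: "small \<rho> v \<Longrightarrow> small \<rho> w \<Longrightarrow> small \<rho> (pmul v w) \<Longrightarrow> J (pmul v w) = J v \<otimes> J w"
    and J_inj: "small \<rho> v \<Longrightarrow> small \<rho> w \<Longrightarrow> J v = J w \<Longrightarrow> i < k \<Longrightarrow> fst v i = fst w i"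
    and J_cong: "(\<And>i. i < k \<Longrightarrow> fst v i = fst w i) \<Longrightarrow> (\<And>j. j < l \<Longrightarrow> snd v j = snd w j) \<Longrightarrow> J v = J w"
    and J_lim: "(\<And>n. small \<rho> (V n)) \<Longrightarrow> small \<rho> v \<Longrightarrow> (\<And>i. (\<lambda>n. fst (V n) i) \<longlonglongrightarrow> fst v i) \<Longrightarrow>
      (\<And>j. (\<lambda>n. snd (V n) j) \<longlonglongrightarrow> snd v j) \<Longrightarrow> limitin T (\<lambda>n. J (V n)) (J v) sequentially"
    and J_open: "0 < \<eta> \<Longrightarrow> \<eta> \<le> \<rho> \<Longrightarrow> \<exists>U. openin T U \<and> \<one> \<in> U \<and> U \<subseteq> J ` {v. small \<eta> v}"
begin

text \<open>A radius at which the product of two parameters is still in the domain of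
  \<open>J\<close>, by \<open>small_pmul\<close>.\<close>

abbreviation "\<rho>3 \<equiv> \<rho> / 3"

lemma J_one: "J pone = \<one>"
proof -
  have s: "small \<rho> pone" using \<rho> by (rule small_pone)
  have "J pone = J pone \<otimes> J pone" using J_mult[OF s s] s by simp
  then show ?thesis using J_closed[OF s] by (metis l_cancel_one)
qed

lemma open_left_translate:
  assumes U: "openin T U" and g: "g \<in> carrier G" shows "openin T (g <# U)"
proof -
  have c: "continuous_map T T (\<lambda>x. inv g \<otimes> x)"
  proof -
    have "continuous_map T (prod_topology T T) (\<lambda>x. (inv g, x))"
      by (intro continuous_map_pairedI continuous_map_id[unfolded id_def]) (use g in \<open>simp add: topspace_eq\<close>)
    from continuous_map_compose[OF this continuous_mult] show ?thesis by (simp add: o_def)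
  qed
  have "openin T {x \<in> topspace T. inv g \<otimes> x \<in> U}" by (rule openin_continuous_map_preimage[OF c U])
  moreover have "{x \<in> topspace T. inv g \<otimes> x \<in> U} = g <# U"
    using vimage_left_mult[of "inv g" U] g openin_subset[OF U] by (auto simp: topspace_eq)
  ultimately show ?thesis by simp
qed

text \<open>Such a subgroup is open, and so is its complement, being a union of cosets;
  connectedness leaves only the whole group.\<close>

lemma open_subgroup_full:
  assumes H: "subgroup H G" and U: "openin T U" "\<one> \<in> U" "U \<subseteq> H"
  shows "H = carrier G"
proof -
  have Uc: "U \<subseteq> carrier G" using openin_subset[OF U(1)] by (simp add: topspace_eq)
  have in_tr: "x \<in> x <# U" if "x \<in> carrier G" for x
    using that U(2) unfolding l_coset_def by force
  have tr: "x <# U \<subseteq> {y \<in> carrier G. inv x \<otimes> y \<in> H}" if x: "x \<in> carrier G" for x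
    using x U(3) Uc unfolding l_coset_def by (auto simp: m_assoc[symmetric] subset_iff)
  have Hc: "H \<subseteq> carrier G" using H by (rule subgroup.subset)
  have "openin T H"
  proof (subst openin_subopen, intro ballI)
    fix x assume x: "x \<in> H"
    then have xc: "x \<in> carrier G" using Hc by auto
    have "x <# U \<subseteq> H"
      using x U(3) subgroup.m_closed[OF H] unfolding l_coset_def by auto
    then show "\<exists>V. openin T V \<and> x \<in> V \<and> V \<subseteq> H"
      using open_left_translate[OF U(1) xc] in_tr[OF xc] by blast
  qed
  moreover have "openin T (topspace T - H)"
  proof (subst openin_subopen, intro ballI)
    fix x assume x: "x \<in> topspace T - H"
    then have xc: "x \<in> carrier G" "x \<notin> H" by (auto simp: topspace_eq)
    have "x <# U \<subseteq> topspace T - H"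
    proof
      fix y assume "y \<in> x <# U"
      then have y: "y \<in> carrier G" "inv x \<otimes> y \<in> H" using tr[OF xc(1)] by auto
      have "y \<notin> H"
      proof
        assume "y \<in> H"
        from subgroup.m_closed[OF H y(2) subgroup.m_inv_closed[OF H this]]
        have "inv x \<in> H" using xc(1) y(1) by (simp add: m_assoc)
        from subgroup.m_inv_closed[OF H this] show False using xc by simp
      qed
      then show "y \<in> topspace T - H" using y by (simp add: topspace_eq)
    qed
    then show "\<exists>V. openin T V \<and> x \<in> V \<and> V \<subseteq> topspace T - H"
      using open_left_translate[OF U(1) xc(1)] in_tr[OF xc(1)] by blast
  qed
  then have "closedin T H" using Hc by (simp add: closedin_def topspace_eq)
  ultimately have "H = {} \<or> H = topspace T" using conn by (simp add: connected_space_clopen_in)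
  then show ?thesis using U by (auto simp: topspace_eq)
qed

lemma conj_J_small:
  assumes w: "small \<rho>3 w" and v: "small \<rho>3 v"
  shows "J w \<otimes> J v = J (pconj (fst w) v) \<otimes> J w"
proof -
  have u: "norm (fst w i) = 1" "cmod (snd w j) = 1" for i j using w by (auto simp: small_def)
  have le: "\<rho>3 \<le> \<rho>" using \<rho> by simp
  have sp: "small \<rho>3 (pconj (fst w) v)" by (rule small_pconj[OF u(1) v])
  have e: "pmul w v = pmul (pconj (fst w) v) w"
    using u by (simp add: pmul_def pconj_def qconj_def qm_assoc qc_cancel mult.commute)
  have s: "small \<rho> (pmul w v)" using small_mono[OF small_pmul[OF w v]] \<rho> by simp
  show ?thesis
    using J_mult[OF small_mono[OF w le] small_mono[OF v le] s]
      J_mult[OF small_mono[OF sp le] small_mono[OF w le] s[unfolded e]] e by simp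
qed

text \<open>Conjugation by \<open>a\<close> in local coordinates: by \<open>Q i\<close> on each
  quaternion factor and trivially on the circles. As \<open>pconj\<close> preserves
  \<open>small\<close>, such relations compose without shrinking the radius.\<close>

definition acts :: "'a \<Rightarrow> (nat \<Rightarrow> complex \<times> complex) \<Rightarrow> bool" where
  "acts a Q \<longleftrightarrow> (\<forall>i. norm (Q i) = 1) \<and> (\<forall>v. small \<rho>3 v \<longrightarrow> a \<otimes> J v = J (pconj Q v) \<otimes> a)"

lemma actsD: "acts a Q \<Longrightarrow> small \<rho>3 v \<Longrightarrow> a \<otimes> J v = J (pconj Q v) \<otimes> a"
  and acts_norm: "acts a Q \<Longrightarrow> norm (Q i) = 1"
  by (auto simp: acts_def)

lemma J_closed3: "small \<rho>3 v \<Longrightarrow> J v \<in> carrier G"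
  using J_closed small_mono[of \<rho>3 v \<rho>] \<rho> by simp

lemma acts_J: "small \<rho>3 w \<Longrightarrow> acts (J w) (fst w)"
  using conj_J_small by (auto simp: acts_def small_def)

lemma acts_mult:
  assumes a: "a \<in> carrier G" "acts a P" and b: "b \<in> carrier G" "acts b Q"
  shows "acts (a \<otimes> b) (\<lambda>i. qm (P i) (Q i))"
  unfolding acts_def
proof (intro conjI allI impI)
  show "norm (qm (P i) (Q i)) = 1" for i using a b by (simp add: acts_def norm_qm)
  fix v assume v: "small \<rho>3 v"
  have v': "small \<rho>3 (pconj Q v)" using small_pconj[OF _ v, of Q] b by (simp add: acts_def)
  have v'': "small \<rho>3 (pconj P (pconj Q v))" using small_pconj[OF _ v', of P] a by (simp add: acts_def)
  note c = J_closed3[OF v] J_closed3[OF v'] J_closed3[OF v'']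
  have "a \<otimes> b \<otimes> J v = a \<otimes> (J (pconj Q v) \<otimes> b)" using a b v c by (simp add: m_assoc actsD)
  also have "\<dots> = (a \<otimes> J (pconj Q v)) \<otimes> b" using a b c by (simp add: m_assoc)
  also have "\<dots> = J (pconj P (pconj Q v)) \<otimes> a \<otimes> b" using a v' by (simp add: actsD)
  also have "pconj P (pconj Q v) = pconj (\<lambda>i. qm (P i) (Q i)) v" by (simp add: pconj_def qconj_qm)
  finally show "a \<otimes> b \<otimes> J v = J (pconj (\<lambda>i. qm (P i) (Q i)) v) \<otimes> (a \<otimes> b)"
    using a b c by (simp add: m_assoc pconj_def qconj_qm)
qed

lemma acts_inv:
  assumes a: "a \<in> carrier G" "acts a P" shows "acts (inv a) (\<lambda>i. qc (P i))"
  unfolding acts_def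
proof (intro conjI allI impI)
  show "norm (qc (P i)) = 1" for i using a by (simp add: acts_def)
  fix v assume v: "small \<rho>3 v"
  let ?v = "pconj (\<lambda>i. qc (P i)) v"
  have v': "small \<rho>3 ?v" using small_pconj[OF _ v, of "\<lambda>i. qc (P i)"] a by (simp add: acts_def)
  have e: "pconj P ?v = v" using a by (simp add: pconj_def acts_def qconj_inv)
  note c = J_closed3[OF v] J_closed3[OF v']
  have "a \<otimes> J ?v = J v \<otimes> a" using actsD[OF a(2) v'] e by simp
  have "inv a \<otimes> J v = inv a \<otimes> (J v \<otimes> a) \<otimes> inv a" using a c by (simp add: m_assoc)
  also have "\<dots> = inv a \<otimes> (a \<otimes> J ?v) \<otimes> inv a" by (simp only: \<open>a \<otimes> J ?v = J v \<otimes> a\<close>)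
  also have "\<dots> = J ?v \<otimes> inv a" using a c by (simp add: m_assoc[symmetric])
  finally show "inv a \<otimes> J v = J ?v \<otimes> inv a" .
qed

text \<open>The elements with such a description form a subgroup containing all small elements,
  hence the connected group. In particular no element permutes the local factors or inverts a
  circle.\<close>

lemma ex_acts: assumes "a \<in> carrier G" shows "\<exists>Q. acts a Q"
proof -
  let ?H = "{a \<in> carrier G. \<exists>Q. acts a Q}"
  have "subgroup ?H G"
  proof
    show "\<one> \<in> ?H" using acts_J[OF small_pone] \<rho> by (auto simp: J_one)
  qed (auto intro: acts_mult acts_inv)
  moreover obtain U where U: "openin T U" "\<one> \<in> U" "U \<subseteq> J ` {v. small \<rho>3 v}"
    using J_open[of \<rho>3] \<rho> by auto
  moreover have "U \<subseteq> ?H" using U(3) acts_J J_closed3 by blast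
  ultimately have "?H = carrier G" using open_subgroup_full by blast
  with assms show ?thesis by blast
qed

text \<open>An arbitrary choice; by \<open>acts_unique\<close> it is determined up to sign in each
  factor \<open>i < k\<close>.\<close>

definition Qf :: "'a \<Rightarrow> nat \<Rightarrow> complex \<times> complex" where
  "Qf a = (SOME Q. acts a Q)"

lemma acts_Qf: "a \<in> carrier G \<Longrightarrow> acts a (Qf a)"
  unfolding Qf_def using ex_acts someI_ex by metis

lemma Qf_norm: "a \<in> carrier G \<Longrightarrow> norm (Qf a i) = 1"
  using acts_Qf by (auto simp: acts_def)

lemma acts_unique:
  assumes a: "a \<in> carrier G" and P: "acts a P" and Q: "acts a Q" and i: "i < k"
  shows "sign_eq (P i) (Q i)"
proof (rule sign_eq_of_qconj[where r=\<rho>3])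
  show n: "norm (P i) = 1" "norm (Q i) = 1" using P Q by (auto simp: acts_def)
  show r: "\<rho>3 > 0" using \<rho> by simp
  fix q assume q: "norm q = 1" "norm (q - q1) < \<rho>3"
  have s: "small \<rho>3 (incq i q)" using q r by (simp add: small_incq)
  have sP: "small \<rho>3 (pconj P (incq i q))" "small \<rho>3 (pconj Q (incq i q))"
    using small_pconj[OF _ s] P Q by (auto simp: acts_def)
  have "J (pconj P (incq i q)) \<otimes> a = J (pconj Q (incq i q)) \<otimes> a"
    using actsD[OF P s] actsD[OF Q s] by simp
  then have "J (pconj P (incq i q)) = J (pconj Q (incq i q))" using a J_closed3 sP by (simp add: r_cancel)
  from J_inj[OF small_mono[OF sP(1)] small_mono[OF sP(2)] this i] \<rho>
  show "qconj (P i) q = qconj (Q i) q" by (simp add: pconj_def incq_def)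
qed

text \<open>
  Since \<open>a b\<close> and \<open>b a\<close> act alike on the factor \<open>i\<close>, the actions of \<open>a\<close> and \<open>b\<close> on it commute up to sign, so
  their tori may coincide.
\<close>

definition bad :: "nat \<Rightarrow> ('a \<times> 'a) set" where
  "bad i = {(a, b). a \<in> carrier G \<and> b \<in> carrier G \<and> (\<forall>q. norm q = 1 \<longrightarrow> norm (q - q1) < \<rho>3 \<longrightarrow>
     a \<otimes> b \<otimes> J (incq i q) \<otimes> inv (a \<otimes> b) = b \<otimes> a \<otimes> J (incq i q) \<otimes> inv (b \<otimes> a))}"

lemma acts_conj:
  assumes a: "a \<in> carrier G" "acts a P" and q: "norm q = 1" "norm (q - q1) < \<rho>3"
  shows "a \<otimes> J (incq i q) \<otimes> inv a = J (incq i (qconj (P i) q))"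
proof -
  have n: "norm (P i) = 1" for i using a by (simp add: acts_def)
  have s: "small \<rho>3 (incq i q)" using q \<rho> by (simp add: small_incq)
  have s': "small \<rho>3 (incq i (qconj (P i) q))" using q \<rho> n by (simp add: small_incq norm_qconj norm_qconj_1)
  have "a \<otimes> J (incq i q) = J (incq i (qconj (P i) q)) \<otimes> a" using actsD[OF a(2) s] n by simp
  then show ?thesis using a J_closed3[OF s'] by (simp add: m_assoc)
qed

lemma bad_iff:
  assumes a: "a \<in> carrier G" "acts a P" and b: "b \<in> carrier G" "acts b Q" and i: "i < k"
  shows "(a, b) \<in> bad i \<longleftrightarrow> sign_eq (qm (P i) (Q i)) (qm (Q i) (P i))"
proof -
  have ab: "acts (a \<otimes> b) (\<lambda>i. qm (P i) (Q i))" and ba: "acts (b \<otimes> a) (\<lambda>i. qm (Q i) (P i))"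
    by (rule acts_mult[OF a b], rule acts_mult[OF b a])
  have c: "a \<otimes> b \<in> carrier G" "b \<otimes> a \<in> carrier G" using a b by auto
  have n: "norm (qm (P i) (Q i)) = 1" "norm (qm (Q i) (P i)) = 1" using ab ba by (auto simp: acts_def)
  have "(a, b) \<in> bad i \<longleftrightarrow> (\<forall>q. norm q = 1 \<longrightarrow> norm (q - q1) < \<rho>3 \<longrightarrow>
      J (incq i (qconj (qm (P i) (Q i)) q)) = J (incq i (qconj (qm (Q i) (P i)) q)))"
    using a b acts_conj[OF c(1) ab] acts_conj[OF c(2) ba] by (simp add: bad_def)
  also have "\<dots> \<longleftrightarrow> (\<forall>q. norm q = 1 \<longrightarrow> norm (q - q1) < \<rho>3 \<longrightarrow> qconj (qm (P i) (Q i)) q = qconj (qm (Q i) (P i)) q)"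
  proof (intro iff_allI imp_cong refl iffI)
    fix q assume q: "norm q = 1" "norm (q - q1) < \<rho>3"
      and e: "J (incq i (qconj (qm (P i) (Q i)) q)) = J (incq i (qconj (qm (Q i) (P i)) q))"
    have s: "small \<rho> (incq i (qconj R q))" if "norm R = 1" for R
      using q \<rho> that by (simp add: small_incq norm_qconj norm_qconj_1)
    from J_inj[OF s[OF n(1)] s[OF n(2)] e i] show "qconj (qm (P i) (Q i)) q = qconj (qm (Q i) (P i)) q"
      by (simp add: incq_def)
  qed simp
  also have "\<dots> \<longleftrightarrow> sign_eq (qm (P i) (Q i)) (qm (Q i) (P i))"
    using sign_eq_of_qconj[OF n, of \<rho>3] \<rho> sign_eq_qconj[of "qm (P i) (Q i)" "qm (Q i) (P i)"] by auto
  finally show ?thesis .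
qed

text \<open>\<open>bad\<close> is written with group equations so that it is an intersection of
  equalisers of continuous maps, hence closed. A description through the chosen \<open>Qf\<close>
  would not show measurability.\<close>

lemma bad_sets: "bad i \<in> sets (\<mu> \<Otimes>\<^sub>M \<mu>)"
proof -
  let ?P = "prod_topology T T"
  let ?q = "{q. norm q = 1 \<and> norm (q - q1) < \<rho>3}"
  have m: "continuous_map ?P T (\<lambda>z. f z \<otimes> g z)" if "continuous_map ?P T f" "continuous_map ?P T g" for f g
    using continuous_map_compose[OF continuous_map_pairedI[OF that] continuous_mult] by (simp add: o_def)
  have iv: "continuous_map ?P T (\<lambda>z. inv (f z))" if "continuous_map ?P T f" for f
    using continuous_map_compose[OF that continuous_inv] by (simp add: o_def)
  have q1in: "q1 \<in> ?q" using \<rho> by simp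
  have "closedin ?P {z \<in> topspace ?P. fst z \<otimes> snd z \<otimes> J (incq i q) \<otimes> inv (fst z \<otimes> snd z)
      = snd z \<otimes> fst z \<otimes> J (incq i q) \<otimes> inv (snd z \<otimes> fst z)}" if q: "q \<in> ?q" for q
  proof -
    have Jc: "J (incq i q) \<in> topspace T" using J_closed3[of "incq i q"] q \<rho> by (simp add: small_incq topspace_eq)
    show ?thesis
      by (intro closedin_continuous_maps_eq[OF Hausdorff] m iv continuous_map_fst continuous_map_snd)
        (use Jc in simp_all)
  qed
  then have "closedin ?P (\<Inter>q\<in>?q. {z \<in> topspace ?P. fst z \<otimes> snd z \<otimes> J (incq i q) \<otimes> inv (fst z \<otimes> snd z)
      = snd z \<otimes> fst z \<otimes> J (incq i q) \<otimes> inv (snd z \<otimes> fst z)})"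
    using q1in by (intro closedin_Inter) blast+
  moreover have "(\<Inter>q\<in>?q. {z \<in> topspace ?P. fst z \<otimes> snd z \<otimes> J (incq i q) \<otimes> inv (fst z \<otimes> snd z)
      = snd z \<otimes> fst z \<otimes> J (incq i q) \<otimes> inv (snd z \<otimes> fst z)}) = bad i"
  proof -
    have "(\<Inter>q\<in>A. {z \<in> B. P q z}) = {z \<in> B. \<forall>q\<in>A. P q z}" if "q1 \<in> A"
      for A and B :: "('a \<times> 'a) set" and P :: "complex \<times> complex \<Rightarrow> 'a \<times> 'a \<Rightarrow> bool" using that by blast
    from this[OF q1in] show ?thesis by (auto simp: bad_def topspace_eq)
  qed
  ultimately have cl: "closedin ?P (bad i)" by simp
  have "topspace ?P - (topspace ?P - bad i) \<in> sets (\<mu> \<Otimes>\<^sub>M \<mu>)"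
    by (intro sets.Diff openin_prod_sets openin_topspace) (use cl in \<open>simp add: closedin_def\<close>)
  moreover have "topspace ?P - (topspace ?P - bad i) = bad i" using closedin_subset[OF cl] by auto
  ultimately show ?thesis by simp
qed

definition rot :: "nat \<Rightarrow> complex \<times> complex \<Rightarrow> real \<Rightarrow> 'a" where
  "rot i Z h = J (incq i (gam Z h))"

lemma small_rot: "imag_unit Z \<Longrightarrow> \<bar>h\<bar> < r \<Longrightarrow> small r (incq i (gam Z h))"
  using norm_gam_1[of Z h] by (subst small_incq) (auto simp: norm_gam)

lemma acts_rot: "imag_unit Z \<Longrightarrow> \<bar>h\<bar> < \<rho>3 \<Longrightarrow> acts (rot i Z h) ((\<lambda>_. q1)(i := gam Z h))"
  using acts_J[OF small_rot[of Z h \<rho>3 i]] by (simp add: rot_def incq_def)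

lemma rot_closed: "imag_unit Z \<Longrightarrow> \<bar>h\<bar> < \<rho>3 \<Longrightarrow> rot i Z h \<in> carrier G"
  unfolding rot_def by (rule J_closed3[OF small_rot])

text \<open>
  Two elements of the set with the same image under translations by distinct rotations about \<open>Z\<close> would force
  \<open>Q\<close>, the action of \<open>a\<close>, to commute up to sign with a small rotation about \<open>Z\<close>.
\<close>

lemma null_commuting:
  assumes i: "i < k" and a: "a \<in> carrier G" and nc: "Qf a i \<noteq> q1" "Qf a i \<noteq> - q1"
  shows "{b \<in> carrier G. (a, b) \<in> bad i} \<in> null_sets \<mu>"
proof -
  obtain Z where Z: "Z \<in> axes" "qm (Qf a i) Z \<noteq> qm Z (Qf a i)"
    using not_commute_axis[OF Qf_norm[OF a] nc] by blast
  have iu: "imag_unit Z" using Z imag_unit_axes by blast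
  \<comment> \<open>Below \<open>\<rho>3\<close> the rotations lie in the chart; below 1 the angle
    differences satisfy the two non-commutation lemmas.\<close>
  define e where "e = min (\<rho>3 / 2) (1 / 2)"
  have e: "0 < e" "e < \<rho>3" "e < 1" using \<rho> by (auto simp: e_def)
  define h where "h m = e / (real m + 1)" for m :: nat
  have hb: "\<bar>h m\<bar> < \<rho>3" "0 < h m" "h m \<le> e" for m
  proof -
    show "0 < h m" using e by (simp add: h_def)
    show "h m \<le> e" using e by (simp add: h_def divide_le_eq mult_le_cancel_left1)
    then show "\<bar>h m\<bar> < \<rho>3" using \<open>0 < h m\<close> e by simp
  qed
  have hne: "h m \<noteq> h n" if "m \<noteq> n" for m n using that e by (auto simp: h_def field_simps)
  let ?B = "{b \<in> carrier G. (a, b) \<in> bad i}"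
  show ?thesis
  proof (rule null_of_disjoint_translates)
    have "Pair a -` bad i \<in> sets \<mu>" by (rule sets_Pair1[OF bad_sets])
    moreover have "Pair a -` bad i = ?B" by (auto simp: bad_def)
    ultimately show "?B \<in> sets \<mu>" by simp
    show "rot i Z (h m) \<in> carrier G" for m by (rule rot_closed[OF iu hb(1)])
    fix m n :: nat assume mn: "m \<noteq> n"
    show "(rot i Z (h m) <# ?B) \<inter> (rot i Z (h n) <# ?B) = {}"
    proof (rule ccontr)
      assume "\<not> ?thesis"
      then obtain b b' where b: "b \<in> carrier G" "(a, b) \<in> bad i" and b': "b' \<in> carrier G" "(a, b') \<in> bad i"
        and eq: "rot i Z (h m) \<otimes> b = rot i Z (h n) \<otimes> b'"
        unfolding l_coset_def by blast
      have rc: "rot i Z (h m) \<in> carrier G" "rot i Z (h n) \<in> carrier G" by (auto intro: rot_closed[OF iu hb(1)])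
      note A = acts_mult[OF rc(1) acts_rot[OF iu hb(1)] b(1) acts_Qf[OF b(1)]]
      note B = acts_mult[OF rc(2) acts_rot[OF iu hb(1)] b'(1) acts_Qf[OF b'(1)]]
      have "sign_eq (qm (gam Z (h m)) (Qf b i)) (qm (gam Z (h n)) (Qf b' i))"
        using acts_unique[OF _ A B[folded eq] i] rc b by simp
      from sign_eq_qm[OF sign_eq_refl[of "gam Z (- h n)"] this]
      have s1: "sign_eq (qm (gam Z (h m - h n)) (Qf b i)) (Qf b' i)"
        using gam_add[OF iu] by (simp flip: qm_assoc)
      define u where "u = gam Z (h m - h n)"
      have cb: "sign_eq (qm (Qf a i) (Qf b i)) (qm (Qf b i) (Qf a i))"
        and cb': "sign_eq (qm (Qf a i) (Qf b' i)) (qm (Qf b' i) (Qf a i))"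
        using bad_iff[OF a acts_Qf[OF a] b(1) acts_Qf[OF b(1)] i] b(2)
          bad_iff[OF a acts_Qf[OF a] b'(1) acts_Qf[OF b'(1)] i] b'(2) by auto
      have "sign_eq (qm (Qf a i) (qm u (Qf b i))) (qm (Qf a i) (Qf b' i))"
        by (rule sign_eq_qm[OF sign_eq_refl]) (use s1 in \<open>simp add: u_def\<close>)
      moreover have "sign_eq (qm (Qf b' i) (Qf a i)) (qm (qm u (Qf b i)) (Qf a i))"
        by (rule sign_eq_qm[OF sign_eq_sym sign_eq_refl]) (use s1 in \<open>simp add: u_def\<close>)
      moreover have "sign_eq (qm (qm u (Qf b i)) (Qf a i)) (qm u (qm (Qf a i) (Qf b i)))"
        unfolding qm_assoc by (rule sign_eq_qm[OF sign_eq_refl sign_eq_sym[OF cb]])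
      ultimately have "sign_eq (qm (Qf a i) (qm u (Qf b i))) (qm u (qm (Qf a i) (Qf b i)))"
        using cb' sign_eq_trans by blast
      \<comment> \<open>Cancelling \<open>Qf b i\<close> on the right leaves a relation between
        \<open>Qf a i\<close> and the rotation \<open>u\<close> alone.\<close>
      from sign_eq_qm[OF this sign_eq_refl[of "qc (Qf b i)"]]
      have "sign_eq (qm (Qf a i) u) (qm u (Qf a i))"
        using Qf_norm[OF b(1)] by (simp add: qm_assoc qc_cancel)
      moreover have "\<bar>h m - h n\<bar> < 1" "0 < \<bar>h m - h n\<bar>" using hb(2,3)[of m] hb(2,3)[of n] e hne[OF mn] by auto
      ultimately show False
        using gam_not_commute[OF Qf_norm[OF a] Z(2)] gam_not_anticommute[OF Qf_norm[OF a] iu]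
        by (auto simp: u_def sign_eq_def)
    qed
  qed
qed

end

lemma norm_cis_diff_1: "cmod (cis h - 1) \<le> \<bar>h\<bar>"
proof -
  have "norm (eT h - q1) = cmod (cis h - 1)" unfolding eT_props by (simp add: q1_def norm_Pair)
  then show ?thesis using norm_gam_1[OF eT_props(2), of h] by simp
qed

text \<open>If \<open>r\<close> is diagonal or antidiagonal, it normalises the diagonal torus, so
  both elements lie in the same torus. In contrapositive form this supplies the hypothesis on
  \<open>R\<close> in \<open>two_tori_generate\<close>.\<close>

lemma same_torus_commute:
  assumes K: "norm K = 1" and L: "norm L = 1"
    and R: "fst (qm (qc K) L) = 0 \<or> snd (qm (qc K) L) = 0"
  shows "qm (qconj K (d, 0)) (qconj L (d', 0)) = qm (qconj L (d', 0)) (qconj K (d, 0))"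
proof -
  define r where "r = qm (qc K) L"
  have L': "L = qm K r" using K by (simp add: r_def qc_cancel)
  have "fst r = 0 \<or> snd r = 0" using R by (simp add: r_def)
  then have "snd (qconj r (d', 0)) = 0" by (auto simp: qconj_def qm_def qc_def)
  then obtain d'' where d'': "qconj r (d', 0) = (d'', 0)" by (metis prod.collapse)
  have "qm (d, 0) (d'', 0) = qm (d'', 0) (d, 0)" by (simp add: qm_def)
  then show ?thesis by (simp add: L' qconj_qm d'' flip: qconj_mult[OF K])
qed

section \<open>The limits of perturbations generate the group\<close>

context haar_chart
begin

lemma incq_lim:
  assumes "\<And>n. small \<rho> (incq i (V n))" "small \<rho> (incq i q)" "V \<longlonglongrightarrow> q"
  shows "limitin T (\<lambda>n. J (incq i (V n))) (J (incq i q)) sequentially"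
proof (rule J_lim[OF assms(1,2)])
  show "(\<lambda>n. fst (incq i (V n)) i') \<longlonglongrightarrow> fst (incq i q) i'" for i'
    using assms(3) by (cases "i' = i") (simp_all add: incq_def)
qed (simp add: incq_def)

lemma incz_lim:
  assumes "\<And>n. small \<rho> (incz j (V n))" "small \<rho> (incz j z)" "V \<longlonglongrightarrow> z"
  shows "limitin T (\<lambda>n. J (incz j (V n))) (J (incz j z)) sequentially"
proof (rule J_lim[OF assms(1,2)])
  show "(\<lambda>n. snd (incz j (V n)) j') \<longlonglongrightarrow> snd (incz j z) j'" for j'
    using assms(3) by (cases "j' = j") (simp_all add: incz_def)
qed (simp add: incz_def)

lemma seq_closedD:
  "seq_closed_subgroup S \<Longrightarrow> (\<And>n. \<sigma> n \<in> S) \<Longrightarrow> limitin T \<sigma> x sequentially \<Longrightarrow> x \<in> S"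
  unfolding seq_closed_subgroup_def by metis

text \<open>\<open>null_commuting\<close> is used twice: for a fixed noncentral \<open>g\<close>,
  showing that almost every \<open>a\<close> fails to commute with \<open>g\<close> up to sign and
  thus acts noncentrally on the factor, and then for each such \<open>a\<close>.\<close>

lemma AE_not_bad:
  assumes i: "i < k" shows "AE a in \<mu>. AE b in \<mu>. (a, b) \<notin> bad i"
proof -
  define e where "e = min (\<rho>3 / 2) (1 / 2)"
  have e: "0 < e" "\<bar>e\<bar> < \<rho>3" "e < 1" using \<rho> by (auto simp: e_def)
  have iu: "imag_unit (\<i>, 0)" by (rule eT_props)
  define g where "g = rot i (\<i>, 0) e"
  have g: "g \<in> carrier G" unfolding g_def by (rule rot_closed[OF iu e(2)])
  have "acts g ((\<lambda>_. q1)(i := eT e))" unfolding g_def by (rule acts_rot[OF iu e(2)])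
  from acts_unique[OF g acts_Qf[OF g] this i] have "sign_eq (Qf g i) (eT e)" by simp
  moreover have "sin e \<noteq> 0" using sin_gt_zero[of e] e pi_gt3 by auto
  ultimately have "Qf g i \<noteq> q1" "Qf g i \<noteq> - q1"
    unfolding eT_props sign_eq_def by (auto simp: q1_def complex_eq_iff)
  from null_commuting[OF i g this] have "AE a in \<mu>. a \<notin> {b \<in> carrier G. (g, b) \<in> bad i}"
    by (rule AE_not_in)
  then show ?thesis
  proof (rule AE_mp, intro AE_I2[where P="\<lambda>a. a \<notin> {b \<in> carrier G. (g, b) \<in> bad i} \<longrightarrow> (AE b in \<mu>. (a, b) \<notin> bad i)"] impI)
    fix a assume "a \<in> space \<mu>" and nb: "a \<notin> {b \<in> carrier G. (g, b) \<in> bad i}"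
    then have a: "a \<in> carrier G" by (simp add: space_haar)
    have ns: "\<not> sign_eq (qm (Qf g i) (Qf a i)) (qm (Qf a i) (Qf g i))"
      using nb a bad_iff[OF g acts_Qf[OF g] a acts_Qf[OF a] i] by simp
    have "Qf a i \<noteq> q1" "Qf a i \<noteq> - q1"
      using ns by (auto simp: sign_eq_def qm_distrib)
    from null_commuting[OF i a this] have "AE b in \<mu>. b \<notin> {b \<in> carrier G. (a, b) \<in> bad i}" by (rule AE_not_in)
    then show "AE b in \<mu>. (a, b) \<notin> bad i"
      by (rule AE_mp) (auto intro!: AE_I2 simp: space_haar)
  qed
qed

text \<open>Each further power multiplies by \<open>\<gamma>\<close> after conjugating by
  \<open>a\<close>. The distance to \<open>q1\<close> grows by at most
  \<open>norm (\<gamma> - q1)\<close> per step, so the hypothesis on \<open>p\<close> keeps all the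
  iterates in the chart.\<close>

lemma pert_incq:
  assumes a: "a \<in> carrier G" "acts a Q" and \<gamma>: "norm \<gamma> = 1" "norm (\<gamma> - q1) < \<rho>3"
    and p: "real p * norm (\<gamma> - q1) < \<rho>3"
  shows "(J (incq i \<gamma>) \<otimes> a) [^] p \<otimes> inv (a [^] p) = J (incq i (((\<lambda>v. qm \<gamma> (qconj (Q i) v)) ^^ p) q1))"
proof -
  let ?v = "\<lambda>m. ((\<lambda>v. qm \<gamma> (qconj (Q i) v)) ^^ m) q1"
  let ?g = "J (incq i \<gamma>)"
  have Qn: "norm (Q i) = 1" using a by (simp add: acts_norm)
  have sg: "small \<rho>3 (incq i \<gamma>)" using \<gamma> \<rho> by (simp add: small_incq)
  have g: "?g \<in> carrier G" by (rule J_closed3[OF sg])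
  have "(?g \<otimes> a) [^] m \<otimes> inv (a [^] m) = J (incq i (?v m)) \<and> norm (?v m) = 1 \<and> norm (?v m - q1) \<le> real m * norm (\<gamma> - q1)"
    if "m \<le> p" for m
    using that
  proof (induction m)
    case 0
    then show ?case by (simp add: J_one)
  next
    case (Suc m)
    then have IH: "(?g \<otimes> a) [^] m \<otimes> inv (a [^] m) = J (incq i (?v m))" "norm (?v m) = 1"
      "norm (?v m - q1) \<le> real m * norm (\<gamma> - q1)" by auto
    have "real m * norm (\<gamma> - q1) \<le> real p * norm (\<gamma> - q1)" using Suc.prems by (intro mult_right_mono) auto
    then have sz: "norm (?v m - q1) < \<rho>3" using IH(3) p by linarith
    let ?u = "qconj (Q i) (?v m)"
    have u: "norm ?u = 1" "norm (?u - q1) = norm (?v m - q1)" using IH(2) by (auto simp: norm_qconj[OF Qn] norm_qconj_1[OF Qn])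
    have su: "small \<rho>3 (incq i ?u)" using u sz \<rho> by (simp add: small_incq)
    have nb: "norm (qm \<gamma> ?u - q1) \<le> norm (\<gamma> - q1) + norm (?v m - q1)" using norm_qm_1[OF u(1), of \<gamma>] u(2) by simp
    have sgu: "small \<rho> (incq i (qm \<gamma> ?u))"
      using \<gamma> u sz nb \<rho> by (simp add: small_incq norm_qm)
    have "(?g \<otimes> a) [^] Suc m \<otimes> inv (a [^] Suc m) = ?g \<otimes> (a \<otimes> ((?g \<otimes> a) [^] m \<otimes> inv (a [^] m)) \<otimes> inv a)"
    proof -
      have ga: "?g \<otimes> a \<in> carrier G" and ac: "a \<in> carrier G" using g a by auto
      show ?thesis unfolding nat_pow_Suc2[OF ga] nat_pow_Suc2[OF ac]
        using g ac by (simp add: inv_mult_group m_assoc)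
    qed
    also have "\<dots> = ?g \<otimes> J (incq i ?u)"
      unfolding IH(1) using acts_conj[OF a IH(2) sz] by simp
    also have "\<dots> = J (incq i (qm \<gamma> ?u))"
      using J_mult[OF small_mono[OF sg] small_mono[OF su], of] sgu \<rho> by simp
    finally have 1: "(?g \<otimes> a) [^] Suc m \<otimes> inv (a [^] Suc m) = J (incq i (?v (Suc m)))" by simp
    have "norm (?v (Suc m)) = 1" using \<gamma> u by (simp add: norm_qm)
    moreover have "norm (?v (Suc m) - q1) \<le> real (Suc m) * norm (\<gamma> - q1)"
      using nb IH(3) by (simp add: distrib_right)
    ultimately show ?case using 1 by blast
  qed
  then show ?thesis by simp
qed

text \<open>Elements of the local circle factors commute with every \<open>a\<close>, so the
  conjugations disappear and the perturbation does not depend on \<open>a\<close>.\<close>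

lemma pert_incz:
  assumes a: "a \<in> carrier G" and \<zeta>: "cmod \<zeta> = 1" "cmod (\<zeta> - 1) < \<rho>3"
    and p: "real p * cmod (\<zeta> - 1) < \<rho>3"
  shows "(J (incz j \<zeta>) \<otimes> a) [^] p \<otimes> inv (a [^] p) = J (incz j (\<zeta> ^ p))"
proof -
  let ?g = "J (incz j \<zeta>)"
  have Qn: "norm (Qf a i) = 1" for i using a by (rule Qf_norm)
  have sg: "small \<rho>3 (incz j \<zeta>)" using \<zeta> \<rho> by (simp add: small_incz)
  have g: "?g \<in> carrier G" by (rule J_closed3[OF sg])
  have "(?g \<otimes> a) [^] m \<otimes> inv (a [^] m) = J (incz j (\<zeta> ^ m)) \<and> cmod (\<zeta> ^ m - 1) \<le> real m * cmod (\<zeta> - 1)"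
    if "m \<le> p" for m
    using that
  proof (induction m)
    case 0
    then show ?case by (simp add: J_one)
  next
    case (Suc m)
    then have IH: "(?g \<otimes> a) [^] m \<otimes> inv (a [^] m) = J (incz j (\<zeta> ^ m))"
      "cmod (\<zeta> ^ m - 1) \<le> real m * cmod (\<zeta> - 1)" by auto
    have "real m * cmod (\<zeta> - 1) \<le> real p * cmod (\<zeta> - 1)" using Suc.prems by (intro mult_right_mono) auto
    then have sz: "cmod (\<zeta> ^ m - 1) < \<rho>3" using IH(2) p by linarith
    have u: "cmod (\<zeta> ^ m) = 1" using \<zeta> by (simp add: norm_power)
    have su: "small \<rho>3 (incz j (\<zeta> ^ m))" using u sz \<rho> by (simp add: small_incz)
    have Jc: "J (incz j (\<zeta> ^ m)) \<in> carrier G" by (rule J_closed3[OF su])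
    have "\<zeta> * \<zeta> ^ m - 1 = (\<zeta> - 1) * \<zeta> ^ m + (\<zeta> ^ m - 1)" by (simp add: algebra_simps)
    then have "cmod (\<zeta> * \<zeta> ^ m - 1) \<le> cmod ((\<zeta> - 1) * \<zeta> ^ m) + cmod (\<zeta> ^ m - 1)" by (metis norm_triangle_ineq)
    then have nb: "cmod (\<zeta> * \<zeta> ^ m - 1) \<le> cmod (\<zeta> - 1) + cmod (\<zeta> ^ m - 1)" using u by (simp add: norm_mult)
    have sgu: "small \<rho> (incz j (\<zeta> * \<zeta> ^ m))"
      using \<zeta> u sz nb \<rho> by (simp add: small_incz norm_mult)
    have ac: "a \<otimes> J (incz j (\<zeta> ^ m)) \<otimes> inv a = J (incz j (\<zeta> ^ m))"
      using actsD[OF acts_Qf[OF a] su] a Jc Qn by (simp add: m_assoc)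
    have "(?g \<otimes> a) [^] Suc m \<otimes> inv (a [^] Suc m) = ?g \<otimes> (a \<otimes> ((?g \<otimes> a) [^] m \<otimes> inv (a [^] m)) \<otimes> inv a)"
    proof -
      have ga: "?g \<otimes> a \<in> carrier G" and ac: "a \<in> carrier G" using g a by auto
      show ?thesis unfolding nat_pow_Suc2[OF ga] nat_pow_Suc2[OF ac]
        using g ac by (simp add: inv_mult_group m_assoc)
    qed
    also have "\<dots> = ?g \<otimes> J (incz j (\<zeta> ^ m))" unfolding IH(1) ac ..
    also have "\<dots> = J (incz j (\<zeta> * \<zeta> ^ m))"
      using J_mult[OF small_mono[OF sg] small_mono[OF su], of] sgu \<rho> by simp
    finally show ?case using nb IH(2) by (simp add: distrib_right)
  qed
  then show ?thesis by simp
qed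

text \<open>At \<open>p = 0\<close> the quotient is 0 by convention, so the sequence starts with the
  identity and stays in the chart for every \<open>p\<close>.\<close>

definition GQ :: "nat \<Rightarrow> complex \<times> complex \<Rightarrow> real \<Rightarrow> nat \<Rightarrow> 'a" where
  "GQ i Z s p = J (incq i (gam Z (s / real p)))"

definition GZ :: "nat \<Rightarrow> real \<Rightarrow> nat \<Rightarrow> 'a" where
  "GZ j s p = J (incz j (cis (s / real p)))"

text \<open>Rational \<open>s\<close> keep the family countable; the other parameters are recovered
  by closedness. The bound on \<open>s\<close> keeps all \<open>p\<close> steps of size
  \<open>s / p\<close> inside the chart.\<close>

definition GG :: "(nat \<Rightarrow> 'a) set" where
  "GG = (\<lambda>(i, Z, s). GQ i Z s) ` ({..<k} \<times> axes \<times> {s \<in> \<rat>. \<bar>s\<bar> < \<rho>3}) \<union>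
        (\<lambda>(j, s). GZ j s) ` ({..<l} \<times> {s \<in> \<rat>. \<bar>s\<bar> < \<rho>3})"

lemma countable_GG: "countable GG"
proof -
  have "countable {s \<in> \<rat>. \<bar>s\<bar> < \<rho>3}" by (rule countable_subset[OF _ countable_rat]) auto
  then show ?thesis unfolding GG_def axes_def by (intro countable_Un countable_image countable_SIGMA) auto
qed

lemma abs_divide_nat_le: "\<bar>s / real p\<bar> \<le> \<bar>s\<bar>" "real p * \<bar>s / real p\<bar> \<le> \<bar>s\<bar>"
  by (cases "p = 0"; simp add: abs_divide divide_le_eq mult_le_cancel_left1)+

lemma divide_nat_tendsto_0: "(\<lambda>p. s / real p) \<longlonglongrightarrow> 0"
  using tendsto_mult[OF tendsto_const[of s] LIMSEQ_inverse_real_of_nat[THEN LIMSEQ_imp_Suc]] by (simp add: divide_inverse)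

lemma GG_props:
  assumes "g \<in> GG" shows "g p \<in> carrier G" "limitin T g \<one> sequentially"
proof -
  from assms consider (q) i Z s where "g = GQ i Z s" "Z \<in> axes" "\<bar>s\<bar> < \<rho>3" | (z) j s where "g = GZ j s" "\<bar>s\<bar> < \<rho>3"
    unfolding GG_def by auto
  then have "(\<forall>p. g p \<in> carrier G) \<and> limitin T g \<one> sequentially"
  proof cases
    case q
    have iu: "imag_unit Z" using q imag_unit_axes by blast
    have s3: "small \<rho>3 (incq i (gam Z (s / real p)))" for p
      by (rule small_rot[OF iu]) (use q abs_divide_nat_le(1)[of s p] in linarith)
    have c: "(\<lambda>p. gam Z (s / real p)) \<longlonglongrightarrow> gam Z 0"
      unfolding gam_def by (intro tendsto_intros divide_nat_tendsto_0)
    have "limitin T (\<lambda>p. J (incq i (gam Z (s / real p)))) (J (incq i q1)) sequentially"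
    proof (rule incq_lim)
      show "small \<rho> (incq i (gam Z (s / real p)))" for p using small_mono[OF s3] \<rho> by simp
      show "small \<rho> (incq i q1)" using small_pone[OF \<rho>] by simp
    qed (use c in simp)
    then show ?thesis using q J_closed3[OF s3] by (simp add: GQ_def[abs_def] J_one)
  next
    case z
    have s3: "small \<rho>3 (incz j (cis (s / real p)))" for p
      using norm_cis_diff_1[of "s / real p"] abs_divide_nat_le(1)[of s p] z \<rho> by (subst small_incz) auto
    have c: "(\<lambda>p. cis (s / real p)) \<longlonglongrightarrow> cis 0"
      by (intro tendsto_intros divide_nat_tendsto_0)
    have "limitin T (\<lambda>p. J (incz j (cis (s / real p)))) (J (incz j 1)) sequentially"
    proof (rule incz_lim)
      show "small \<rho> (incz j (cis (s / real p)))" for p using small_mono[OF s3] \<rho> by simp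
      show "small \<rho> (incz j 1)" using small_pone[OF \<rho>] by simp
    qed (use c in simp)
    then show ?thesis using z J_closed3[OF s3] by (simp add: GZ_def[abs_def] J_one)
  qed
  then show "g p \<in> carrier G" "limitin T g \<one> sequentially" by auto
qed

lemma rational_approx:
  assumes "\<bar>t\<bar> < (c::real)" shows "\<exists>s. (\<forall>n. s n \<in> \<rat> \<and> \<bar>s n\<bar> < c) \<and> s \<longlonglongrightarrow> t"
proof -
  have "\<exists>q\<in>\<rat>. max (- c) (t - 1 / real (Suc n)) < q \<and> q < min c (t + 1 / real (Suc n))" for n
  proof (rule Rats_dense_in_real)
    have "0 < 1 / real (Suc n)" by simp
    then show "max (- c) (t - 1 / real (Suc n)) < min c (t + 1 / real (Suc n))"
      using assms unfolding max_less_iff_conj min_less_iff_conj abs_less_iff by (intro conjI; linarith)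
  qed
  then obtain s where s: "\<And>n. s n \<in> \<rat>" "\<And>n. max (- c) (t - 1 / real (Suc n)) < s n" "\<And>n. s n < min c (t + 1 / real (Suc n))"
    by metis
  have "(\<lambda>n. t - 1 / real (Suc n)) \<longlonglongrightarrow> t - 0" "(\<lambda>n. t + 1 / real (Suc n)) \<longlonglongrightarrow> t + 0"
    by (intro tendsto_intros LIMSEQ_Suc[OF lim_1_over_n])+
  then have "s \<longlonglongrightarrow> t"
    using s(2,3) by (intro tendsto_sandwich[of "\<lambda>n. t - 1 / real (Suc n)" s sequentially "\<lambda>n. t + 1 / real (Suc n)"])
      (auto intro!: always_eventually less_imp_le)
  moreover have "\<bar>s n\<bar> < c" for n using s(2)[of n] s(3)[of n] by auto
  ultimately show ?thesis using s(1) by blast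
qed

text \<open>The perturbations along an axis \<open>Z\<close> converge to the torus element of angle
  \<open>s * x\<close>, where \<open>x\<close> is the component of \<open>Z\<close> along the axis
  of the torus. An axis with nonzero \<open>x\<close> yields a dense set of small angles, and
  closedness gives the rest.\<close>

lemma torus_in_stab:
  assumes S: "seq_closed_subgroup S" and c: "c \<in> carrier G" and i: "i < k"
    and lim0: "\<forall>g\<in>GG. \<forall>w. limitin T (\<lambda>p. pert g p c) w sequentially \<longrightarrow> w \<in> S"
    and nc: "Qf c i \<noteq> q1" "Qf c i \<noteq> - q1"
  shows "\<exists>K d \<sigma>. norm K = 1 \<and> Qf c i = qconj K (d, 0) \<and> \<sigma> > 0 \<and> (\<forall>s. \<bar>s\<bar> \<le> \<sigma> \<longrightarrow> J (incq i (qconj K (eT s))) \<in> S)"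
proof -
  note lim = lim0[rule_format]
  obtain K d where K: "norm K = 1" and d: "cmod d = 1" "d\<^sup>2 \<noteq> 1" and Q: "Qf c i = qconj K (d, 0)"
    using diagonalize[OF Qf_norm[OF c] nc] by blast
  obtain Z where Z: "Z \<in> axes" "Im (fst (qconj (qc K) Z)) \<noteq> 0" using axis_component[OF K] by blast
  have iu: "imag_unit Z" using Z imag_unit_axes by blast
  define x where "x = Im (fst (qconj (qc K) Z))"
  have x0: "x \<noteq> 0" using Z by (simp add: x_def)
  have x1: "\<bar>x\<bar> \<le> 1"
  proof -
    have "norm (qconj (qc K) Z) = 1" using K iu by (simp add: norm_qconj imag_unit_def)
    then show ?thesis using abs_Im_le_cmod[of "fst (qconj (qc K) Z)"] norm_component_le(1)[of "qconj (qc K) Z"] by (simp add: x_def)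
  qed
  have iue: "imag_unit (\<i>, 0)" by (rule eT_props)
  have sK: "small r (incq i (qconj K (eT s)))" if "\<bar>s\<bar> < r" for s r
    using that norm_gam_1[OF iue, of s] norm_gam[OF iue, of s]
    by (subst small_incq) (auto simp: norm_qconj[OF K] norm_qconj_1[OF K])
  have rat: "J (incq i (qconj K (eT (s * x)))) \<in> S" if s: "s \<in> \<rat>" "\<bar>s\<bar> < \<rho>3" for s
  proof (rule lim)
    show "GQ i Z s \<in> GG" unfolding GG_def using i Z s by (intro UnI1 image_eqI[of _ _ "(i, Z, s)"]) auto
    let ?v = "\<lambda>p. ((\<lambda>v. qm (gam Z (s / real p)) (qconj (Qf c i) v)) ^^ p) q1"
    have sz: "norm (gam Z (s / real p) - q1) < \<rho>3" "real p * norm (gam Z (s / real p) - q1) < \<rho>3" for p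
    proof -
      have n: "norm (gam Z (s / real p) - q1) \<le> \<bar>s / real p\<bar>" by (rule norm_gam_1[OF iu])
      then show "norm (gam Z (s / real p) - q1) < \<rho>3" using abs_divide_nat_le(1)[of s p] s by linarith
      have "real p * norm (gam Z (s / real p) - q1) \<le> real p * \<bar>s / real p\<bar>" using n by (intro mult_left_mono) auto
      then show "real p * norm (gam Z (s / real p) - q1) < \<rho>3" using abs_divide_nat_le(2)[of p s] s by linarith
    qed
    have pe: "pert (GQ i Z s) p c = J (incq i (?v p))" for p
      unfolding pert_def GQ_def by (rule pert_incq[OF c acts_Qf[OF c] norm_gam[OF iu] sz])
    have vn: "norm (?v p) = 1 \<and> norm (?v p - q1) < \<rho>3" for p
    proof -
      have "norm (((\<lambda>v. qm (gam Z h) (qconj (Qf c i) v)) ^^ m) q1) = 1 \<and>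
          norm (((\<lambda>v. qm (gam Z h) (qconj (Qf c i) v)) ^^ m) q1 - q1) \<le> real m * norm (gam Z h - q1)" for m h
      proof (induction m)
        case (Suc m)
        let ?w = "((\<lambda>v. qm (gam Z h) (qconj (Qf c i) v)) ^^ m) q1"
        have "norm (qconj (Qf c i) ?w) = 1" "norm (qconj (Qf c i) ?w - q1) = norm (?w - q1)"
          using Suc by (auto simp: norm_qconj[OF Qf_norm[OF c]] norm_qconj_1[OF Qf_norm[OF c]])
        with norm_qm_1[OF this(1), of "gam Z h"] Suc norm_gam[OF iu] show ?case
          by (simp add: norm_qm distrib_right)
      qed simp
      from this[of p "s / real p"] sz(2)[of p] show ?thesis by linarith
    qed
    have lv: "?v \<longlonglongrightarrow> qconj K (eT (s * x))" unfolding x_def by (rule conj_power_tendsto[OF K d Q iu])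
    have sx: "\<bar>s * x\<bar> < \<rho>"
    proof -
      have "\<bar>s * x\<bar> \<le> \<bar>s\<bar> * 1" unfolding abs_mult using x1 by (intro mult_left_mono) auto
      then show ?thesis using s \<rho> by linarith
    qed
    show "limitin T (\<lambda>p. pert (GQ i Z s) p c) (J (incq i (qconj K (eT (s * x))))) sequentially"
      unfolding pe
    proof (rule incq_lim[OF _ sK[OF sx] lv])
      show "small \<rho> (incq i (?v p))" for p using vn[of p] \<rho> by (subst small_incq) auto
    qed
  qed
  \<comment> \<open>An angle \<open>s\<close> of the torus needs the parameter \<open>s / x\<close>,
    which must be smaller than \<open>\<rho>3\<close>.\<close>
  define \<sigma> where "\<sigma> = \<bar>x\<bar> * \<rho>3 / 2"
  have \<sigma>: "\<sigma> > 0" using x0 \<rho> by (simp add: \<sigma>_def)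
  have "J (incq i (qconj K (eT s))) \<in> S" if s: "\<bar>s\<bar> \<le> \<sigma>" for s
  proof -
    have "\<bar>s / x\<bar> \<le> \<rho>3 / 2" using s x0 by (simp add: \<sigma>_def abs_divide divide_le_eq mult.commute)
    then have "\<bar>s / x\<bar> < \<rho>3" using \<rho> by linarith
    from rational_approx[OF this] obtain t where t: "\<And>n. t n \<in> \<rat>" "\<And>n. \<bar>t n\<bar> < \<rho>3" "t \<longlonglongrightarrow> s / x" by blast
    have tx: "(\<lambda>n. t n * x) \<longlonglongrightarrow> s" using tendsto_mult[OF t(3) tendsto_const[of x]] x0 by simp
    have "\<bar>t n * x\<bar> < \<rho>" for n
    proof -
      have "\<bar>t n * x\<bar> \<le> \<bar>t n\<bar> * 1" unfolding abs_mult using x1 by (intro mult_left_mono) auto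
      then show ?thesis using t(2)[of n] \<rho> by linarith
    qed
    moreover have "\<bar>s\<bar> < \<rho>"
    proof -
      have "\<bar>x\<bar> * \<rho>3 \<le> 1 * \<rho>3" using x1 \<rho> by (intro mult_right_mono) auto
      then show ?thesis using s \<rho> unfolding \<sigma>_def by linarith
    qed
    moreover have "(\<lambda>n. qconj K (eT (t n * x))) \<longlonglongrightarrow> qconj K (eT s)"
      unfolding qconj_def qm_def qc_def gam_def by (intro tendsto_intros tx)
    ultimately have "limitin T (\<lambda>n. J (incq i (qconj K (eT (t n * x))))) (J (incq i (qconj K (eT s)))) sequentially"
      by (intro incq_lim sK)
    moreover have "J (incq i (qconj K (eT (t n * x)))) \<in> S" for n using rat t by simp
    ultimately show ?thesis by (rule seq_closedD[OF S, rotated])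
  qed
  with K Q \<sigma> show ?thesis by blast
qed

lemma circle_in_stab:
  assumes S: "seq_closed_subgroup S" and c: "c \<in> carrier G" and j: "j < l"
    and lim0: "\<forall>g\<in>GG. \<forall>w. limitin T (\<lambda>p. pert g p c) w sequentially \<longrightarrow> w \<in> S"
  shows "\<exists>\<eta>>0. \<forall>z. cmod z = 1 \<longrightarrow> cmod (z - 1) < \<eta> \<longrightarrow> J (incz j z) \<in> S"
proof -
  note lim = lim0[rule_format]
  have sz: "small r (incz j (cis s))" if "\<bar>s\<bar> < r" for s r
    using that norm_cis_diff_1[of s] by (subst small_incz) auto
  have rat: "J (incz j (cis s)) \<in> S" if s: "s \<in> \<rat>" "\<bar>s\<bar> < \<rho>3" for s
  proof (rule lim)
    show "GZ j s \<in> GG" unfolding GG_def using j s by (intro UnI2 image_eqI[of _ _ "(j, s)"]) auto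
    have pe: "pert (GZ j s) p c = J (incz j (cis s))" if p: "p > 0" for p
    proof -
      have n: "cmod (cis (s / real p) - 1) \<le> \<bar>s / real p\<bar>" by (rule norm_cis_diff_1)
      have 1: "cmod (cis (s / real p) - 1) < \<rho>3" using n abs_divide_nat_le(1)[of s p] s by linarith
      have "real p * cmod (cis (s / real p) - 1) \<le> real p * \<bar>s / real p\<bar>" using n by (intro mult_left_mono) auto
      then have 2: "real p * cmod (cis (s / real p) - 1) < \<rho>3" using abs_divide_nat_le(2)[of p s] s by linarith
      have "cis (s / real p) ^ p = cis s" using p by (simp add: Complex.DeMoivre)
      then show ?thesis unfolding pert_def GZ_def using pert_incz[OF c _ 1 2, of j] by simp
    qed
    show "limitin T (\<lambda>p. pert (GZ j s) p c) (J (incz j (cis s))) sequentially"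
    proof (rule limitin_transform_eventually)
      show "\<forall>\<^sub>F p in sequentially. J (incz j (cis s)) = pert (GZ j s) p c"
        using pe by (intro eventually_sequentiallyI[of 1]) simp
      show "limitin T (\<lambda>p. J (incz j (cis s))) (J (incz j (cis s))) sequentially"
        using J_closed3[OF sz[OF s(2)]] by (simp add: topspace_eq)
    qed
  qed
  have real: "J (incz j (cis s)) \<in> S" if s: "\<bar>s\<bar> < \<rho>3" for s
  proof -
    from rational_approx[OF s] obtain t where t: "\<And>n. t n \<in> \<rat>" "\<And>n. \<bar>t n\<bar> < \<rho>3" "t \<longlonglongrightarrow> s" by blast
    have "(\<lambda>n. cis (t n)) \<longlonglongrightarrow> cis s" by (intro tendsto_intros t)
    moreover have "\<bar>t n\<bar> < \<rho>" "\<bar>s\<bar> < \<rho>" for n using t(2)[of n] s \<rho> by auto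
    ultimately have "limitin T (\<lambda>n. J (incz j (cis (t n)))) (J (incz j (cis s))) sequentially"
      by (intro incz_lim sz)
    moreover have "J (incz j (cis (t n))) \<in> S" for n using rat t by simp
    ultimately show ?thesis by (rule seq_closedD[OF S, rotated])
  qed
  obtain \<epsilon> where \<epsilon>: "\<epsilon> > 0" "\<And>u. cmod u = 1 \<Longrightarrow> cmod (u - 1) < \<epsilon> \<Longrightarrow> \<exists>\<theta>. \<bar>\<theta>\<bar> \<le> \<rho>3 / 2 \<and> u = cis \<theta>"
    using small_angle[of "\<rho>3 / 2"] \<rho> by auto
  have "J (incz j z) \<in> S" if zz: "cmod z = 1" "cmod (z - 1) < \<epsilon>" for z
  proof -
    obtain \<theta> where "\<bar>\<theta>\<bar> \<le> \<rho>3 / 2" "z = cis \<theta>" using \<epsilon>(2)[OF zz] by blast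
    then show ?thesis using real[of \<theta>] \<rho> by simp
  qed
  with \<epsilon>(1) show ?thesis by blast
qed

text \<open>In each quaternion factor the tori of \<open>a\<close> and \<open>b\<close> differ
  because the pair is not bad, so they generate a neighbourhood of 1; with the circles,
  \<open>S\<close> contains a neighbourhood of the identity, and connectedness finishes.\<close>

theorem stab_full:
  assumes S: "seq_closed_subgroup S" and a: "a \<in> carrier G" and b: "b \<in> carrier G"
    and good: "\<And>i. i < k \<Longrightarrow> (a, b) \<notin> bad i"
    and lim: "\<And>g c w. g \<in> GG \<Longrightarrow> c \<in> {a, b} \<Longrightarrow> limitin T (\<lambda>p. pert g p c) w sequentially \<Longrightarrow> w \<in> S"
  shows "S = carrier G"
proof -
  have sub: "subgroup S G" using S by (simp add: seq_closed_subgroup_def)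
  have lim_a: "\<forall>g\<in>GG. \<forall>w. limitin T (\<lambda>p. pert g p a) w sequentially \<longrightarrow> w \<in> S"
    and lim_b: "\<forall>g\<in>GG. \<forall>w. limitin T (\<lambda>p. pert g p b) w sequentially \<longrightarrow> w \<in> S"
    using lim by auto
  have q: "\<exists>\<eta>>0. \<forall>q. norm q = 1 \<longrightarrow> norm (q - q1) < \<eta> \<longrightarrow> J (incq i q) \<in> S" if i: "i < k" for i
  proof -
    have ns: "\<not> sign_eq (qm (Qf a i) (Qf b i)) (qm (Qf b i) (Qf a i))"
      using good[OF i] bad_iff[OF a acts_Qf[OF a] b acts_Qf[OF b] i] by simp
    have nc: "Qf a i \<noteq> q1" "Qf a i \<noteq> - q1" "Qf b i \<noteq> q1" "Qf b i \<noteq> - q1"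
      using ns by (auto simp: sign_eq_def qm_distrib)
    obtain K d \<sigma> where K: "norm K = 1" "Qf a i = qconj K (d, 0)" "\<sigma> > 0" "\<forall>s. \<bar>s\<bar> \<le> \<sigma> \<longrightarrow> J (incq i (qconj K (eT s))) \<in> S"
      using torus_in_stab[OF S a i lim_a nc(1,2)] by blast
    obtain L d' \<sigma>' where L: "norm L = 1" "Qf b i = qconj L (d', 0)" "\<sigma>' > 0" "\<forall>s. \<bar>s\<bar> \<le> \<sigma>' \<longrightarrow> J (incq i (qconj L (eT s))) \<in> S"
      using torus_in_stab[OF S b i lim_b nc(3,4)] by blast
    have R: "fst (qm (qc K) L) \<noteq> 0" "snd (qm (qc K) L) \<noteq> 0"
      using same_torus_commute[OF K(1) L(1), of d d'] ns K(2) L(2) by auto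
    have "\<exists>\<eta>>0. \<forall>q. norm q = 1 \<longrightarrow> norm (q - q1) < \<eta> \<longrightarrow> q \<in> {q. J (incq i q) \<in> S}"
    proof (rule two_tori_generate[OF \<rho> _ _ K(1) L(1) _ _ R])
      show "min \<sigma> \<sigma>' > 0" using K L by simp
      fix p q assume pq: "p \<in> {q. J (incq i q) \<in> S}" "q \<in> {q. J (incq i q) \<in> S}" "norm p = 1" "norm q = 1"
        "norm (p - q1) < \<rho>" "norm (q - q1) < \<rho>" "norm (qm p q - q1) < \<rho>"
      have "J (incq i (qm p q)) = J (incq i p) \<otimes> J (incq i q)"
        using J_mult[of "incq i p" "incq i q"] pq \<rho> by (simp add: small_incq norm_qm)
      then show "qm p q \<in> {q. J (incq i q) \<in> S}" using pq subgroup.m_closed[OF sub] by simp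
    qed (use K L in auto)
    then show ?thesis by simp
  qed
  have z: "\<exists>\<eta>>0. \<forall>z. cmod z = 1 \<longrightarrow> cmod (z - 1) < \<eta> \<longrightarrow> J (incz j z) \<in> S" if j: "j < l" for j
    by (rule circle_in_stab[OF S a j lim_a])
  obtain \<eta>q where \<eta>q: "\<And>i. i < k \<Longrightarrow> \<eta>q i > 0" "\<And>i q. i < k \<Longrightarrow> norm q = 1 \<Longrightarrow> norm (q - q1) < \<eta>q i \<Longrightarrow> J (incq i q) \<in> S"
    using q by metis
  obtain \<eta>z where \<eta>z: "\<And>j. j < l \<Longrightarrow> \<eta>z j > 0" "\<And>j z. j < l \<Longrightarrow> cmod z = 1 \<Longrightarrow> cmod (z - 1) < \<eta>z j \<Longrightarrow> J (incz j z) \<in> S"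
    using z by metis
  define \<eta> where "\<eta> = Min (insert \<rho> (\<eta>q ` {..<k} \<union> \<eta>z ` {..<l}))"
  have \<eta>: "\<eta> > 0" "\<eta> \<le> \<rho>" "\<And>i. i < k \<Longrightarrow> \<eta> \<le> \<eta>q i" "\<And>j. j < l \<Longrightarrow> \<eta> \<le> \<eta>z j"
    unfolding \<eta>_def using \<eta>q(1) \<eta>z(1) \<rho> by (auto intro!: Min_le)
  have JS: "J v \<in> S" if v: "small \<eta> v" for v
  proof -
    have v\<rho>: "small \<rho> v" using small_mono[OF v \<eta>(2)] .
    \<comment> \<open>A small parameter is assembled from single-factor ones; all partial products
      remain small, as required by \<open>J_mult\<close>.\<close>
    define vq where "vq m = ((\<lambda>i. if i < m then fst v i else q1), (\<lambda>_::nat. 1 :: complex))" for m :: nat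
    have svq: "small \<rho> (vq m)" for m using v\<rho> \<rho> by (auto simp: small_def vq_def)
    have sq: "small \<rho> (incq i (fst v i))" for i unfolding small_incq[OF \<rho>] using v\<rho> by (simp add: small_def)
    have Sq: "m \<le> k \<Longrightarrow> J (vq m) \<in> S" for m
    proof (induction m)
      case 0
      have "vq 0 = pone" by (simp add: vq_def pone_def)
      then show ?case using subgroup.one_closed[OF sub] by (simp add: J_one)
    next
      case (Suc m)
      have e: "pmul (vq m) (incq m (fst v m)) = vq (Suc m)" by (auto simp: pmul_def vq_def incq_def fun_eq_iff prod_eq_iff less_Suc_eq)
      have "J (incq m (fst v m)) \<in> S"
        using \<eta>q(2)[of m "fst v m"] Suc.prems v \<eta>(3)[of m] by (auto simp: small_def intro: less_le_trans)
      then have "J (vq m) \<otimes> J (incq m (fst v m)) \<in> S" using Suc by (intro subgroup.m_closed[OF sub]) auto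
      then show ?case using J_mult[OF svq[of m] sq[of m], unfolded e, OF svq] by simp
    qed
    define vz where "vz m = (fst (vq k), (\<lambda>j. if j < m then snd v j else 1 :: complex))" for m :: nat
    have svz: "small \<rho> (vz m)" for m using v\<rho> svq \<rho> by (auto simp: small_def vz_def)
    have sz: "small \<rho> (incz j (snd v j))" for j unfolding small_incz[OF \<rho>] using v\<rho> by (simp add: small_def)
    have Sz: "m \<le> l \<Longrightarrow> J (vz m) \<in> S" for m
    proof (induction m)
      case 0
      have "vz 0 = vq k" by (simp add: vz_def vq_def)
      then show ?case using Sq[of k] by simp
    next
      case (Suc m)
      have e: "pmul (vz m) (incz m (snd v m)) = vz (Suc m)" by (auto simp: pmul_def vz_def incz_def fun_eq_iff prod_eq_iff less_Suc_eq)
      have "J (incz m (snd v m)) \<in> S"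
        using \<eta>z(2)[of m "snd v m"] Suc.prems v \<eta>(4)[of m] by (auto simp: small_def intro: less_le_trans)
      then have "J (vz m) \<otimes> J (incz m (snd v m)) \<in> S" using Suc by (intro subgroup.m_closed[OF sub]) auto
      then show ?case using J_mult[OF svz[of m] sz[of m], unfolded e, OF svz] by simp
    qed
    have "J v = J (vz l)" by (rule J_cong) (auto simp: vz_def vq_def)
    then show ?thesis using Sz[of l] by simp
  qed
  obtain U where "openin T U" "\<one> \<in> U" "U \<subseteq> J ` {v. small \<eta> v}" using J_open[OF \<eta>(1,2)] by blast
  then show ?thesis using open_subgroup_full[OF sub] JS by blast
qed

end

section \<open>The local isomorphism as a chart\<close>

definition qmat :: "complex \<times> complex \<Rightarrow> complex^2^2" where
  "qmat p = (\<chi> i j. if i = 1 then (if j = 1 then fst p else - cnj (snd p)) else (if j = 1 then snd p else cnj (fst p)))"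

definition colq :: "complex^2^2 \<Rightarrow> complex \<times> complex" where
  "colq A = (A $ 1 $ 1, A $ 2 $ 1)"

lemma colq_qmat [simp]: "colq (qmat p) = p"
  by (simp add: colq_def qmat_def prod_eq_iff)

lemma qmat_mult: "qmat p ** qmat q = qmat (qm p q)"
  by (simp add: vec_eq_iff forall_2 matrix_matrix_mult_def sum_2 qmat_def qm_def algebra_simps)

lemma qmat_1: "qmat q1 = mat 1"
  by (simp add: vec_eq_iff forall_2 qmat_def mat_def)

lemma qmat_SU2: assumes "norm p = 1" shows "qmat p \<in> carrier SU2"
proof -
  have n: "fst p * cnj (fst p) + snd p * cnj (snd p) = 1"
    using norm_quat[of p] assms complex_norm_square[of "fst p"] complex_norm_square[of "snd p"]
    by (metis of_real_1 of_real_add one_power2)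
  have "conj_transpose (qmat p) = qmat (qc p)"
    by (simp add: vec_eq_iff forall_2 conj_transpose_def qmat_def qc_def)
  then have "qmat p ** conj_transpose (qmat p) = mat 1"
    using assms by (simp add: qmat_mult qc_cancel qmat_1)
  moreover have "det (qmat p) = 1" using n by (simp add: det_2 qmat_def mult.commute)
  ultimately show ?thesis by (simp add: SU2_def)
qed

lemma SU2_qmat:
  assumes "A \<in> carrier SU2" shows "qmat (colq A) = A" "norm (colq A) = 1"
proof -
  define a b c d where "a = A $ 1 $ 1" and "b = A $ 1 $ 2" and "c = A $ 2 $ 1" and "d = A $ 2 $ 2"
  have AA: "A ** conj_transpose A = mat 1" and dt: "det A = 1" using assms by (auto simp: SU2_def)
  have e: "a * cnj a + b * cnj b = 1" "c * cnj a + d * cnj b = 0" "c * cnj c + d * cnj d = 1"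
    using AA by (simp_all add: vec_eq_iff forall_2 matrix_matrix_mult_def sum_2 conj_transpose_def mat_def a_def b_def c_def d_def)
  have dd: "a * d - b * c = 1" using dt by (simp add: det_2 a_def b_def c_def d_def)
  \<comment> \<open>Inserting the unit length of the first row allows regrouping into the
    determinant and the orthogonality of the rows.\<close>
  have "d = d * (a * cnj a + b * cnj b)" using e by simp
  also have "\<dots> = cnj a * (a * d - b * c) + b * (c * cnj a + d * cnj b)" by (simp add: algebra_simps)
  also have "\<dots> = cnj a" using e dd by simp
  finally have d: "d = cnj a" .
  have "c = c * (a * cnj a + b * cnj b)" using e by simp
  also have "\<dots> = a * (c * cnj a + d * cnj b) - cnj b * (a * d - b * c)" by (simp add: algebra_simps)
  also have "\<dots> = - cnj b" using e dd by simp
  finally have c: "c = - cnj b" .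
  show "qmat (colq A) = A"
    using c d by (simp add: vec_eq_iff forall_2 qmat_def colq_def a_def b_def c_def d_def)
  have "complex_of_real ((norm (colq A))\<^sup>2) = a * cnj a + b * cnj b"
    unfolding norm_quat using c by (simp add: colq_def complex_norm_square mult.commute a_def b_def c_def flip: of_real_power)
  then have "(norm (colq A))\<^sup>2 = 1" using e by (metis of_real_eq_1_iff)
  then show "norm (colq A) = 1" by (simp add: abs_square_eq_1)
qed

lemma continuous_qmat: "continuous_on UNIV qmat"
  unfolding qmat_def
proof (intro continuous_on_vec_lambda)
  fix i j :: 2
  show "continuous_on UNIV (\<lambda>p. if i = 1 then (if j = 1 then fst p else - cnj (snd p)) else (if j = 1 then snd p else cnj (fst p)))"
    by (cases "i = 1"; cases "j = 1") (auto intro!: continuous_intros)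
qed

lemma continuous_colq: "continuous_on UNIV colq"
  unfolding colq_def by (intro continuous_intros)

definition emb :: "nat \<Rightarrow> nat \<Rightarrow> param \<Rightarrow> (nat \<Rightarrow> complex^2^2) \<times> (nat \<Rightarrow> complex)" where
  "emb k l v = (\<lambda>i\<in>{..<k}. qmat (fst v i), \<lambda>j\<in>{..<l}. snd v j)"

lemma emb_pmul: "emb k l v \<otimes>\<^bsub>SU2_U1_product k l\<^esub> emb k l w = emb k l (pmul v w)"
  by (auto simp: SU2_U1_product_def emb_def mult_DirProd product_group_def SU2_def U1_def qmat_mult pmul_def fun_eq_iff)

lemma emb_pone: "emb k l pone = \<one>\<^bsub>SU2_U1_product k l\<^esub>"
  by (simp add: SU2_U1_product_def emb_def product_group_def SU2_def U1_def qmat_1 pone_def)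

lemma topspace_SU2_U1: "topspace (SU2_U1_topology k l) = (\<Pi>\<^sub>E i\<in>{..<k}. carrier SU2) \<times> (\<Pi>\<^sub>E i\<in>{..<l}. carrier U1)"
  by (simp add: SU2_U1_topology_def)

lemma emb_topspace: "small r v \<Longrightarrow> emb k l v \<in> topspace (SU2_U1_topology k l)"
  by (auto simp: topspace_SU2_U1 emb_def small_def qmat_SU2 U1_def)

lemma emb_nbhd:
  assumes W: "openin (SU2_U1_topology k l) W" and one: "\<one>\<^bsub>SU2_U1_product k l\<^esub> \<in> W"
  shows "\<exists>r>0. \<forall>v. small r v \<longrightarrow> emb k l v \<in> W"
proof -
  have e1: "emb k l pone \<in> W" using one by (simp add: emb_pone)
  obtain A B where AB: "openin (product_topology (\<lambda>_. top_of_set (carrier SU2)) {..<k}) A"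
    "openin (product_topology (\<lambda>_. top_of_set (carrier U1)) {..<l}) B"
    "fst (emb k l pone) \<in> A" "snd (emb k l pone) \<in> B" "A \<times> B \<subseteq> W"
    using openin_prod_topology_alt[THEN iffD1, OF W[unfolded SU2_U1_topology_def], rule_format, of "fst (emb k l pone)" "snd (emb k l pone)"] e1
    by auto
  obtain P where P: "\<And>i. i \<in> {..<k} \<Longrightarrow> openin (top_of_set (carrier SU2)) (P i)" "fst (emb k l pone) \<in> Pi\<^sub>E {..<k} P" "Pi\<^sub>E {..<k} P \<subseteq> A"
    using openin_product_topology_alt[THEN iffD1, OF AB(1), rule_format, OF AB(3)] by auto
  obtain R where R: "\<And>i. i \<in> {..<l} \<Longrightarrow> openin (top_of_set (carrier U1)) (R i)" "snd (emb k l pone) \<in> Pi\<^sub>E {..<l} R" "Pi\<^sub>E {..<l} R \<subseteq> B"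
    using openin_product_topology_alt[THEN iffD1, OF AB(2), rule_format, OF AB(4)] by auto
  have "\<exists>r>0. \<forall>q. norm q = 1 \<longrightarrow> norm (q - q1) < r \<longrightarrow> qmat q \<in> P i" if i: "i < k" for i
  proof -
    obtain Oi where O: "open Oi" "P i = carrier SU2 \<inter> Oi" using P(1)[of i] i by (auto simp: openin_open)
    have "open (qmat -` Oi)" using continuous_qmat O(1) by (simp add: continuous_on_open_vimage)
    moreover have "q1 \<in> qmat -` Oi" using P(2) i O(2) by (auto simp: emb_def pone_def PiE_iff)
    ultimately obtain r where r: "r > 0" "ball q1 r \<subseteq> qmat -` Oi" using open_contains_ball by blast
    have "qmat q \<in> P i" if "norm q = 1" "norm (q - q1) < r" for q
      using that r(2) qmat_SU2 O(2) by (auto simp: dist_norm norm_minus_commute subset_iff)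
    with r(1) show ?thesis by blast
  qed
  then obtain rq where rq: "\<And>i. i < k \<Longrightarrow> rq i > 0" "\<And>i q. i < k \<Longrightarrow> norm q = 1 \<Longrightarrow> norm (q - q1) < rq i \<Longrightarrow> qmat q \<in> P i"
    by metis
  have "\<exists>r>0. \<forall>z. cmod z = 1 \<longrightarrow> cmod (z - 1) < r \<longrightarrow> z \<in> R i" if i: "i < l" for i
  proof -
    obtain Oi where O: "open Oi" "R i = carrier U1 \<inter> Oi" using R(1)[of i] i by (auto simp: openin_open)
    have "1 \<in> Oi" using R(2) i O(2) by (auto simp: emb_def pone_def PiE_iff)
    then obtain r where r: "r > 0" "ball 1 r \<subseteq> Oi" using O(1) open_contains_ball by blast
    have "z \<in> R i" if "cmod z = 1" "cmod (z - 1) < r" for z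
      using that r(2) O(2) by (auto simp: dist_norm norm_minus_commute subset_iff U1_def)
    with r(1) show ?thesis by blast
  qed
  then obtain rz where rz: "\<And>i. i < l \<Longrightarrow> rz i > 0" "\<And>i z. i < l \<Longrightarrow> cmod z = 1 \<Longrightarrow> cmod (z - 1) < rz i \<Longrightarrow> z \<in> R i"
    by metis
  define r where "r = Min (insert 1 (rq ` {..<k} \<union> rz ` {..<l}))"
  have r: "r > 0" "\<And>i. i < k \<Longrightarrow> r \<le> rq i" "\<And>j. j < l \<Longrightarrow> r \<le> rz j"
    unfolding r_def using rq(1) rz(1) by (auto intro!: Min_le)
  have "emb k l v \<in> W" if v: "small r v" for v
  proof -
    have "qmat (fst v i) \<in> P i" if i: "i < k" for i
      by (rule rq(2)[OF i]) (use v r(2)[OF i] in \<open>auto simp: small_def intro: less_le_trans\<close>)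
    then have "fst (emb k l v) \<in> Pi\<^sub>E {..<k} P" by (auto simp: emb_def)
    moreover have "snd v j \<in> R j" if j: "j < l" for j
      by (rule rz(2)[OF j]) (use v r(3)[OF j] in \<open>auto simp: small_def intro: less_le_trans\<close>)
    then have "snd (emb k l v) \<in> Pi\<^sub>E {..<l} R" by (auto simp: emb_def)
    ultimately have "(fst (emb k l v), snd (emb k l v)) \<in> W" using P(3) R(3) AB(5) by blast
    then show ?thesis by simp
  qed
  with r(1) show ?thesis by blast
qed

lemma emb_limit:
  assumes "\<And>n. small r (V n)" "small r v" "\<And>i. (\<lambda>n. fst (V n) i) \<longlonglongrightarrow> fst v i" "\<And>j. (\<lambda>n. snd (V n) j) \<longlonglongrightarrow> snd v j"
  shows "limitin (SU2_U1_topology k l) (\<lambda>n. emb k l (V n)) (emb k l v) sequentially"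
  unfolding SU2_U1_topology_def limitin_pairwise limitin_componentwise o_def
proof (intro conjI ballI)
  note e = emb_topspace[OF assms(1), of k l] emb_topspace[OF assms(2), of k l]
  show "fst (emb k l v) \<in> extensional {..<k}" "snd (emb k l v) \<in> extensional {..<l}" by (auto simp: emb_def)
  show "\<forall>\<^sub>F n in sequentially. fst (emb k l (V n)) \<in> topspace (product_topology (\<lambda>_. top_of_set (carrier SU2)) {..<k})"
    "\<forall>\<^sub>F n in sequentially. snd (emb k l (V n)) \<in> topspace (product_topology (\<lambda>_. top_of_set (carrier U1)) {..<l})"
    using e(1) by (auto simp: SU2_U1_topology_def mem_Times_iff)
  show "limitin (top_of_set (carrier SU2)) (\<lambda>n. fst (emb k l (V n)) i) (fst (emb k l v) i) sequentially" if "i \<in> {..<k}" for i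
    unfolding limitin_subtopology limitin_canonical_iff
  proof (intro conjI)
    show "fst (emb k l v) i \<in> carrier SU2" using that assms(2) by (auto simp: emb_def small_def qmat_SU2)
    show "\<forall>\<^sub>F n in sequentially. fst (emb k l (V n)) i \<in> carrier SU2" using that assms(1) by (auto simp: emb_def small_def qmat_SU2)
    show "(\<lambda>n. fst (emb k l (V n)) i) \<longlonglongrightarrow> fst (emb k l v) i"
      using that continuous_on_tendsto_compose[OF continuous_qmat assms(3)[of i]] by (simp add: emb_def)
  qed
  show "limitin (top_of_set (carrier U1)) (\<lambda>n. snd (emb k l (V n)) j) (snd (emb k l v) j) sequentially" if "j \<in> {..<l}" for j
    unfolding limitin_subtopology limitin_canonical_iff
  proof (intro conjI)
    show "snd (emb k l v) j \<in> carrier U1" using that assms(2) by (auto simp: emb_def small_def U1_def)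
    show "\<forall>\<^sub>F n in sequentially. snd (emb k l (V n)) j \<in> carrier U1" using that assms(1) by (auto simp: emb_def small_def U1_def)
    show "(\<lambda>n. snd (emb k l (V n)) j) \<longlonglongrightarrow> snd (emb k l v) j"
      using that assms(4)[of j] by (simp add: emb_def)
  qed
qed

lemma open_small_box:
  fixes k l :: nat
  assumes \<eta>: "\<eta> > 0"
  defines "N \<equiv> (\<Pi>\<^sub>E i\<in>{..<k}. {A \<in> carrier SU2. norm (colq A - q1) < \<eta>}) \<times> (\<Pi>\<^sub>E j\<in>{..<l}. {z \<in> carrier U1. cmod (z - 1) < \<eta>})"
  shows "openin (SU2_U1_topology k l) N" "\<one>\<^bsub>SU2_U1_product k l\<^esub> \<in> N" "N \<subseteq> emb k l ` {v. small \<eta> v}"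
proof -
  have "open (colq -` ball q1 \<eta>)" using continuous_colq by (simp add: continuous_on_open_vimage)
  moreover have "{A \<in> carrier SU2. norm (colq A - q1) < \<eta>} = carrier SU2 \<inter> colq -` ball q1 \<eta>"
    by (auto simp: dist_norm norm_minus_commute)
  ultimately have 1: "openin (top_of_set (carrier SU2)) {A \<in> carrier SU2. norm (colq A - q1) < \<eta>}"
    by (metis openin_open_Int)
  have "{z \<in> carrier U1. cmod (z - 1) < \<eta>} = carrier U1 \<inter> ball 1 \<eta>"
    by (auto simp: dist_norm norm_minus_commute)
  then have 2: "openin (top_of_set (carrier U1)) {z \<in> carrier U1. cmod (z - 1) < \<eta>}"
    by (metis openin_open_Int open_ball)
  show "openin (SU2_U1_topology k l) N"
    unfolding N_def SU2_U1_topology_def openin_prod_Times_iff using 1 2 by (simp add: openin_PiE)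
  have "emb k l pone \<in> N" using \<eta> by (auto simp: N_def emb_def pone_def qmat_SU2 U1_def)
  then show "\<one>\<^bsub>SU2_U1_product k l\<^esub> \<in> N" by (simp add: emb_pone)
  show "N \<subseteq> emb k l ` {v. small \<eta> v}"
  proof
    fix z assume z: "z \<in> N"
    define v where "v = ((\<lambda>i. if i < k then colq (fst z i) else q1), (\<lambda>j. if j < l then snd z j else 1))"
    have F: "fst z i \<in> carrier SU2" "norm (colq (fst z i) - q1) < \<eta>" if "i < k" for i
      using z that by (auto simp: N_def mem_Times_iff PiE_iff)
    have H: "snd z j \<in> carrier U1" "cmod (snd z j - 1) < \<eta>" if "j < l" for j
      using z that by (auto simp: N_def mem_Times_iff PiE_iff)
    have ext: "fst z \<in> extensional {..<k}" "snd z \<in> extensional {..<l}" using z by (auto simp: N_def mem_Times_iff PiE_iff)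
    have "small \<eta> v" using F H \<eta> SU2_qmat(2) by (auto simp: small_def v_def U1_def)
    moreover have "emb k l v = z"
      using SU2_qmat(1)[OF F(1)] ext by (auto simp: emb_def v_def prod_eq_iff fun_eq_iff extensional_def)
    ultimately show "z \<in> emb k l ` {v. small \<eta> v}" by blast
  qed
qed

text \<open>\<open>J\<close> is the inverse of the local isomorphism after the quaternion
  parametrisation, on a radius small enough for all its values to lie in the given
  neighbourhood.\<close>

lemma (in haar_compact) ex_chart:
  assumes Hausdorff: "Hausdorff_space T" and conn: "connected_space T"
    and loc: "locally_isomorphic G T (SU2_U1_product k l) (SU2_U1_topology k l)"
  shows "\<exists>J \<rho>. haar_chart G T \<mu> k l J \<rho>"
proof -
  let ?P = "SU2_U1_product k l" and ?S = "SU2_U1_topology k l"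
  obtain U W f where lUW: "openin T U \<and> \<one> \<in> U \<and> openin ?S W \<and> \<one>\<^bsub>?P\<^esub> \<in> W \<and>
      homeomorphic_map (subtopology T U) (subtopology ?S W) f \<and>
      (\<forall>x\<in>U. \<forall>y\<in>U. (x \<otimes> y \<in> U \<longleftrightarrow> f x \<otimes>\<^bsub>?P\<^esub> f y \<in> W) \<and>
         (x \<otimes> y \<in> U \<longrightarrow> f (x \<otimes> y) = f x \<otimes>\<^bsub>?P\<^esub> f y))"
    using loc[unfolded locally_isomorphic_def] by (elim exE) (rule that)
  then have U: "openin T U" "\<one> \<in> U" and W: "openin ?S W" "\<one>\<^bsub>?P\<^esub> \<in> W"
    and hm: "homeomorphic_map (subtopology T U) (subtopology ?S W) f" by simp_all
  have hom: "x \<otimes> y \<in> U \<longleftrightarrow> f x \<otimes>\<^bsub>?P\<^esub> f y \<in> W" "x \<otimes> y \<in> U \<Longrightarrow> f (x \<otimes> y) = f x \<otimes>\<^bsub>?P\<^esub> f y"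
    if "x \<in> U" "y \<in> U" for x y
    using lUW that by (elim conjE, blast)+
  have Us: "topspace (subtopology T U) = U" "U \<subseteq> carrier G" using openin_subset[OF U(1)] by (auto simp: topspace_eq)
  have Ws: "topspace (subtopology ?S W) = W" using openin_subset[OF W(1)] by auto
  obtain g where "homeomorphic_maps (subtopology T U) (subtopology ?S W) f g"
    using hm homeomorphic_map_maps by blast
  then have fc: "continuous_map (subtopology T U) (subtopology ?S W) f"
    and gc: "continuous_map (subtopology ?S W) (subtopology T U) g"
    and gf: "\<And>x. x \<in> U \<Longrightarrow> g (f x) = x" and fg: "\<And>y. y \<in> W \<Longrightarrow> f (g y) = y"
    unfolding homeomorphic_maps_def Us Ws by auto
  have fW: "f x \<in> W" if "x \<in> U" for x using continuous_map_image_subset_topspace[OF fc] that unfolding Us Ws by auto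
  have gU: "g y \<in> U" if "y \<in> W" for y using continuous_map_image_subset_topspace[OF gc] that unfolding Us Ws by auto
  obtain \<rho> where \<rho>: "\<rho> > 0" "\<And>v. small \<rho> v \<Longrightarrow> emb k l v \<in> W" using emb_nbhd[OF W] by blast
  define J where "J v = g (emb k l v)" for v
  have JU: "J v \<in> U" if "small \<rho> v" for v using gU \<rho>(2)[OF that] by (simp add: J_def)
  have fJ: "f (J v) = emb k l v" if "small \<rho> v" for v using fg \<rho>(2)[OF that] by (simp add: J_def)
  have Jm: "J (pmul v w) = J v \<otimes> J w" if s: "small \<rho> v" "small \<rho> w" "small \<rho> (pmul v w)" for v w
  proof -
    have e: "f (J v) \<otimes>\<^bsub>?P\<^esub> f (J w) = emb k l (pmul v w)" by (simp add: fJ s emb_pmul)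
    \<comment> \<open>The equivalence in the definition of local isomorphism is essential here:
      membership of the product is pulled back from the model group.\<close>
    then have "J v \<otimes> J w \<in> U" using hom(1)[OF JU[OF s(1)] JU[OF s(2)]] \<rho>(2)[OF s(3)] by simp
    with hom(2)[OF JU[OF s(1)] JU[OF s(2)]] e have "f (J v \<otimes> J w) = emb k l (pmul v w)" by simp
    then show ?thesis using gf[OF \<open>J v \<otimes> J w \<in> U\<close>] by (simp add: J_def)
  qed
  \<comment> \<open>Not part of the definition of local isomorphism; it follows because
    \<open>J pone\<close> is idempotent.\<close>
  have f1: "f \<one> = \<one>\<^bsub>?P\<^esub>"
  proof -
    have s: "small \<rho> pone" by (rule small_pone[OF \<rho>(1)])
    have "J pone = J pone \<otimes> J pone" using Jm[OF s s] s by simp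
    then have "J pone = \<one>" using JU[OF s] Us(2) by (metis l_cancel_one subsetD)
    then show ?thesis using fJ[OF s] by (simp add: emb_pone)
  qed
  have "haar_chart G T \<mu> k l J \<rho>"
  proof unfold_locales
    show "Hausdorff_space T" "connected_space T" "\<rho> > 0" by fact+
    show "J v \<in> carrier G" if "small \<rho> v" for v using JU[OF that] Us by auto
    show "J (pmul v w) = J v \<otimes> J w" if "small \<rho> v" "small \<rho> w" "small \<rho> (pmul v w)" for v w by (rule Jm[OF that])
    show "fst v i = fst w i" if s: "small \<rho> v" "small \<rho> w" and e: "J v = J w" and i: "i < k" for v w i
    proof -
      have "emb k l v = emb k l w" using fJ[OF s(1)] fJ[OF s(2)] e by simp
      then have "fst (emb k l v) i = fst (emb k l w) i" by simp
      then have "qmat (fst v i) = qmat (fst w i)" using i by (simp add: emb_def)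
      then show ?thesis by (metis colq_qmat)
    qed
    show "J v = J w" if "\<And>i. i < k \<Longrightarrow> fst v i = fst w i" "\<And>j. j < l \<Longrightarrow> snd v j = snd w j" for v w
    proof -
      have "emb k l v = emb k l w" using that by (auto simp: emb_def fun_eq_iff)
      then show ?thesis by (simp add: J_def)
    qed
    show "limitin T (\<lambda>n. J (V n)) (J v) sequentially"
      if "\<And>n. small \<rho> (V n)" "small \<rho> v" "\<And>i. (\<lambda>n. fst (V n) i) \<longlonglongrightarrow> fst v i" "\<And>j. (\<lambda>n. snd (V n) j) \<longlonglongrightarrow> snd v j" for V v
    proof -
      have "limitin (subtopology ?S W) (\<lambda>n. emb k l (V n)) (emb k l v) sequentially"
        unfolding limitin_subtopology using emb_limit[OF that] \<rho>(2) that by simp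
      from continuous_map_limit[OF gc this] show ?thesis
        by (simp add: limitin_subtopology o_def J_def)
    qed
    show "\<exists>U. openin T U \<and> \<one> \<in> U \<and> U \<subseteq> J ` {v. small \<eta> v}" if \<eta>: "0 < \<eta>" "\<eta> \<le> \<rho>" for \<eta>
    proof -
      obtain N where N: "openin ?S N" "\<one>\<^bsub>?P\<^esub> \<in> N" "N \<subseteq> emb k l ` {v. small \<eta> v}"
        by (rule that[OF open_small_box[OF \<eta>(1)]])
      have NW: "N \<subseteq> W"
      proof
        fix z assume "z \<in> N"
        then obtain v where "small \<eta> v" "z = emb k l v" using N(3) by auto
        then show "z \<in> W" using \<rho>(2) small_mono[OF _ \<eta>(2)] by simp
      qed
      let ?O = "{x \<in> topspace (subtopology T U). f x \<in> N}"
      have "openin (subtopology ?S W) N" using N(1) NW W(1) by (simp add: openin_open_subtopology)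
      then have "openin (subtopology T U) ?O" by (rule openin_continuous_map_preimage[OF fc])
      then have "openin T ?O" using U(1) openin_open_subtopology by blast
      moreover have "\<one> \<in> ?O" using U(2) N(2) Us(1) by (simp add: f1)
      moreover have "?O \<subseteq> J ` {v. small \<eta> v}"
      proof
        fix x assume "x \<in> ?O"
        then have x: "x \<in> U" "f x \<in> N" using Us(1) by auto
        then obtain v where v: "small \<eta> v" "f x = emb k l v" using N(3) by auto
        then have "x = J v" using gf[OF x(1)] by (simp add: J_def)
        with v show "x \<in> J ` {v. small \<eta> v}" by blast
      qed
      ultimately show ?thesis by blast
    qed
  qed
  then show ?thesis by blast
qed

section \<open>The free group\<close>

lemma inv_letter_inv [simp]: "inv_letter (inv_letter x) = x" by (simp add: inv_letter_def)

lemma inv_letter_neq [simp]: "inv_letter x \<noteq> x" "x \<noteq> inv_letter x"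
  by (auto simp: inv_letter_def prod_eq_iff)

lemma fst_inv_letter [simp]: "fst (inv_letter x) = fst x" by (simp add: inv_letter_def)

lemma reduced_Nil [simp]: "reduced_word []" by (simp add: reduced_word_def)

lemma reduced_single [simp]: "reduced_word [x]" by (simp add: reduced_word_def)

lemma reduced_Cons2: "reduced_word (x # y # w) \<longleftrightarrow> y \<noteq> inv_letter x \<and> reduced_word (y # w)"
  by (simp add: reduced_word_def)

lemma reduced_tl: "reduced_word (x # w) \<Longrightarrow> reduced_word w"
  by (cases w) (auto simp: reduced_Cons2)

lemma push_reduced: "reduced_word w \<Longrightarrow> reduced_word (push_letter x w)"
  by (cases w) (auto simp: reduced_Cons2 dest: reduced_tl)

lemma push_of_reduced: "reduced_word (x # w) \<Longrightarrow> push_letter x w = x # w"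
  by (cases w) (auto simp: reduced_Cons2)

lemma push_push_inv: "reduced_word w \<Longrightarrow> push_letter x (push_letter (inv_letter x) w) = w"
  by (cases w) (auto simp: push_of_reduced reduced_Cons2)

lemma foldr_push_reduced: "reduced_word w \<Longrightarrow> reduced_word (foldr push_letter u w)"
  by (induction u) (auto simp: push_reduced)

lemma push_letters: "fst ` set (push_letter x w) \<subseteq> insert (fst x) (fst ` set w)"
  by (cases w) auto

lemma foldr_push_letters: "fst ` set (foldr push_letter u w) \<subseteq> fst ` set u \<union> fst ` set w"
proof (induction u)
  case (Cons x u)
  have "fst ` set (foldr push_letter (x # u) w) \<subseteq> insert (fst x) (fst ` set (foldr push_letter u w))"
    using push_letters[of x "foldr push_letter u w"] by simp
  then show ?case using Cons by auto
qed simp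

text \<open>Van der Waerden's device: letters act on reduced words, inverse letters by inverse maps.
  Associativity of reduced multiplication reduces to this.\<close>

lemma foldr_push_push:
  "reduced_word v \<Longrightarrow> foldr push_letter (push_letter x u) v = push_letter x (foldr push_letter u v)"
  by (cases u) (auto simp: push_push_inv foldr_push_reduced)

lemma foldr_push_assoc:
  "reduced_word c \<Longrightarrow> foldr push_letter (foldr push_letter a b) c = foldr push_letter a (foldr push_letter b c)"
  by (induction a) (auto simp: foldr_push_push)

lemma foldr_push_Nil: "reduced_word w \<Longrightarrow> foldr push_letter w [] = w"
proof (induction w)
  case (Cons x w)
  then show ?case using reduced_tl[OF Cons.prems] push_of_reduced[OF Cons.prems] by simp
qed simp

lemma foldr_push_inverse: "reduced_word v \<Longrightarrow> foldr push_letter (map inv_letter (rev w)) (foldr push_letter w v) = v"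
proof (induction w)
  case (Cons x w)
  have "push_letter (inv_letter x) (push_letter x (foldr push_letter w v)) = foldr push_letter w v"
    using push_push_inv[of "foldr push_letter w v" "inv_letter x"] foldr_push_reduced[OF Cons.prems] by simp
  then show ?case using Cons by simp
qed simp

lemma free_group_carrier: "w \<in> carrier (free_group n) \<longleftrightarrow> reduced_word w \<and> fst ` set w \<subseteq> {..<n}"
  by (simp add: free_group_def)

lemma free_group_simps [simp]:
  "u \<otimes>\<^bsub>free_group n\<^esub> v = foldr push_letter u v" "\<one>\<^bsub>free_group n\<^esub> = []"
  by (simp_all add: free_group_def)

lemma group_free_group: "group (free_group n)"
proof (rule groupI)
  fix u v w assume c: "u \<in> carrier (free_group n)" "v \<in> carrier (free_group n)"
  show "u \<otimes>\<^bsub>free_group n\<^esub> v \<in> carrier (free_group n)"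
    using c foldr_push_reduced[of v u] order_trans[OF foldr_push_letters[of u v] Un_least, of "{..<n}"]
    by (simp add: free_group_carrier)
  assume "w \<in> carrier (free_group n)"
  then show "u \<otimes>\<^bsub>free_group n\<^esub> v \<otimes>\<^bsub>free_group n\<^esub> w = u \<otimes>\<^bsub>free_group n\<^esub> (v \<otimes>\<^bsub>free_group n\<^esub> w)"
    by (simp add: foldr_push_assoc free_group_carrier)
next
  fix u assume u: "u \<in> carrier (free_group n)"
  let ?v = "foldr push_letter (map inv_letter (rev u)) []"
  have "?v \<in> carrier (free_group n)"
  proof -
    have "fst ` set (map inv_letter (rev u)) = fst ` set u"
      by (simp add: image_image inv_letter_def)
    then show ?thesis
      using u order_trans[OF foldr_push_letters[of "map inv_letter (rev u)" "[]"] Un_least, of "{..<n}"]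
      by (simp add: free_group_carrier foldr_push_reduced)
  qed
  moreover have "foldr push_letter ?v u = []"
    using foldr_push_inverse[of "[]" u] u by (simp add: foldr_push_assoc free_group_carrier foldr_push_Nil)
  ultimately show "\<exists>v\<in>carrier (free_group n). v \<otimes>\<^bsub>free_group n\<^esub> u = \<one>\<^bsub>free_group n\<^esub>" by auto
qed (auto simp: free_group_carrier)

lemma letter_in_free_group: "fst x < n \<Longrightarrow> [x] \<in> carrier (free_group n)"
  by (simp add: free_group_carrier)

lemma free_gen_carrier: "i < n \<Longrightarrow> free_gen i \<in> carrier (free_group n)"
  by (simp add: free_gen_def letter_in_free_group)

lemma inv_letter_free_group: "i < n \<Longrightarrow> inv\<^bsub>free_group n\<^esub> (free_gen i) = [(i, False)]"
  by (rule group.inv_equality[OF group_free_group])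
    (auto simp: free_gen_def letter_in_free_group inv_letter_def)

section \<open>Evaluation of words and the universal property of the free group\<close>

context group
begin

definition letter_val :: "(nat \<Rightarrow> 'a) \<Rightarrow> nat \<times> bool \<Rightarrow> 'a" where
  "letter_val t x = (if snd x then t (fst x) else inv (t (fst x)))"

definition word_val :: "(nat \<Rightarrow> 'a) \<Rightarrow> (nat \<times> bool) list \<Rightarrow> 'a" where
  "word_val t w = foldr (\<lambda>x a. letter_val t x \<otimes> a) w \<one>"

lemma word_val_simps [simp]: "word_val t [] = \<one>" "word_val t (x # w) = letter_val t x \<otimes> word_val t w"
  by (simp_all add: word_val_def)

lemma letter_val_closed: "\<forall>i<n. t i \<in> carrier G \<Longrightarrow> fst x < n \<Longrightarrow> letter_val t x \<in> carrier G"
  by (simp add: letter_val_def)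

lemma letter_val_inv: "\<forall>i<n. t i \<in> carrier G \<Longrightarrow> fst x < n \<Longrightarrow> letter_val t (inv_letter x) = inv (letter_val t x)"
  by (simp add: letter_val_def inv_letter_def)

lemma word_val_closed: "\<forall>i<n. t i \<in> carrier G \<Longrightarrow> fst ` set w \<subseteq> {..<n} \<Longrightarrow> word_val t w \<in> carrier G"
  by (induction w) (auto simp: letter_val_closed)

lemma word_val_push:
  assumes t: "\<forall>i<n. t i \<in> carrier G" and x: "fst x < n" and w: "fst ` set w \<subseteq> {..<n}"
  shows "word_val t (push_letter x w) = letter_val t x \<otimes> word_val t w"
proof (cases w)
  case (Cons y w')
  show ?thesis
  proof (cases "y = inv_letter x")
    case True
    have "word_val t w' \<in> carrier G" using word_val_closed[OF t, of w'] w Cons by auto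
    then show ?thesis using True Cons letter_val_inv[OF t x] letter_val_closed[OF t x] by (simp add: m_assoc[symmetric])
  qed (use Cons in simp)
qed simp

lemma word_val_foldr:
  assumes t: "\<forall>i<n. t i \<in> carrier G" and u: "fst ` set u \<subseteq> {..<n}" and w: "fst ` set w \<subseteq> {..<n}"
  shows "word_val t (foldr push_letter u w) = word_val t u \<otimes> word_val t w"
  using u
proof (induction u)
  case Nil then show ?case using word_val_closed[OF t w] by simp
next
  case (Cons x u)
  have f: "fst ` set (foldr push_letter u w) \<subseteq> {..<n}" 
    by (rule order_trans[OF foldr_push_letters Un_least]) (use Cons.prems w in auto)
  have c: "letter_val t x \<in> carrier G" "word_val t u \<in> carrier G" "word_val t w \<in> carrier G"
    using Cons.prems letter_val_closed[OF t, of x] word_val_closed[OF t, of u] word_val_closed[OF t w] by auto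
  show ?case using Cons word_val_push[OF t _ f, of x] c by (simp add: m_assoc)
qed

definition rep_of :: "nat \<Rightarrow> (nat \<Rightarrow> 'a) \<Rightarrow> 'a rep" where
  "rep_of n t = restrict (word_val t) (carrier (free_group n))"

lemma rep_of_Hom: assumes t: "\<forall>i<n. t i \<in> carrier G" shows "rep_of n t \<in> Hom_space n G"
  unfolding Hom_space_def
proof
  interpret F: group "free_group n" by (rule group_free_group)
  show "rep_of n t \<in> hom (free_group n) G"
  proof (rule homI)
    fix u v assume uv: "u \<in> carrier (free_group n)" "v \<in> carrier (free_group n)"
    then have "foldr push_letter u v \<in> carrier (free_group n)" using F.m_closed[of u v] by simp
    then show "rep_of n t (u \<otimes>\<^bsub>free_group n\<^esub> v) = rep_of n t u \<otimes> rep_of n t v"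
      using uv word_val_foldr[OF t] by (simp add: rep_of_def free_group_carrier)
  qed (use word_val_closed[OF t] in \<open>auto simp: rep_of_def free_group_carrier\<close>)
qed (simp add: rep_of_def)

lemma rep_of_gen: "\<forall>i<n. t i \<in> carrier G \<Longrightarrow> i < n \<Longrightarrow> rep_of n t (free_gen i) = t i"
  using free_gen_carrier[of i n] by (simp add: rep_of_def) (simp add: free_gen_def letter_val_def)

lemma Hom_unique:
  assumes r: "\<rho> \<in> Hom_space n G" and t: "\<And>i. i < n \<Longrightarrow> \<rho> (free_gen i) = t i"
  shows "\<rho> = rep_of n t"
proof
  interpret h: group_hom "free_group n" G \<rho>
    using r group_free_group is_group by (simp add: Hom_space_def group_hom_def group_hom_axioms_def)
  fix w
  have "w \<in> carrier (free_group n) \<Longrightarrow> \<rho> w = word_val t w"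
  proof (induction w)
    case Nil
    then show ?case using h.hom_one by simp
  next
    case (Cons x w)
    then have red: "reduced_word (x # w)" and b: "fst x < n" "fst ` set w \<subseteq> {..<n}" by (auto simp: free_group_carrier)
    have wc: "w \<in> carrier (free_group n)" using reduced_tl[OF red] b by (simp add: free_group_carrier)
    have e: "x # w = [x] \<otimes>\<^bsub>free_group n\<^esub> w" using push_of_reduced[OF red] by simp
    have "\<rho> [x] = letter_val t x"
    proof (cases "snd x")
      case True
      then have "[x] = free_gen (fst x)" by (cases x) (simp add: free_gen_def)
      then show ?thesis using t[OF b(1)] True by (simp add: letter_val_def)
    next
      case False
      then have "[x] = inv\<^bsub>free_group n\<^esub> (free_gen (fst x))" using inv_letter_free_group[OF b(1)] by (cases x) simp
      then show ?thesis using t[OF b(1)] False h.hom_inv[OF free_gen_carrier[OF b(1)]] by (simp add: letter_val_def)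
    qed
    moreover have "\<rho> (x # w) = \<rho> [x] \<otimes> \<rho> w"
      using h.hom_mult[OF letter_in_free_group[OF b(1)] wc] unfolding e[symmetric] .
    ultimately show ?case using Cons.IH[OF wc] by simp
  qed
  then show "\<rho> w = rep_of n t w"
    using r by (auto simp: rep_of_def Hom_space_def extensional_def)
qed

lemma eval_gens_rep_of:
  assumes "t \<in> (\<Pi>\<^sub>E i\<in>{..<n}. carrier G)" shows "eval_gens n (rep_of n t) = t"
  using assms rep_of_gen[of n t] by (auto simp: eval_gens_def fun_eq_iff PiE_iff extensional_def)

lemma inj_on_eval_gens: "inj_on (eval_gens n) (Hom_space n G)"
proof (rule inj_onI)
  fix \<rho> \<sigma> assume r: "\<rho> \<in> Hom_space n G" "\<sigma> \<in> Hom_space n G" and e: "eval_gens n \<rho> = eval_gens n \<sigma>"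
  have "\<rho> (free_gen i) = \<sigma> (free_gen i)" if "i < n" for i
    using fun_cong[OF e, of i] that by (simp add: eval_gens_def)
  then have "\<rho> = rep_of n (\<lambda>i. \<sigma> (free_gen i))" by (rule Hom_unique[OF r(1)])
  also have "\<dots> = \<sigma>" by (rule Hom_unique[OF r(2), symmetric]) simp
  finally show "\<rho> = \<sigma>" .
qed

lemma the_inv_eval_gens:
  assumes "t \<in> (\<Pi>\<^sub>E i\<in>{..<n}. carrier G)"
  shows "the_inv_into (Hom_space n G) (eval_gens n) t = rep_of n t"
  using assms the_inv_into_f_f[OF inj_on_eval_gens rep_of_Hom, of n t] eval_gens_rep_of[OF assms] by auto

section \<open>Automorphisms\<close>

lemma AutoGroup_simps:
  "carrier (AutoGroup G) = auto G" "\<one>\<^bsub>AutoGroup G\<^esub> = (\<lambda>x\<in>carrier G. x)"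
  "\<phi> \<in> auto G \<Longrightarrow> \<psi> \<in> auto G \<Longrightarrow> \<phi> \<otimes>\<^bsub>AutoGroup G\<^esub> \<psi> = compose (carrier G) \<phi> \<psi>"
  by (auto simp: AutoGroup_def BijGroup_def auto_def)

lemma auto_closed: "\<phi> \<in> auto G \<Longrightarrow> x \<in> carrier G \<Longrightarrow> \<phi> x \<in> carrier G"
  by (auto simp: auto_def hom_def)

lemma auto_mult: "\<phi> \<in> auto G \<Longrightarrow> x \<in> carrier G \<Longrightarrow> y \<in> carrier G \<Longrightarrow> \<phi> (x \<otimes> y) = \<phi> x \<otimes> \<phi> y"
  by (auto simp: auto_def hom_def)

lemma auto_inv: "\<phi> \<in> auto G \<Longrightarrow> x \<in> carrier G \<Longrightarrow> \<phi> (inv x) = inv (\<phi> x)"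
proof -
  assume p: "\<phi> \<in> auto G" and x: "x \<in> carrier G"
  interpret h: group_hom G G \<phi> using p is_group by (simp add: auto_def group_hom_def group_hom_axioms_def)
  show ?thesis using x by simp
qed

lemma autoI:
  assumes "\<phi> \<in> hom G G" "\<phi> \<in> extensional (carrier G)" "\<psi> \<in> hom G G"
    and "\<And>x. x \<in> carrier G \<Longrightarrow> \<psi> (\<phi> x) = x" "\<And>x. x \<in> carrier G \<Longrightarrow> \<phi> (\<psi> x) = x"
  shows "\<phi> \<in> auto G"
proof -
  have "bij_betw \<phi> (carrier G) (carrier G)"
    by (rule bij_betw_byWitness[where f'=\<psi>]) (use assms in \<open>auto simp: hom_def\<close>)
  then show ?thesis using assms by (simp add: auto_def Bij_def)
qed

definition inner :: "'a \<Rightarrow> 'a \<Rightarrow> 'a" where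
  "inner g = (\<lambda>x\<in>carrier G. g \<otimes> x \<otimes> inv g)"

lemma Inn_eq: "Inn G = inner ` carrier G"
  by (simp add: Inn_def inner_def)

lemma inner_hom: "g \<in> carrier G \<Longrightarrow> inner g \<in> hom G G"
proof (rule homI)
  fix x y assume c: "g \<in> carrier G" "x \<in> carrier G" "y \<in> carrier G"
  have "g \<otimes> x \<otimes> inv g \<otimes> (g \<otimes> y \<otimes> inv g) = g \<otimes> x \<otimes> (inv g \<otimes> g) \<otimes> (y \<otimes> inv g)"
    using c by (simp only: m_assoc inv_closed m_closed)
  then show "inner g (x \<otimes> y) = inner g x \<otimes> inner g y" using c by (simp add: inner_def m_assoc)
qed (simp add: inner_def)

lemma inner_inner: "g \<in> carrier G \<Longrightarrow> x \<in> carrier G \<Longrightarrow> inner (inv g) (inner g x) = x"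
  by (simp add: inner_def m_assoc) (simp add: m_assoc[symmetric])

lemma inner_auto: assumes g: "g \<in> carrier G" shows "inner g \<in> auto G"
proof (rule autoI[where \<psi>="inner (inv g)"])
  show "inner g (inner (inv g) x) = x" if "x \<in> carrier G" for x
    using inner_inner[of "inv g" x] g that by simp
qed (use g inner_inner in \<open>auto simp: inner_hom\<close>, simp add: inner_def)

lemma inner_compose: "g \<in> carrier G \<Longrightarrow> h \<in> carrier G \<Longrightarrow> inner g \<otimes>\<^bsub>AutoGroup G\<^esub> inner h = inner (g \<otimes> h)"
  by (simp add: AutoGroup_simps inner_auto) (auto simp: inner_def compose_def fun_eq_iff m_assoc inv_mult_group)

lemma inv_inner: "g \<in> carrier G \<Longrightarrow> inv\<^bsub>AutoGroup G\<^esub> (inner g) = inner (inv g)"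
proof (rule group.inv_equality[OF AutoGroup])
  assume g: "g \<in> carrier G"
  then have "inner (inv g) \<otimes>\<^bsub>AutoGroup G\<^esub> inner g = inner \<one>" by (simp add: inner_compose)
  also have "inner \<one> = \<one>\<^bsub>AutoGroup G\<^esub>" by (auto simp: inner_def AutoGroup_simps)
  finally show "inner (inv g) \<otimes>\<^bsub>AutoGroup G\<^esub> inner g = \<one>\<^bsub>AutoGroup G\<^esub>" .
qed (simp_all add: AutoGroup_simps inner_auto)

lemma Inn_normal: "Inn G \<lhd> AutoGroup G"
proof -
  interpret A: group "AutoGroup G" by (rule AutoGroup)
  show ?thesis unfolding A.normal_inv_iff
  proof (intro conjI ballI)
    show "subgroup (Inn G) (AutoGroup G)"
    proof (rule A.subgroupI)
      show "Inn G \<subseteq> carrier (AutoGroup G)" by (auto simp: Inn_eq AutoGroup_simps inner_auto)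
      show "Inn G \<noteq> {}" by (auto simp: Inn_eq)
    qed (auto simp: Inn_eq inv_inner inner_compose)
    fix \<phi> h assume p: "\<phi> \<in> carrier (AutoGroup G)" and "h \<in> Inn G"
    then obtain g where g: "g \<in> carrier G" "h = inner g" by (auto simp: Inn_eq)
    have pa: "\<phi> \<in> auto G" using p by (simp add: AutoGroup_simps)
    have pg: "\<phi> g \<in> carrier G" by (rule auto_closed[OF pa g(1)])
    have "\<phi> \<otimes>\<^bsub>AutoGroup G\<^esub> inner g = inner (\<phi> g) \<otimes>\<^bsub>AutoGroup G\<^esub> \<phi>"
      using pa g pg by (auto simp: AutoGroup_simps inner_auto compose_def fun_eq_iff) 
        (simp add: inner_def auto_mult auto_inv auto_closed)
    moreover have "inner (\<phi> g) \<in> carrier (AutoGroup G)" using pg by (simp add: AutoGroup_simps inner_auto)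
    ultimately have "\<phi> \<otimes>\<^bsub>AutoGroup G\<^esub> inner g \<otimes>\<^bsub>AutoGroup G\<^esub> inv\<^bsub>AutoGroup G\<^esub> \<phi> = inner (\<phi> g)"
      using p by (simp add: A.m_assoc)
    then show "\<phi> \<otimes>\<^bsub>AutoGroup G\<^esub> h \<otimes>\<^bsub>AutoGroup G\<^esub> inv\<^bsub>AutoGroup G\<^esub> \<phi> \<in> Inn G" using g pg by (simp add: Inn_eq)
  qed
qed

lemma Out_inv_coset:
  assumes "\<phi> \<in> auto G"
  shows "Inn G #>\<^bsub>AutoGroup G\<^esub> \<phi> \<in> carrier (Out G)"
    and "inv\<^bsub>Out G\<^esub> (Inn G #>\<^bsub>AutoGroup G\<^esub> \<phi>) = Inn G #>\<^bsub>AutoGroup G\<^esub> inv\<^bsub>AutoGroup G\<^esub> \<phi>"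
proof -
  interpret N: normal "Inn G" "AutoGroup G" by (rule Inn_normal)
  have p: "\<phi> \<in> carrier (AutoGroup G)" using assms by (simp add: AutoGroup_simps)
  show c: "Inn G #>\<^bsub>AutoGroup G\<^esub> \<phi> \<in> carrier (Out G)"
    using p unfolding Out_def FactGroup_def RCOSETS_def by simp blast
  show "inv\<^bsub>Out G\<^esub> (Inn G #>\<^bsub>AutoGroup G\<^esub> \<phi>) = Inn G #>\<^bsub>AutoGroup G\<^esub> inv\<^bsub>AutoGroup G\<^esub> \<phi>"
    using N.inv_FactGroup[OF c[unfolded Out_def]] N.rcos_inv[OF p] by (simp add: Out_def)
qed

section \<open>Transvections\<close>

lemma Hom_comp_auto:
  assumes r: "\<rho> \<in> Hom_space n G" and p: "\<phi> \<in> auto (free_group n)"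
  shows "compose (carrier (free_group n)) \<rho> \<phi> \<in> Hom_space n G"
proof -
  interpret F: group "free_group n" by (rule group_free_group)
  have "compose (carrier (free_group n)) \<rho> \<phi> \<in> hom (free_group n) G"
  proof (rule homI)
    fix x y assume xy: "x \<in> carrier (free_group n)" "y \<in> carrier (free_group n)"
    then show "compose (carrier (free_group n)) \<rho> \<phi> (x \<otimes>\<^bsub>free_group n\<^esub> y) =
        compose (carrier (free_group n)) \<rho> \<phi> x \<otimes> compose (carrier (free_group n)) \<rho> \<phi> y"
      using F.m_closed[OF xy] F.auto_mult[OF p xy] r F.auto_closed[OF p]
      by (simp add: compose_def Hom_space_def hom_def del: free_group_simps)
  qed (use r F.auto_closed[OF p] in \<open>auto simp: compose_def Hom_space_def hom_def\<close>)
  then show ?thesis by (simp add: Hom_space_def compose_def)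
qed

lemma orbit_conj_rep:
  "\<rho> \<in> Hom_space n G \<Longrightarrow> orbit G (conj_rep n G) \<rho> =
    {\<lambda>w\<in>carrier (free_group n). g \<otimes> \<rho> w \<otimes> inv g | g. g \<in> carrier G}"
  by (auto simp: orbit_def conj_rep_def)

text \<open>Composing \<open>\<rho>\<close> with an inner automorphism of the free group conjugates it by a value of \<open>\<rho>\<close>.\<close>

lemma out_act_coset:
  assumes r: "\<rho> \<in> Hom_space n G" and p: "\<phi> \<in> auto (free_group n)"
  shows "out_act n (Inn (free_group n) #>\<^bsub>AutoGroup (free_group n)\<^esub> inv\<^bsub>AutoGroup (free_group n)\<^esub> \<phi>)
      (orbit G (conj_rep n G) \<rho>) = orbit G (conj_rep n G) (compose (carrier (free_group n)) \<rho> \<phi>)"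
    (is "?L = ?R")
proof -
  interpret F: group "free_group n" by (rule group_free_group)
  let ?F = "carrier (free_group n)" and ?A = "AutoGroup (free_group n)"
  interpret A: group ?A by (rule F.AutoGroup)
  have pA: "\<phi> \<in> carrier ?A" using p by (simp add: F.AutoGroup_simps)
  have rc: "\<rho> w \<in> carrier G" if "w \<in> ?F" for w using r that by (auto simp: Hom_space_def hom_def)
  have rm: "\<rho> (x \<otimes>\<^bsub>free_group n\<^esub> y) = \<rho> x \<otimes> \<rho> y" if "x \<in> ?F" "y \<in> ?F" for x y
    using r that by (auto simp: Hom_space_def hom_def)
  interpret h: group_hom "free_group n" G \<rho>
    using r group_free_group is_group by (simp add: Hom_space_def group_hom_def group_hom_axioms_def)
  note pc = F.auto_closed[OF p]
  have comp: "compose ?F \<rho> \<phi> \<in> Hom_space n G" by (rule Hom_comp_auto[OF r p])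
  \<comment> \<open>The inner automorphism is absorbed into the conjugating element, which becomes
    \<open>g \<otimes> inv (\<rho> (\<phi> u))\<close>. Any \<open>u\<close> gives one inclusion,
    and the trivial word gives the other.\<close>
  have key: "compose ?F (\<lambda>w\<in>?F. g \<otimes> \<rho> w \<otimes> inv g) (inv\<^bsub>?A\<^esub> (F.inner u \<otimes>\<^bsub>?A\<^esub> inv\<^bsub>?A\<^esub> \<phi>)) =
      (\<lambda>w\<in>?F. (g \<otimes> inv (\<rho> (\<phi> u))) \<otimes> compose ?F \<rho> \<phi> w \<otimes> inv (g \<otimes> inv (\<rho> (\<phi> u))))"
    if g: "g \<in> carrier G" and u: "u \<in> ?F" for g u
  proof
    fix w
    have iA: "F.inner u \<in> carrier ?A" using u by (simp add: F.AutoGroup_simps F.inner_auto)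
    have "inv\<^bsub>?A\<^esub> (F.inner u \<otimes>\<^bsub>?A\<^esub> inv\<^bsub>?A\<^esub> \<phi>) = \<phi> \<otimes>\<^bsub>?A\<^esub> F.inner (inv\<^bsub>free_group n\<^esub> u)"
      using iA pA u by (simp add: A.inv_mult_group F.inv_inner)
    also have "\<dots> = compose ?F \<phi> (F.inner (inv\<^bsub>free_group n\<^esub> u))"
      using p u by (simp add: F.AutoGroup_simps F.inner_auto)
    finally have e: "inv\<^bsub>?A\<^esub> (F.inner u \<otimes>\<^bsub>?A\<^esub> inv\<^bsub>?A\<^esub> \<phi>) = compose ?F \<phi> (F.inner (inv\<^bsub>free_group n\<^esub> u))" .
    show "compose ?F (\<lambda>w\<in>?F. g \<otimes> \<rho> w \<otimes> inv g) (inv\<^bsub>?A\<^esub> (F.inner u \<otimes>\<^bsub>?A\<^esub> inv\<^bsub>?A\<^esub> \<phi>)) w =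
      (\<lambda>w\<in>?F. (g \<otimes> inv (\<rho> (\<phi> u))) \<otimes> compose ?F \<rho> \<phi> w \<otimes> inv (g \<otimes> inv (\<rho> (\<phi> u)))) w"
    proof (cases "w \<in> ?F")
      case True
      have c: "inv\<^bsub>free_group n\<^esub> u \<otimes>\<^bsub>free_group n\<^esub> w \<in> ?F" "inv\<^bsub>free_group n\<^esub> u \<otimes>\<^bsub>free_group n\<^esub> w \<otimes>\<^bsub>free_group n\<^esub> u \<in> ?F"
        using u True by (simp_all del: free_group_simps)
      have "\<rho> (\<phi> (F.inner (inv\<^bsub>free_group n\<^esub> u) w)) = inv (\<rho> (\<phi> u)) \<otimes> \<rho> (\<phi> w) \<otimes> \<rho> (\<phi> u)"
        using u True c p pc by (simp add: F.inner_def F.auto_mult F.auto_inv rm del: free_group_simps)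
      moreover have "F.inner (inv\<^bsub>free_group n\<^esub> u) w \<in> ?F"
        using u True c by (simp add: F.inner_def del: free_group_simps)
      ultimately have "compose ?F (\<lambda>w\<in>?F. g \<otimes> \<rho> w \<otimes> inv g) (compose ?F \<phi> (F.inner (inv\<^bsub>free_group n\<^esub> u))) w =
          g \<otimes> (inv (\<rho> (\<phi> u)) \<otimes> \<rho> (\<phi> w) \<otimes> \<rho> (\<phi> u)) \<otimes> inv g"
        using True pc by (simp add: compose_def)
      also have "\<dots> = (g \<otimes> inv (\<rho> (\<phi> u))) \<otimes> \<rho> (\<phi> w) \<otimes> inv (g \<otimes> inv (\<rho> (\<phi> u)))"
        using g rc[OF pc[OF u]] rc[OF pc[OF True]] by (simp add: inv_mult_group m_assoc)
      finally show ?thesis unfolding e using True by (simp add: compose_def)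
    qed (simp add: compose_def restrict_def)
  qed
  have L: "?L = {compose ?F (\<lambda>w\<in>?F. g \<otimes> \<rho> w \<otimes> inv g) (inv\<^bsub>?A\<^esub> (F.inner u \<otimes>\<^bsub>?A\<^esub> inv\<^bsub>?A\<^esub> \<phi>)) | g u. g \<in> carrier G \<and> u \<in> ?F}"
    unfolding out_act_def orbit_conj_rep[OF r] r_coset_def F.Inn_eq by blast
  show ?thesis
  proof
    show "?L \<subseteq> ?R"
    proof
      fix x assume "x \<in> ?L"
      then obtain g u where g: "g \<in> carrier G" and u: "u \<in> ?F"
        and x: "x = compose ?F (\<lambda>w\<in>?F. g \<otimes> \<rho> w \<otimes> inv g) (inv\<^bsub>?A\<^esub> (F.inner u \<otimes>\<^bsub>?A\<^esub> inv\<^bsub>?A\<^esub> \<phi>))"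
        unfolding L by blast
      have "g \<otimes> inv (\<rho> (\<phi> u)) \<in> carrier G" using g rc[OF pc[OF u]] by simp
      then show "x \<in> ?R" unfolding orbit_conj_rep[OF comp] x key[OF g u] by blast
    qed
    show "?R \<subseteq> ?L"
    proof
      fix x assume "x \<in> ?R"
      then obtain g where g: "g \<in> carrier G" and x: "x = (\<lambda>w\<in>?F. g \<otimes> compose ?F \<rho> \<phi> w \<otimes> inv g)"
        unfolding orbit_conj_rep[OF comp] by blast
      have one: "\<one>\<^bsub>free_group n\<^esub> \<in> ?F" by (rule F.one_closed)
      have "\<phi> \<one>\<^bsub>free_group n\<^esub> = \<one>\<^bsub>free_group n\<^esub>"
        using F.auto_mult[OF p one one] pc[OF one] F.l_cancel_one'[of "\<phi> \<one>\<^bsub>free_group n\<^esub>" "\<phi> \<one>\<^bsub>free_group n\<^esub>"]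
        by (simp del: free_group_simps)
      then have "g \<otimes> inv (\<rho> (\<phi> \<one>\<^bsub>free_group n\<^esub>)) = g" using g h.hom_one by (simp del: free_group_simps)
      then have "x = compose ?F (\<lambda>w\<in>?F. g \<otimes> \<rho> w \<otimes> inv g) (inv\<^bsub>?A\<^esub> (F.inner \<one>\<^bsub>free_group n\<^esub> \<otimes>\<^bsub>?A\<^esub> inv\<^bsub>?A\<^esub> \<phi>))"
        unfolding key[OF g one] x by simp
      then show "x \<in> ?L" unfolding L using g one by blast
    qed
  qed
qed

text \<open>The inverse multiplies by the inverse of generator \<open>j\<close> instead. Both
  composites fix the generators, so they are the identity by uniqueness of homomorphisms.\<close>

lemma ex_transvection:
  assumes ij: "i < n" "j < n" "i \<noteq> j"
  shows "\<exists>\<phi>\<in>auto (free_group n). \<phi> (free_gen i) = free_gen j \<otimes>\<^bsub>free_group n\<^esub> free_gen i \<and>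
    (\<forall>m<n. m \<noteq> i \<longrightarrow> \<phi> (free_gen m) = free_gen m)"
proof -
  interpret F: group "free_group n" by (rule group_free_group)
  let ?F = "carrier (free_group n)"
  define t where "t = free_gen(i := free_gen j \<otimes>\<^bsub>free_group n\<^esub> free_gen i)"
  define s where "s = free_gen(i := inv\<^bsub>free_group n\<^esub> free_gen j \<otimes>\<^bsub>free_group n\<^esub> free_gen i)"
  have gc: "\<forall>m<n. free_gen m \<in> ?F" by (simp add: free_gen_carrier)
  have tc: "\<forall>m<n. t m \<in> ?F" and sc: "\<forall>m<n. s m \<in> ?F"
    using ij gc by (auto simp: t_def s_def simp del: free_group_simps)
  define \<phi> where "\<phi> = F.rep_of n t"
  define \<psi> where "\<psi> = F.rep_of n s"
  have ph: "\<phi> \<in> hom (free_group n) (free_group n)" "\<phi> \<in> extensional ?F" and qh: "\<psi> \<in> hom (free_group n) (free_group n)" "\<psi> \<in> extensional ?F"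
    using F.rep_of_Hom[OF tc] F.rep_of_Hom[OF sc] by (auto simp: \<phi>_def \<psi>_def Hom_space_def)
  have pg: "\<phi> (free_gen m) = t m" and qg: "\<psi> (free_gen m) = s m" if "m < n" for m
    using F.rep_of_gen[OF tc that] F.rep_of_gen[OF sc that] by (auto simp: \<phi>_def \<psi>_def)
  interpret p: group_hom "free_group n" "free_group n" \<phi> using ph by unfold_locales
  interpret q: group_hom "free_group n" "free_group n" \<psi> using qh by unfold_locales
  have id: "f = F.rep_of n free_gen" if "f \<in> Hom_space n (free_group n)" "\<And>m. m < n \<Longrightarrow> f (free_gen m) = free_gen m" for f
    by (rule F.Hom_unique[OF that])
  have idH: "(\<lambda>x\<in>?F. x) \<in> Hom_space n (free_group n)"
    using F.id_in_auto by (simp add: Hom_space_def auto_def)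
  have comp: "compose ?F f g \<in> Hom_space n (free_group n)"
    if "f \<in> hom (free_group n) (free_group n)" "g \<in> hom (free_group n) (free_group n)" for f g
    using F.hom_compose[OF that(2) that(1)] by (simp add: Hom_space_def)
  have e1: "compose ?F \<psi> \<phi> = (\<lambda>x\<in>?F. x)"
  proof -
    have "compose ?F \<psi> \<phi> (free_gen m) = free_gen m" if m: "m < n" for m
    proof (cases "m = i")
      case True
      have "\<psi> (free_gen j \<otimes>\<^bsub>free_group n\<^esub> free_gen i) = \<psi> (free_gen j) \<otimes>\<^bsub>free_group n\<^esub> \<psi> (free_gen i)"
        using gc ij by (intro q.hom_mult) auto
      also have "\<dots> = free_gen i" using qg ij gc by (simp add: s_def F.m_assoc[symmetric] del: free_group_simps)
      finally show ?thesis using True ij gc pg[OF ij(1)] by (simp add: compose_def t_def del: free_group_simps)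
    qed (use m gc pg qg in \<open>simp add: compose_def t_def s_def\<close>)
    from id[OF comp[OF qh(1) ph(1)] this] have 1: "compose ?F \<psi> \<phi> = F.rep_of n free_gen" .
    have "(\<lambda>x\<in>?F. x) = F.rep_of n free_gen" by (rule id[OF idH]) (simp add: gc)
    with 1 show ?thesis by simp
  qed
  have e2: "compose ?F \<phi> \<psi> = (\<lambda>x\<in>?F. x)"
  proof -
    have "compose ?F \<phi> \<psi> (free_gen m) = free_gen m" if m: "m < n" for m
    proof (cases "m = i")
      case True
      have "\<phi> (inv\<^bsub>free_group n\<^esub> free_gen j \<otimes>\<^bsub>free_group n\<^esub> free_gen i) = inv\<^bsub>free_group n\<^esub> \<phi> (free_gen j) \<otimes>\<^bsub>free_group n\<^esub> \<phi> (free_gen i)"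
        using gc ij by (simp add: p.hom_mult p.hom_inv del: free_group_simps)
      also have "\<dots> = free_gen i" using pg ij gc by (simp add: t_def F.m_assoc[symmetric] del: free_group_simps)
      finally show ?thesis using True ij gc qg[OF ij(1)] by (simp add: compose_def s_def del: free_group_simps)
    qed (use m gc pg qg in \<open>simp add: compose_def t_def s_def\<close>)
    from id[OF comp[OF ph(1) qh(1)] this] have 1: "compose ?F \<phi> \<psi> = F.rep_of n free_gen" .
    have "(\<lambda>x\<in>?F. x) = F.rep_of n free_gen" by (rule id[OF idH]) (simp add: gc)
    with 1 show ?thesis by simp
  qed
  have "\<phi> \<in> auto (free_group n)"
  proof (rule F.autoI[OF ph qh(1)])
    fix x assume x: "x \<in> ?F"
    show "\<psi> (\<phi> x) = x" using fun_cong[OF e1, of x] x by (simp add: compose_def)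
    show "\<phi> (\<psi> x) = x" using fun_cong[OF e2, of x] x by (simp add: compose_def)
  qed
  then show ?thesis using pg ij by (intro bexI[of _ \<phi>]) (auto simp: t_def)
qed

text \<open>The inverse of \<open>c\<close> in \<open>Out\<close> cancels the inverse built into
  \<open>out_act\<close>, so the action is by composition with the transvection itself.\<close>

theorem transvection_out_act:
  assumes ij: "i < n" "j < n" "i \<noteq> j"
  shows "\<exists>c\<in>carrier (Out (free_group n)). \<forall>t\<in>(\<Pi>\<^sub>E i\<in>{..<n}. carrier G).
    out_act n (inv\<^bsub>Out (free_group n)\<^esub> c) (orbit G (conj_rep n G) (rep_of n t)) =
    orbit G (conj_rep n G) (rep_of n (t(i := t j \<otimes> t i)))"
proof -
  interpret F: group "free_group n" by (rule group_free_group)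
  let ?F = "carrier (free_group n)"
  obtain \<phi> where p: "\<phi> \<in> auto (free_group n)" "\<phi> (free_gen i) = free_gen j \<otimes>\<^bsub>free_group n\<^esub> free_gen i"
    "\<And>m. m < n \<Longrightarrow> m \<noteq> i \<Longrightarrow> \<phi> (free_gen m) = free_gen m"
    using ex_transvection[OF ij] by auto
  let ?c = "Inn (free_group n) #>\<^bsub>AutoGroup (free_group n)\<^esub> \<phi>"
  show ?thesis
  proof (intro bexI[of _ ?c] ballI)
    show "?c \<in> carrier (Out (free_group n))" by (rule F.Out_inv_coset(1)[OF p(1)])
    fix t assume t: "t \<in> (\<Pi>\<^sub>E i\<in>{..<n}. carrier G)"
    then have tc: "\<forall>i<n. t i \<in> carrier G" by auto
    have r: "rep_of n t \<in> Hom_space n G" by (rule rep_of_Hom[OF tc])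
    have "compose ?F (rep_of n t) \<phi> = rep_of n (t(i := t j \<otimes> t i))"
    proof (rule Hom_unique[OF Hom_comp_auto[OF r p(1)]])
      fix m assume m: "m < n"
      have "rep_of n t (free_gen j \<otimes>\<^bsub>free_group n\<^esub> free_gen i) = rep_of n t (free_gen j) \<otimes> rep_of n t (free_gen i)"
        using r ij free_gen_carrier by (auto simp: Hom_space_def hom_def simp del: free_group_simps)
      then show "compose ?F (rep_of n t) \<phi> (free_gen m) = (t(i := t j \<otimes> t i)) m"
        using m p(2,3) rep_of_gen[OF tc] ij free_gen_carrier[OF m] by (simp add: compose_def del: free_group_simps)
    qed
    then show "out_act n (inv\<^bsub>Out (free_group n)\<^esub> ?c) (orbit G (conj_rep n G) (rep_of n t)) =
      orbit G (conj_rep n G) (rep_of n (t(i := t j \<otimes> t i)))"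
      unfolding F.Out_inv_coset(2)[OF p(1)] out_act_coset[OF r p(1)] by simp
  qed
qed

end

section \<open>Quotient measures\<close>

text \<open>\<open>N\<close> carries the largest sigma-algebra making \<open>\<Phi>\<close>
  measurable. So a function on the quotient is measurable, or square integrable, exactly when its
  lift is, and all questions can be moved to \<open>M\<close>.\<close>

locale quotient_map =
  fixes M :: "'x measure" and N :: "'y measure" and \<Phi> :: "'x \<Rightarrow> 'y"
  assumes into: "\<Phi> \<in> space M \<rightarrow> space N"
    and sets_iff: "A \<in> sets N \<longleftrightarrow> A \<subseteq> space N \<and> \<Phi> -` A \<inter> space M \<in> sets M"
    and distr_eq: "distr M N \<Phi> = N"
begin

lemma measurable_quotient [measurable]: "\<Phi> \<in> measurable M N"
  by (rule measurableI) (use into sets_iff in auto)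

lemma borel_measurable_iff:
  fixes h :: "'y \<Rightarrow> 'z :: topological_space"
  shows "h \<in> borel_measurable N \<longleftrightarrow> (\<lambda>t. h (\<Phi> t)) \<in> borel_measurable M"
proof
  assume h: "(\<lambda>t. h (\<Phi> t)) \<in> borel_measurable M"
  show "h \<in> borel_measurable N"
  proof (rule measurableI)
    fix A :: "'z set" assume A: "A \<in> sets borel"
    have "\<Phi> -` (h -` A \<inter> space N) \<inter> space M = (\<lambda>t. h (\<Phi> t)) -` A \<inter> space M" using into by auto
    then show "h -` A \<inter> space N \<in> sets N" using measurable_sets[OF h A] by (simp add: sets_iff)
  qed simp
qed (rule measurable_compose[OF measurable_quotient])

lemma sq_integrable_iff: "h \<in> sq_integrable N \<longleftrightarrow> (\<lambda>t. h (\<Phi> t)) \<in> sq_integrable M"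
proof (cases "h \<in> borel_measurable N")
  case True
  then have "integrable N (\<lambda>x. (cmod (h x))\<^sup>2) \<longleftrightarrow> integrable M (\<lambda>t. (cmod (h (\<Phi> t)))\<^sup>2)"
    by (subst distr_eq[symmetric], subst integrable_distr_eq) auto
  then show ?thesis using True borel_measurable_iff[of h] by (simp add: sq_integrable_def)
qed (use borel_measurable_iff[of h] in \<open>simp add: sq_integrable_def\<close>)

lemma AE_eq_iff:
  fixes f g :: "'y \<Rightarrow> complex"
  assumes "f \<in> sq_integrable N" "g \<in> sq_integrable N"
  shows "(AE x in N. f x = g x) \<longleftrightarrow> (AE t in M. f (\<Phi> t) = g (\<Phi> t))"
proof -
  have [measurable]: "f \<in> borel_measurable N" "g \<in> borel_measurable N" using assms by (auto simp: sq_integrable_def)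
  have "{x \<in> space N. f x = g x} \<in> sets N" by measurable
  from AE_distr_iff[OF measurable_quotient this] show ?thesis by (simp only: distr_eq)
qed

end

lemma quotient_measure_props:
  assumes q: "q \<in> space M \<rightarrow> Y"
  shows space_quotient_measure: "space (quotient_measure M q Y) = Y"
    and sets_quotient_measure: "sets (quotient_measure M q Y) = {A. A \<subseteq> Y \<and> q -` A \<inter> space M \<in> sets M}"
    and distr_quotient_measure: "distr M (quotient_measure M q Y) q = quotient_measure M q Y"
proof -
  let ?C = "{A. A \<subseteq> Y \<and> q -` A \<inter> space M \<in> sets M}"
  have pow: "?C \<subseteq> Pow Y" by auto
  have "sigma_algebra Y ?C"
    unfolding sigma_algebra_iff2
  proof (intro conjI ballI allI impI)
    fix A assume A: "A \<in> ?C"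
    have "q -` (Y - A) \<inter> space M = space M - (q -` A \<inter> space M)" using q by auto
    then show "Y - A \<in> ?C" using A by auto
  next
    fix A :: "nat \<Rightarrow> 'b set" assume "range A \<subseteq> ?C"
    then have "\<And>i. A i \<subseteq> Y" "\<And>i. q -` A i \<inter> space M \<in> sets M" by auto
    moreover from this have "(\<Union>i. q -` A i \<inter> space M) \<in> sets M" by (intro sets.countable_UN) auto
    moreover have "q -` (\<Union>i. A i) \<inter> space M = (\<Union>i. q -` A i \<inter> space M)" by auto
    ultimately show "(\<Union>i. A i) \<in> ?C" by (simp only: mem_Collect_eq UN_subset_iff) simp
  qed auto
  then have s: "sigma_sets Y ?C = ?C" by (rule sigma_algebra.sigma_sets_eq)
  show 1: "space (quotient_measure M q Y) = Y"
    unfolding quotient_measure_def by (rule space_measure_of[OF pow])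
  show 2: "sets (quotient_measure M q Y) = ?C"
    unfolding quotient_measure_def by (simp only: sets_measure_of[OF pow] s)
  \<comment> \<open>Both sides unfold to the same \<open>measure_of\<close> term, without any appeal
    to additivity.\<close>
  show "distr M (quotient_measure M q Y) q = quotient_measure M q Y"
    unfolding distr_def 1 2 by (simp only: quotient_measure_def)
qed

lemma quotient_map_embed:
  assumes e: "inj_on e (space M)" and q: "\<And>t. t \<in> space M \<Longrightarrow> q (e t) \<in> Y"
  shows "quotient_map M (quotient_measure (embed_measure M e) q Y) (\<lambda>t. q (e t))"
proof -
  let ?H = "embed_measure M e" and ?N = "quotient_measure (embed_measure M e) q Y"
  have qH: "q \<in> space ?H \<rightarrow> Y" using q by (auto simp: space_embed_measure)
  note P = quotient_measure_props[OF qH]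
  note em = measurable_embed_measure2'[OF e]
  have qm: "q \<in> measurable ?H ?N"
    by (rule measurableI) (use qH in \<open>auto simp: P\<close>)
  show ?thesis
  proof
    show "(\<lambda>t. q (e t)) \<in> space M \<rightarrow> space ?N" using q by (auto simp: P)
    fix A
    have "q -` A \<inter> space ?H \<in> sets ?H \<longleftrightarrow> (\<lambda>t. q (e t)) -` A \<inter> space M \<in> sets M"
    proof
      assume "q -` A \<inter> space ?H \<in> sets ?H"
      from measurable_sets[OF em this] have "e -` (q -` A \<inter> space ?H) \<inter> space M \<in> sets M" .
      also have "e -` (q -` A \<inter> space ?H) \<inter> space M = (\<lambda>t. q (e t)) -` A \<inter> space M"
        by (auto simp: space_embed_measure)
      finally show "(\<lambda>t. q (e t)) -` A \<inter> space M \<in> sets M" .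
    next
      assume "(\<lambda>t. q (e t)) -` A \<inter> space M \<in> sets M"
      from in_sets_embed_measure[OF this] have "e ` ((\<lambda>t. q (e t)) -` A \<inter> space M) \<in> sets ?H" .
      also have "e ` ((\<lambda>t. q (e t)) -` A \<inter> space M) = q -` A \<inter> space ?H"
        by (auto simp: space_embed_measure)
      finally show "q -` A \<inter> space ?H \<in> sets ?H" .
    qed
    then show "A \<in> sets ?N \<longleftrightarrow> A \<subseteq> space ?N \<and> (\<lambda>t. q (e t)) -` A \<inter> space M \<in> sets M"
      by (simp add: P)
  next
    have "distr M ?N (\<lambda>t. q (e t)) = distr (distr M ?H e) ?N q"
      by (simp add: distr_distr[OF qm em] comp_def)
    also have "\<dots> = ?N" using P(3) by (simp only: embed_measure_eq_distr'[OF e, symmetric])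
    finally show "distr M ?N (\<lambda>t. q (e t)) = ?N" .
  qed
qed

section \<open>Finite-dimensional subspaces of \<open>L\<^sup>2\<close>\<close>

lemma L2_class_eq: "f \<in> sq_integrable M \<Longrightarrow> L2_class M f = {g \<in> sq_integrable M. AE x in M. f x = g x}"
  by (auto simp: L2_class_def ae_rel_def)

lemma L2_class_in: "f \<in> sq_integrable M \<Longrightarrow> L2_class M f \<in> L2 M"
  by (auto simp: L2_def L2_class_def quotient_def)

lemma L2_repr: "v \<in> L2 M \<Longrightarrow> \<exists>f\<in>sq_integrable M. v = L2_class M f"
  by (auto simp: L2_def L2_class_def quotient_def)

lemma L2_class_cong:
  assumes "f \<in> sq_integrable M" "g \<in> sq_integrable M" "AE x in M. f x = g x"
  shows "L2_class M f = L2_class M g"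
proof -
  have "(AE x in M. f x = h x) \<longleftrightarrow> (AE x in M. g x = h x)" for h
  proof
    assume "AE x in M. f x = h x" with assms(3) show "AE x in M. g x = h x" by eventually_elim simp
  next
    assume "AE x in M. g x = h x" with assms(3) show "AE x in M. f x = h x" by eventually_elim simp
  qed
  then show ?thesis using assms by (simp add: L2_class_eq)
qed

lemma L2_class_self: "f \<in> sq_integrable M \<Longrightarrow> f \<in> L2_class M f"
  by (simp add: L2_class_eq)

text \<open>Operations on classes are written as unions over representatives; if the result does not
  depend on the representative, the union is a single class. This serves scaling, addition and the
  representation alike.\<close>

lemma UN_L2_class:
  assumes f: "f \<in> sq_integrable M"
    and \<theta>: "\<And>g. g \<in> sq_integrable M \<Longrightarrow> \<theta> g \<in> sq_integrable N"
    and AE: "\<And>g. g \<in> sq_integrable M \<Longrightarrow> AE x in M. f x = g x \<Longrightarrow> AE x in N. \<theta> f x = \<theta> g x"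
  shows "(\<Union>g\<in>L2_class M f. L2_class N (\<theta> g)) = L2_class N (\<theta> f)"
proof -
  have "L2_class N (\<theta> g) = L2_class N (\<theta> f)" if "g \<in> L2_class M f" for g
    using that f by (intro L2_class_cong[symmetric] \<theta> AE) (auto simp: L2_class_eq)
  then show ?thesis using L2_class_self[OF f] by blast
qed

lemma L2_scale_class:
  assumes f: "f \<in> sq_integrable M"
  shows "L2_scale M a (L2_class M f) = L2_class M (\<lambda>x. a * f x)"
  unfolding L2_scale_def
proof (rule UN_L2_class[OF f])
  fix g assume "AE x in M. f x = g x"
  then show "AE x in M. a * f x = a * g x" by eventually_elim simp
qed (rule sq_integrable_scale)

lemma L2_add_class:
  assumes f: "f \<in> sq_integrable M" and g: "g \<in> sq_integrable M"
  shows "L2_add M (L2_class M f) (L2_class M g) = L2_class M (\<lambda>x. f x + g x)"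
proof -
  have inner: "(\<Union>g'\<in>L2_class M g. L2_class M (\<lambda>x. f' x + g' x)) = L2_class M (\<lambda>x. f' x + g x)"
    if f': "f' \<in> sq_integrable M" for f'
  proof (rule UN_L2_class[OF g])
    fix g' assume "AE x in M. g x = g' x"
    then show "AE x in M. f' x + g x = f' x + g' x" by eventually_elim simp
  qed (rule sq_integrable_add[OF f'])
  have "L2_add M (L2_class M f) (L2_class M g) = (\<Union>f'\<in>L2_class M f. L2_class M (\<lambda>x. f' x + g x))"
    unfolding L2_add_def
  proof (rule SUP_cong[OF refl])
    fix f' assume "f' \<in> L2_class M f"
    then show "(\<Union>g'\<in>L2_class M g. L2_class M (\<lambda>x. f' x + g' x)) = L2_class M (\<lambda>x. f' x + g x)"
      using f by (intro inner) (simp add: L2_class_eq)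
  qed
  also have "\<dots> = L2_class M (\<lambda>x. f x + g x)"
  proof (rule UN_L2_class[OF f])
    fix f' assume "AE x in M. f x = f' x"
    then show "AE x in M. f x + g x = f' x + g x" by eventually_elim simp
  qed (rule sq_integrable_add[OF _ g])
  finally show ?thesis .
qed

text \<open>The classes of combinations of representatives form a subspace containing the
  generators, and the hull is the least such subspace.\<close>

lemma L2_finite_dim_span:
  assumes "L2_finite_dim M V"
  shows "\<exists>(m::nat) b. (\<forall>k<m. b k \<in> sq_integrable M) \<and> (\<forall>v\<in>V. \<exists>c. v = L2_class M (\<lambda>x. \<Sum>k<m. c k * b k x))"
proof -
  obtain B where B: "finite B" "B \<subseteq> L2 M" "V = L2_subspace M hull B"
    using assms unfolding L2_finite_dim_def by auto
  obtain \<beta> where \<beta>: "bij_betw \<beta> {0..<card B} B" using ex_bij_betw_nat_finite[OF B(1)] by auto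
  let ?m = "card B"
  have "\<forall>k. \<exists>f. k < ?m \<longrightarrow> f \<in> sq_integrable M \<and> \<beta> k = L2_class M f"
  proof
    fix k
    show "\<exists>f. k < ?m \<longrightarrow> f \<in> sq_integrable M \<and> \<beta> k = L2_class M f"
    proof (cases "k < ?m")
      case True
      then have "\<beta> k \<in> L2 M" using \<beta> B(2) bij_betwE[OF \<beta>] by auto
      then show ?thesis using L2_repr by blast
    qed simp
  qed
  from choice[OF this] obtain b where b: "\<forall>k<?m. b k \<in> sq_integrable M \<and> \<beta> k = L2_class M (b k)" by auto
  define W where "W = {L2_class M (\<lambda>x. \<Sum>k<?m. c k * b k x) | c. True}"
  have sq: "(\<lambda>x. \<Sum>k<?m. c k * b k x) \<in> sq_integrable M" for c
    by (rule sq_integrable_sum) (use b in auto)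
  have W_I: "L2_class M (\<lambda>x. \<Sum>k<?m. c k * b k x) \<in> W" for c by (auto simp: W_def)
  have "L2_subspace M W"
    unfolding L2_subspace_def
  proof (intro conjI ballI allI)
    show "W \<subseteq> L2 M" using L2_class_in[OF sq] by (auto simp: W_def)
    show "L2_class M (\<lambda>_. 0) \<in> W" using W_I[of "\<lambda>_. 0"] by simp
    fix v assume "v \<in> W"
    then obtain c where v: "v = L2_class M (\<lambda>x. \<Sum>k<?m. c k * b k x)" by (auto simp: W_def)
    show "L2_scale M a v \<in> W" for a
      using W_I[of "\<lambda>k. a * c k"] unfolding v L2_scale_class[OF sq] by (simp add: sum_distrib_left mult.assoc)
    fix w assume "w \<in> W"
    then obtain d where w: "w = L2_class M (\<lambda>x. \<Sum>k<?m. d k * b k x)" by (auto simp: W_def)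
    show "L2_add M v w \<in> W"
      using W_I[of "\<lambda>k. c k + d k"] unfolding v w L2_add_class[OF sq sq] by (simp add: sum.distrib distrib_right)
  qed
  moreover have "B \<subseteq> W"
  proof
    fix v assume "v \<in> B"
    then have "v \<in> \<beta> ` {0..<?m}" using \<beta> by (simp add: bij_betw_def)
    then obtain k where k: "k < ?m" "v = \<beta> k" by auto
    have "(\<lambda>x. \<Sum>l<?m. (if l = k then 1 else 0) * b l x) = b k"
      using k by (simp add: if_distrib[of "\<lambda>c. c * _"] cong: if_cong)
    then show "v \<in> W" using W_I[of "\<lambda>l. if l = k then 1 else 0"] b k by simp
  qed
  ultimately have "V \<subseteq> W" unfolding B(3) by (intro hull_minimal)
  then have "\<forall>v\<in>V. \<exists>c. v = L2_class M (\<lambda>x. \<Sum>k<?m. c k * b k x)" by (auto simp: W_def)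
  then show ?thesis using b by (intro exI[of _ ?m] exI[of _ b]) auto
qed

context haar_compact
begin

lemma quotient_map_char:
  "quotient_map (Pi\<^sub>M {..<n} (\<lambda>_. \<mu>)) (char_measure n G \<mu>)
    (\<lambda>t. orbit G (conj_rep n G) (the_inv_into (Hom_space n G) (eval_gens n) t))"
  unfolding char_measure_def Hom_measure_def
proof (rule quotient_map_embed)
  have sp: "space (Pi\<^sub>M {..<n} (\<lambda>_. \<mu>)) = (\<Pi>\<^sub>E i\<in>{..<n}. carrier G)"
    by (simp add: space_PiM space_haar)
  show "inj_on (the_inv_into (Hom_space n G) (eval_gens n)) (space (Pi\<^sub>M {..<n} (\<lambda>_. \<mu>)))"
    unfolding sp
  proof (rule inj_on_inverseI)
    fix t assume t: "t \<in> (\<Pi>\<^sub>E i\<in>{..<n}. carrier G)"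
    show "eval_gens n (the_inv_into (Hom_space n G) (eval_gens n) t) = t"
      unfolding the_inv_eval_gens[OF t] by (rule eval_gens_rep_of[OF t])
  qed
  fix t assume "t \<in> space (Pi\<^sub>M {..<n} (\<lambda>_. \<mu>))"
  then have t: "t \<in> (\<Pi>\<^sub>E i\<in>{..<n}. carrier G)" by (simp add: sp)
  then have "rep_of n t \<in> Hom_space n G" by (intro rep_of_Hom) auto
  then show "orbit G (conj_rep n G) (the_inv_into (Hom_space n G) (eval_gens n) t) \<in> char_space n G"
    by (auto simp: the_inv_eval_gens[OF t] char_space_def orbits_def)
qed

end

section \<open>Assembly on the space of representations modulo conjugation\<close>

theorem mainTheorem2:
  fixes G :: "('a, 'b) monoid_scheme" and T :: "'a topology"
    and d :: nat and \<A> :: "('a set \<times> ('a \<Rightarrow> nat \<Rightarrow> real)) set"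
    and \<mu> :: "'a measure" and n k l :: nat
    and V :: "('a rep set \<Rightarrow> complex) set set"
  assumes "lie_group G T d \<A>"
    and "compact_space T"
    and "connected_space T"
    and "locally_isomorphic G T (SU2_U1_product k l) (SU2_U1_topology k l)"
    and "haar_measure G T \<mu>"
    and "n > 2"
    and "L2_subspace (char_measure n G \<mu>) V"
    and "L2_finite_dim (char_measure n G \<mu>) V"
    and "\<And>c v. c \<in> carrier (Out (free_group n)) \<Longrightarrow> v \<in> V \<Longrightarrow> out_rep n G \<mu> c v \<in> V"
  shows "\<forall>v\<in>V. \<exists>a. v = L2_class (char_measure n G \<mu>) (\<lambda>_. a)"
proof
  have mf: "smooth_manifold T d \<A>" and tg: "topological_group G T"
    using assms(1) by (auto simp: lie_group_def)
  have hc: "haar_compact G T \<mu>"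
    by (intro haar_compact.intro tg haar_compact_axioms.intro assms(2,5))
      (use smooth_manifold.second_countable[OF mf] in \<open>simp add: second_countable_def\<close>)
  obtain J \<rho> where chart: "haar_chart G T \<mu> k l J \<rho>"
    using haar_compact.ex_chart[OF hc smooth_manifold.Hausdorff[OF mf] assms(3,4)] by (elim exE) (rule that)
  interpret C: haar_chart G T \<mu> k l J \<rho> by (rule chart)
  interpret P: haar_power G T \<mu> "{..<n}"
    by (intro haar_power.intro hc haar_power_axioms.intro) simp
  let ?M = "Pi\<^sub>M {..<n} (\<lambda>_. \<mu>)" and ?N = "char_measure n G \<mu>"
  define \<Phi> where "\<Phi> = (\<lambda>t. orbit G (conj_rep n G) (the_inv_into (Hom_space n G) (eval_gens n) t))"
  interpret Q: quotient_map ?M ?N \<Phi>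
    unfolding \<Phi>_def by (rule C.quotient_map_char)
  have spM: "space ?M = (\<Pi>\<^sub>E i\<in>{..<n}. carrier G)" by (simp add: space_PiM C.space_haar)
  have V_L2: "V \<subseteq> L2 ?N" using assms(7) by (simp add: L2_subspace_def)
  obtain m :: nat and b where b: "\<forall>k<m. b k \<in> sq_integrable ?N"
    and span: "\<forall>v\<in>V. \<exists>c. v = L2_class ?N (\<lambda>x. \<Sum>k<m. c k * b k x)"
    using L2_finite_dim_span[OF assms(8)] by (elim exE conjE) (rule that)
  \<comment> \<open>Honest functions instead of classes: every representative of every class in
    \<open>V\<close> is lifted, so \<open>F\<close> is closed under transvections pointwise.\<close>
  define F where "F = {\<lambda>t. h (\<Phi> t) | h. h \<in> sq_integrable ?N \<and> L2_class ?N h \<in> V}"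
  define Bad where "Bad = (\<Union>i<k. C.bad i)"

  have closed: "\<exists>f'\<in>F. \<forall>t\<in>space ?M. f' t = f (t(i := t j \<otimes>\<^bsub>G\<^esub> t i))"
    if f: "f \<in> F" and ij: "i \<in> {..<n}" "j \<in> {..<n}" "i \<noteq> j" for f i j
  proof -
    obtain h where h: "f = (\<lambda>t. h (\<Phi> t))" "h \<in> sq_integrable ?N" "L2_class ?N h \<in> V"
      using f by (auto simp: F_def)
    obtain c where c: "c \<in> carrier (Out (free_group n))"
      and act: "\<forall>t\<in>(\<Pi>\<^sub>E i\<in>{..<n}. carrier G).
        out_act n (inv\<^bsub>Out (free_group n)\<^esub> c) (orbit G (conj_rep n G) (C.rep_of n t)) =
        orbit G (conj_rep n G) (C.rep_of n (t(i := t j \<otimes>\<^bsub>G\<^esub> t i)))"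
      using C.transvection_out_act[of i n j] ij by auto
    define \<theta> :: "'a rep set \<Rightarrow> 'a rep set" where "\<theta> = out_act n (inv\<^bsub>Out (free_group n)\<^esub> c)"
    have shift_sp: "t(i := t j \<otimes>\<^bsub>G\<^esub> t i) \<in> space ?M" if "t \<in> space ?M" for t
      using that ij by (auto simp: spM PiE_iff extensional_def)
    have \<theta>: "\<theta> (\<Phi> t) = \<Phi> (t(i := t j \<otimes>\<^bsub>G\<^esub> t i))" if t: "t \<in> space ?M" for t
      using act t shift_sp[OF t] by (simp add: \<theta>_def \<Phi>_def spM C.the_inv_eval_gens)
    have tj: "(\<lambda>t. t j) \<in> measurable ?M \<mu>" by (rule measurable_component_singleton[OF ij(2)])
    have tji: "\<And>t x. t \<in> space ?M \<Longrightarrow> x \<in> carrier G \<Longrightarrow> (t(i := x)) j = t j" using ij by simp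
    note sm = P.shift_measurable[OF ij(1) tj, unfolded P.shift_def[abs_def]]
    \<comment> \<open>Measurability of \<open>\<theta>\<close> on the quotient is never shown
      directly; the lift of \<open>g\<close> after \<open>\<theta>\<close> is the lift of
      \<open>g\<close> after a measure-preserving shift, and the quotient structure does the
      rest.\<close>
    have sq: "(\<lambda>x. g (\<theta> x)) \<in> sq_integrable ?N" if g: "g \<in> sq_integrable ?N" for g
    proof -
      have g': "(\<lambda>t. g (\<Phi> t)) \<in> borel_measurable ?M" "integrable ?M (\<lambda>t. (cmod (g (\<Phi> t)))\<^sup>2)"
        using Q.sq_integrable_iff[of g] g by (auto simp: sq_integrable_def)
      have m: "(\<lambda>t. g (\<theta> (\<Phi> t))) \<in> borel_measurable ?M"
        using measurable_compose[OF sm g'(1)] by (rule measurable_cong[THEN iffD2, rotated]) (simp add: \<theta>)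
      have "integrable ?M (\<lambda>t. (cmod (g (\<Phi> (t(i := t j \<otimes>\<^bsub>G\<^esub> t i)))))\<^sup>2)"
        by (rule P.integrable_shift[OF ij(1) tj tji g'(2)])
      then have "integrable ?M (\<lambda>t. (cmod (g (\<theta> (\<Phi> t))))\<^sup>2)"
        by (rule Bochner_Integration.integrable_cong[THEN iffD2, rotated 2]) (simp_all add: \<theta>)
      then show ?thesis using m Q.sq_integrable_iff[of "\<lambda>x. g (\<theta> x)"] by (simp add: sq_integrable_def)
    qed
    have "out_rep n G \<mu> c (L2_class ?N h) = L2_class ?N (\<lambda>x. h (\<theta> x))"
      unfolding out_rep_def \<theta>_def[symmetric]
    proof (rule UN_L2_class[OF h(2) sq])
      fix g assume g: "g \<in> sq_integrable ?N" "AE x in ?N. h x = g x"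
      then have "AE t in ?M. h (\<Phi> t) = g (\<Phi> t)" using Q.AE_eq_iff[OF h(2) g(1)] by simp
      from P.AE_shift[OF ij(1) tj tji this]
      have "AE t in ?M. h (\<Phi> (t(i := t j \<otimes>\<^bsub>G\<^esub> t i))) = g (\<Phi> (t(i := t j \<otimes>\<^bsub>G\<^esub> t i)))" .
      then have "AE t in ?M. h (\<theta> (\<Phi> t)) = g (\<theta> (\<Phi> t))"
        by (rule AE_mp) (rule AE_I2, simp add: \<theta>)
      then show "AE x in ?N. h (\<theta> x) = g (\<theta> x)" using Q.AE_eq_iff[OF sq[OF h(2)] sq[OF g(1)]] by simp
    qed
    then have "L2_class ?N (\<lambda>x. h (\<theta> x)) \<in> V" using assms(9)[OF c h(3)] by simp
    then have "(\<lambda>t. h (\<theta> (\<Phi> t))) \<in> F" using sq[OF h(2)] unfolding F_def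
      by (intro CollectI exI[of _ "\<lambda>x. h (\<theta> x)"]) simp
    then show ?thesis by (rule bexI[rotated]) (simp add: h(1) \<theta>)
  qed

  have spanF: "\<exists>c. AE t in ?M. f t = (\<Sum>k<m. c k * b k (\<Phi> t))" if f: "f \<in> F" for f
  proof -
    obtain h where h: "f = (\<lambda>t. h (\<Phi> t))" "h \<in> sq_integrable ?N" "L2_class ?N h \<in> V"
      using f by (auto simp: F_def)
    obtain c where c: "L2_class ?N h = L2_class ?N (\<lambda>x. \<Sum>k<m. c k * b k x)" using span h(3) by auto
    have sq: "(\<lambda>x. \<Sum>k<m. c k * b k x) \<in> sq_integrable ?N" by (rule sq_integrable_sum) (use b in auto)
    have "(\<lambda>x. \<Sum>k<m. c k * b k x) \<in> L2_class ?N h" using c L2_class_self[OF sq] by simp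
    then have "AE x in ?N. h x = (\<Sum>k<m. c k * b k x)" by (simp add: L2_class_eq[OF h(2)])
    then have "AE t in ?M. h (\<Phi> t) = (\<Sum>k<m. c k * b k (\<Phi> t))" using Q.AE_eq_iff[OF h(2) sq] by simp
    then show ?thesis unfolding h(1) by (intro exI[of _ c])
  qed

  have Bad_sets: "Bad \<in> sets (\<mu> \<Otimes>\<^sub>M \<mu>)"
    unfolding Bad_def by (intro sets.finite_UN) (auto simp: C.bad_sets)
  have Bad_AE: "AE a in \<mu>. AE b in \<mu>. (a, b) \<notin> Bad"
  proof -
    have all: "AE a in \<mu>. \<forall>i\<in>{..<k}. AE b in \<mu>. (a, b) \<notin> C.bad i"
      by (rule AE_finite_allI) (auto intro: C.AE_not_bad)
    show ?thesis
    proof (rule AE_mp[OF all], rule AE_I2, rule impI)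
      fix a assume a: "\<forall>i\<in>{..<k}. AE b in \<mu>. (a, b) \<notin> C.bad i"
      have "AE b in \<mu>. \<forall>i\<in>{..<k}. (a, b) \<notin> C.bad i"
        by (rule AE_finite_allI) (use a in auto)
      then show "AE b in \<mu>. (a, b) \<notin> Bad" by (simp add: Bad_def)
    qed
  qed
  have const: "\<exists>a. AE t in ?M. f t = a" if f: "f \<in> F" for f
  proof (rule P.transvection_invariant_const[where GG=C.GG and Bad=Bad and m=m and h="\<lambda>k t. b k (\<Phi> t)", OF _ _ spanF closed])
    show "f \<in> sq_integrable ?M" if "f \<in> F" for f
      using that Q.sq_integrable_iff by (auto simp: F_def)
    show "(\<lambda>t. b k (\<Phi> t)) \<in> sq_integrable ?M" if "k < m" for k
      using that b Q.sq_integrable_iff by auto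
    fix a b S assume "a \<in> carrier G" "b \<in> carrier G" "(a, b) \<notin> Bad" "C.seq_closed_subgroup S"
      and "\<And>g c w. g \<in> C.GG \<Longrightarrow> c \<in> {a, b} \<Longrightarrow> limitin T (\<lambda>p. C.pert g p c) w sequentially \<Longrightarrow> w \<in> S"
    then show "S = carrier G" by (intro C.stab_full[of S a b]) (auto simp: Bad_def)
  qed (use C.countable_GG C.GG_props Bad_sets Bad_AE f assms(6) in auto)

  fix v assume v: "v \<in> V"
  then obtain h where h: "h \<in> sq_integrable ?N" "v = L2_class ?N h" using L2_repr V_L2 by blast
  then have "(\<lambda>t. h (\<Phi> t)) \<in> F" using v unfolding F_def by (intro CollectI exI[of _ h]) simp
  from const[OF this] obtain a where a: "AE t in ?M. h (\<Phi> t) = a" by auto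
  have sq: "(\<lambda>_. a) \<in> sq_integrable ?N"
    by (simp add: Q.sq_integrable_iff) (simp add: sq_integrable_def)
  have "v = L2_class ?N (\<lambda>_. a)"
    unfolding h(2) by (rule L2_class_cong[OF h(1) sq]) (simp add: Q.AE_eq_iff[OF h(1) sq] a)
  then show "\<exists>a. v = L2_class ?N (\<lambda>_. a)" by (rule exI)
qed

end
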